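(* Let $\Sigma\subset\mathbb{R}^3$ be a generic, pure $3$-dimensional, hereditary, simplicial fan such that $\mathrm{lk}(\Sigma)$ is simply connected, equipped with uniform smoothness $1$ (i.e. $\alpha(\tau)=1$ for interior $\tau\in\Sigma_2$ and $\alpha(\tau)=-1$ for $\tau\in\Sigma_2\cap\partial\Sigma$, so $\Sigma^{-1}=\partial\Sigma$). Then for all $d\ge0$, \[\dim_{\mathbb{R}}C^1(\Sigma)_d=\chi(\mathcal{R}/\mathcal{J}[\Sigma,\partial\Sigma],d):=\sum_{i=0}^3(-1)^i\sum_{\gamma\in\Sigma_{3-i}\setminus(\partial\Sigma)_{3-i}}HF(S/J(\gamma),d);\] equivalently, $H_2(\mathcal{R}/\mathcal{J}[\Sigma,\partial\Sigma])=0$.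
   Context: $S=\mathbb{R}[x,y,z]$, $HF(M,d)=\dim_{\mathbb{R}}M_d$. A cone is the positive hull of finitely many vectors in $\mathbb{R}^3$, of dimension that of its linear span $\mathrm{aff}(\gamma)$; a fan is a finite set of cones closed under faces, any two meeting in a common face; $\Sigma_i$ = $i$-dim cones; pure $3$-dim: all facets (maximal cones) are $3$-dimensional; simplicial: each cone generated by linearly independent vectors; hereditary: for each face $\psi$ the graph on facets containing $\psi$ (edges for pairs sharing a $2$-face) is connected. $\partial\Sigma$ = subfan of faces contained in a $2$-face lying in exactly one facet. $\mathrm{lk}(\Sigma)$ is the polytopal complex of the convex hulls of the unit ray generators of the cones (topologically $\Sigma\cap\mathbb{S}^2$). "Generic" means: for the given combinatorial type, the ray coordinates are chosen in a suitable nonempty Zariski-open (general position) set. $l_\tau$ generates the ideal of $\mathrm{aff}(\tau)$; $J(\tau)=\langle l_\tau^2\rangle$ for interior $\tau\in\Sigma_2$; $J(\gamma)=\sum_{\tau\supseteq\gamma\text{ interior}}J(\tau)$ for non-facets, $J(\sigma)=0$ for facets. $C^1(\Sigma)$ is the graded $S$-module of tuples $(F_\sigma)_{\sigma\in\Sigma_3}$ with $l_\tau^2\mid F_{\sigma_1}-F_{\sigma_2}$ whenever $\sigma_1\cap\sigma_2=\tau\in\Sigma_2$; degree-$d$ part = tuples of forms of degree $d$. With $u_\rho$ unit ray generators, $P(\gamma)=\mathrm{conv}(\{0\}\cup\{u_\rho:\rho\subseteq\gamma\})$; $\mathcal{R}/\mathcal{J}[\Sigma,\partial\Sigma]_i=\bigoplus_{\gamma\in\Sigma_i\setminus(\partial\Sigma)_i}S/J(\gamma)$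 with differential induced by the cellular boundary of the relative cellular chain complex of $(P(\Sigma),\mathrm{lk}(\Sigma)\cup P(\partial\Sigma))$ with $S$ coefficients. *)

theory Defs
  imports "HOL-Analysis.Analysis" "HOL-Library.Function_Algebras"
begin

definition mono3 :: "nat \<times> nat \<times> nat \<Rightarrow> real^3 \<Rightarrow> real" where
  "mono3 m p = (case m of (a, b, c) \<Rightarrow> (p$1)^a * (p$2)^b * (p$3)^c)"

definition mdeg :: "nat \<times> nat \<times> nat \<Rightarrow> nat" where
  "mdeg m = (case m of (a, b, c) \<Rightarrow> a + b + c)"

definition forms :: "nat \<Rightarrow> (real^3 \<Rightarrow> real) set" where
  "forms d = {(\<lambda>p. \<Sum>m\<in>{m. mdeg m = d}. coef m * mono3 m p) | coef. True}"

definition polys :: "(real^3 \<Rightarrow> real) set" where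
  "polys = {(\<lambda>p. \<Sum>m\<in>{m. mdeg m \<le> N}. coef m * mono3 m p) | coef N. True}"

definition fdim :: "('x \<Rightarrow> real) set \<Rightarrow> nat" where
  "fdim S = vector_space.dim (\<lambda>c f. \<lambda>x. c * f x) S"

definition tdim :: "('i \<Rightarrow> 'x \<Rightarrow> real) set \<Rightarrow> nat" where
  "tdim S = vector_space.dim (\<lambda>c F. \<lambda>i x. c * F i x) S"

section \<open>Simplicial fans, given by a combinatorial type K on ray labels 'v and ray vectors u\<close>

definition pos_hull :: "('v \<Rightarrow> real^3) \<Rightarrow> 'v set \<Rightarrow> (real^3) set" where
  "pos_hull u A = {(\<Sum>v\<in>A. c v *\<^sub>R u v) | c. \<forall>v\<in>A. c v \<ge> 0}"

definition simplicial_fan :: "('v::finite) set set \<Rightarrow> ('v \<Rightarrow> real^3) \<Rightarrow> bool" where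
  "simplicial_fan K u \<longleftrightarrow> {} \<in> K \<and> (\<forall>v. {v} \<in> K) \<and> (\<forall>A\<in>K. \<forall>B. B \<subseteq> A \<longrightarrow> B \<in> K) \<and>
     (\<forall>A\<in>K. inj_on u A \<and> independent (u ` A)) \<and>
     (\<forall>A\<in>K. \<forall>B\<in>K. pos_hull u A \<inter> pos_hull u B = pos_hull u (A \<inter> B))"

definition facets :: "'v set set \<Rightarrow> 'v set set" where
  "facets K = {\<sigma>\<in>K. \<forall>A\<in>K. \<sigma> \<subseteq> A \<longrightarrow> A = \<sigma>}"

definition pure3 :: "'v set set \<Rightarrow> bool" where
  "pure3 K \<longleftrightarrow> (\<forall>\<sigma>\<in>facets K. card \<sigma> = 3)"

definition facet_adj :: "'v set set \<Rightarrow> 'v set \<Rightarrow> 'v set \<Rightarrow> 'v set \<Rightarrow> bool" where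
  "facet_adj K \<psi> a b \<longleftrightarrow> a \<in> facets K \<and> b \<in> facets K \<and> \<psi> \<subseteq> a \<and> \<psi> \<subseteq> b \<and> card (a \<inter> b) = 2"

definition hereditary :: "'v set set \<Rightarrow> bool" where
  "hereditary K \<longleftrightarrow> (\<forall>\<psi>\<in>K. \<forall>a b. a \<in> facets K \<and> \<psi> \<subseteq> a \<and> b \<in> facets K \<and> \<psi> \<subseteq> b
      \<longrightarrow> (facet_adj K \<psi>)\<^sup>*\<^sup>* a b)"

definition bdry_2faces :: "'v set set \<Rightarrow> 'v set set" where
  "bdry_2faces K = {\<tau>\<in>K. card \<tau> = 2 \<and> card {\<sigma>\<in>facets K. \<tau> \<subseteq> \<sigma>} = 1}"

definition bdry :: "'v set set \<Rightarrow> 'v set set" where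
  "bdry K = {A\<in>K. \<exists>\<tau>\<in>bdry_2faces K. A \<subseteq> \<tau>}"

definition interior2 :: "'v set set \<Rightarrow> 'v set set" where
  "interior2 K = {\<tau>\<in>K. card \<tau> = 2 \<and> \<tau> \<notin> bdry K}"

definition lk_space :: "'v set set \<Rightarrow> ('v \<Rightarrow> real^3) \<Rightarrow> (real^3) set" where
  "lk_space K u = (\<Union>A\<in>K. convex hull ((\<lambda>v. (1 / norm (u v)) *\<^sub>R u v) ` A))"

text \<open>normal vector of aff(\<tau>); l_\<tau>(p) = normal \<bullet> p\<close>
definition normal :: "('v \<Rightarrow> real^3) \<Rightarrow> 'v set \<Rightarrow> real^3" where
  "normal u \<tau> = (SOME n. n \<noteq> 0 \<and> (\<forall>v\<in>\<tau>. n \<bullet> u v = 0))"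

definition sq_ideal :: "('v \<Rightarrow> real^3) \<Rightarrow> 'v set set \<Rightarrow> (real^3 \<Rightarrow> real) set" where
  "sq_ideal u T = {(\<lambda>p. \<Sum>\<tau>\<in>T. (normal u \<tau> \<bullet> p)^2 * G \<tau> p) | G. \<forall>\<tau>\<in>T. G \<tau> \<in> polys}"

definition Jid :: "'v set set \<Rightarrow> ('v \<Rightarrow> real^3) \<Rightarrow> 'v set \<Rightarrow> (real^3 \<Rightarrow> real) set" where
  "Jid K u \<gamma> = (if \<gamma> \<in> facets K then {(\<lambda>p. 0)} else sq_ideal u {\<tau>\<in>interior2 K. \<gamma> \<subseteq> \<tau>})"

definition HF_quot :: "'v set set \<Rightarrow> ('v \<Rightarrow> real^3) \<Rightarrow> 'v set \<Rightarrow> nat \<Rightarrow> int" where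
  "HF_quot K u \<gamma> d = int (fdim (forms d)) - int (fdim (Jid K u \<gamma> \<inter> forms d))"

definition chi_RJ :: "'v set set \<Rightarrow> ('v \<Rightarrow> real^3) \<Rightarrow> nat \<Rightarrow> int" where
  "chi_RJ K u d = (\<Sum>i\<in>{0..3::nat}. (-1)^i *
      (\<Sum>\<gamma>\<in>{A\<in>K. card A = 3 - i \<and> A \<notin> bdry K}. HF_quot K u \<gamma> d))"

definition C1 :: "'v set set \<Rightarrow> ('v \<Rightarrow> real^3) \<Rightarrow> nat \<Rightarrow> ('v set \<Rightarrow> real^3 \<Rightarrow> real) set" where
  "C1 K u d = {F. (\<forall>\<sigma>\<in>facets K. F \<sigma> \<in> forms d) \<and> (\<forall>A. A \<notin> facets K \<longrightarrow> F A = (\<lambda>p. 0)) \<and>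
     (\<forall>\<sigma>1\<in>facets K. \<forall>\<sigma>2\<in>facets K. card (\<sigma>1 \<inter> \<sigma>2) = 2 \<longrightarrow>
         (\<lambda>p. F \<sigma>1 p - F \<sigma>2 p) \<in> sq_ideal u {\<sigma>1 \<inter> \<sigma>2})}"

section \<open>Polynomial functions of the ray coordinates (for genericity)\<close>

inductive coord_poly :: "(('v \<Rightarrow> real^3) \<Rightarrow> real) \<Rightarrow> bool" where
  cp_const: "coord_poly (\<lambda>u. c)"
| cp_coord: "coord_poly (\<lambda>u. u v $ i)"
| cp_add: "coord_poly P \<Longrightarrow> coord_poly Q \<Longrightarrow> coord_poly (\<lambda>u. P u + Q u)"
| cp_mult: "coord_poly P \<Longrightarrow> coord_poly Q \<Longrightarrow> coord_poly (\<lambda>u. P u * Q u)"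

end

theory Submission
  imports Defs "HOL-Computational_Algebra.Polynomial"
begin

text \<open>
  A spline is determined, up to a global form, by its jumps across the interior 2-faces \<open>\<tau>\<close>, which lie in
  \<open>J(\<tau>)\<close>. As the link is simply connected, a system of jumps is realised by a spline as soon as it sums to zero
  around every interior ray. The formula therefore says that the boundary map from the ideals of the 2-faces to
  the ideals of the interior rays is onto (for a complete fan: onto the kernel of the sum map to the ideal of
  the origin); the Euler characteristic of the fan comes out of the same count with all ideals replaced by \<open>S\<close>.

  All these ideals are generated by squares of linear forms, so surjectivity needs to be checked in degree 2 only.
  There the dual statement is a rigidity property: quadratic forms \<open>A\<^sub>v\<close>, one for each ray, such that
  \<open>A\<^sub>v\<close> and \<open>A\<^sub>w\<close> agree on the normal of the plane of every 2-face \<open>vw\<close>, are induced by one global form.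
  For generic rays this holds for the graph of every minimal 2-cycle modulo 2, by Fogelsanger's argument:
  contract an edge, decompose the result into minimal cycles, undo the contraction on each of them by vertex
  splitting, and glue. The fan with its boundary coned off to a new vertex is such a cycle. For a complete fan
  one also needs that the syzygies of the ideal of all quadrics are linear and, for four rays in general
  position, generated by those of the ideals of the rays.
\<close>

section \<open>Properties holding for generic ray coordinates\<close>

definition generically :: "(('v \<Rightarrow> real^3) \<Rightarrow> bool) \<Rightarrow> bool" where
  "generically \<phi> \<longleftrightarrow> (\<exists>P. coord_poly P \<and> (\<exists>u. P u \<noteq> 0) \<and> (\<forall>u. P u \<noteq> 0 \<longrightarrow> \<phi> u))"

lemma coord_poly_on_line:
  assumes "coord_poly P"
  shows "\<exists>q :: real poly. \<forall>t. P (\<lambda>v. u v + t *\<^sub>R w v) = poly q t"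
  using assms
proof induction
  case (cp_const c)
  show ?case by (rule exI[of _ "[:c:]"]) simp
next
  case (cp_coord v i)
  show ?case by (rule exI[of _ "[:u v $ i, w v $ i:]"]) simp
next
  case (cp_add P Q)
  then show ?case by (metis poly_add)
next
  case (cp_mult P Q)
  then show ?case by (metis poly_mult)
qed

lemma coord_poly_mult_nonzero:
  assumes P: "coord_poly P" "P a \<noteq> 0" and Q: "coord_poly Q" "Q b \<noteq> 0"
  shows "\<exists>u. P u * Q u \<noteq> 0"
proof -
  let ?line = "\<lambda>t v. a v + t *\<^sub>R (b v - a v)"
  obtain p where p: "\<And>t. P (?line t) = poly p t"
    using coord_poly_on_line[OF P(1), of a "\<lambda>v. b v - a v"] by blast
  obtain q where q: "\<And>t. Q (?line t) = poly q t"
    using coord_poly_on_line[OF Q(1), of a "\<lambda>v. b v - a v"] by blast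
  have "p \<noteq> 0" using p[of 0] P(2) by auto
  moreover have "q \<noteq> 0" using q[of 1] Q(2) by auto
  ultimately have "p * q \<noteq> 0" by simp
  then obtain t where "poly (p * q) t \<noteq> 0" using poly_all_0_iff_0 by blast
  then have "P (?line t) * Q (?line t) \<noteq> 0" by (simp add: p q)
  then show ?thesis by blast
qed

lemma generically_conj:
  assumes "generically \<phi>" "generically \<psi>"
  shows "generically (\<lambda>u. \<phi> u \<and> \<psi> u)"
proof -
  obtain P a where P: "coord_poly P" "P a \<noteq> 0" "\<And>u. P u \<noteq> 0 \<Longrightarrow> \<phi> u"
    using assms(1) by (auto simp: generically_def)
  obtain Q b where Q: "coord_poly Q" "Q b \<noteq> 0" "\<And>u. Q u \<noteq> 0 \<Longrightarrow> \<psi> u"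
    using assms(2) by (auto simp: generically_def)
  have "coord_poly (\<lambda>u. P u * Q u)" using P Q by (auto intro: cp_mult)
  then show ?thesis unfolding generically_def
    using coord_poly_mult_nonzero[OF P(1,2) Q(1,2)] P(3) Q(3)
    by (intro exI[of _ "\<lambda>u. P u * Q u"]) auto
qed

lemma generically_mono: "generically \<phi> \<Longrightarrow> (\<And>u. \<phi> u \<Longrightarrow> \<psi> u) \<Longrightarrow> generically \<psi>"
  unfolding generically_def by meson

lemma generically_ex: "generically \<phi> \<Longrightarrow> \<exists>u. \<phi> u"
  unfolding generically_def by blast

lemma generically_True: "generically (\<lambda>u. True)"
  unfolding generically_def by (rule exI[of _ "\<lambda>u. 1"]) (auto intro: cp_const)

lemma generically_ball_finite:
  assumes "finite I" "\<And>i. i \<in> I \<Longrightarrow> generically (\<phi> i)"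
  shows "generically (\<lambda>u. \<forall>i\<in>I. \<phi> i u)"
  using assms
proof (induction I rule: finite_induct)
  case empty then show ?case using generically_True by simp
next
  case (insert i I)
  then have "generically (\<lambda>u. \<phi> i u \<and> (\<forall>i\<in>I. \<phi> i u))" by (intro generically_conj) auto
  then show ?case by simp
qed

lemma coord_poly_sum: "(\<And>i. i \<in> I \<Longrightarrow> coord_poly (f i)) \<Longrightarrow> coord_poly (\<lambda>u. \<Sum>i\<in>I. f i u)"
  by (induction I rule: infinite_finite_induct) (auto intro: coord_poly.intros)

lemma coord_poly_prod: "(\<And>i. i \<in> I \<Longrightarrow> coord_poly (f i)) \<Longrightarrow> coord_poly (\<lambda>u. \<Prod>i\<in>I. f i u)"
  by (induction I rule: infinite_finite_induct) (auto intro: coord_poly.intros)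

lemma coord_poly_uminus: "coord_poly f \<Longrightarrow> coord_poly (\<lambda>u. - f u)"
  using cp_mult[OF cp_const[of "-1"], of f] by simp

lemma coord_poly_diff: "coord_poly f \<Longrightarrow> coord_poly g \<Longrightarrow> coord_poly (\<lambda>u. f u - g u)"
  using cp_add[of f "\<lambda>u. - g u"] coord_poly_uminus[of g] by simp

lemma coord_poly_cross: "coord_poly (\<lambda>u. cross3 (u x) (u y) $ i)"
  using exhaust_3[of i]
  by (auto simp: cross_components intro!: coord_poly_diff coord_poly.intros)

lemma coord_poly_triple: "coord_poly (\<lambda>u. u x \<bullet> cross3 (u y) (u z))"
  by (auto simp: inner_vec_def intro!: coord_poly_sum cp_mult cp_coord coord_poly_cross)

lemma coord_poly_det: "(\<And>i j. coord_poly (\<lambda>u. M u $ i $ j)) \<Longrightarrow> coord_poly (\<lambda>u. det (M u))"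
  unfolding det_def by (intro coord_poly_sum cp_mult cp_const coord_poly_prod) auto

definition triples_independent :: "('v \<Rightarrow> real^3) \<Rightarrow> bool" where
  "triples_independent u \<longleftrightarrow> (\<forall>x y z. distinct [x,y,z] \<longrightarrow> u x \<bullet> cross3 (u y) (u z) \<noteq> 0)"

lemma triples_independentD: "triples_independent u \<Longrightarrow> distinct [x,y,z] \<Longrightarrow> u x \<bullet> cross3 (u y) (u z) \<noteq> 0"
  unfolding triples_independent_def by blast

lemma generically_triples_independent: "generically (triples_independent :: ('v::finite \<Rightarrow> _) \<Rightarrow> bool)"
proof -
  let ?triples = "{(x,y,z). distinct [x,y,z :: 'v]}"
  have "generically (\<lambda>u. case t of (x,y,z) \<Rightarrow> u x \<bullet> cross3 (u y) (u z) \<noteq> 0)" if triple: "t \<in> ?triples" for t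
  proof -
    obtain x y z where t: "t = (x,y,z)" "distinct [x,y,z]" using triple by blast
    let ?basis = "\<lambda>w::'v. if w = x then axis 1 1 else if w = y then axis 2 1 else (axis 3 1 :: real^3)"
    have "?basis x \<bullet> cross3 (?basis y) (?basis z) \<noteq> 0" using t(2)
      by (auto simp: inner_vec_def sum_3 cross_components axis_def)
    then have "\<exists>u. u x \<bullet> cross3 (u y) (u z) \<noteq> 0" by (intro exI[of _ ?basis])
    then show ?thesis unfolding generically_def t(1) prod.case
      by (intro exI[of _ "\<lambda>u. u x \<bullet> cross3 (u y) (u z)"]) (auto intro: coord_poly_triple)
  qed
  then have "generically (\<lambda>u. \<forall>t\<in>?triples. case t of (x,y,z) \<Rightarrow> u x \<bullet> cross3 (u y) (u z) \<noteq> 0)"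
    by (intro generically_ball_finite) auto
  then show ?thesis by (rule generically_mono) (auto simp: triples_independent_def)
qed

definition outer :: "real^'n \<Rightarrow> real^'n \<Rightarrow> real^'n^'n" where
  "outer a b = (\<chi> i j. a $ i * b $ j)"

lemma outer_mult_vec: "outer a b *v x = (b \<bullet> x) *\<^sub>R a"
  by (simp add: vec_eq_iff outer_def matrix_vector_mult_def inner_vec_def sum_distrib_left mult_ac)

definition gram :: "'k set \<Rightarrow> ('k \<Rightarrow> real^'n) \<Rightarrow> real^'n^'n" where
  "gram I r = (\<Sum>k\<in>I. outer (r k) (r k))"

lemma sum_matrix_vector_mult: "(\<Sum>k\<in>I. M k) *v x = (\<Sum>k\<in>I. M k *v x)"
  for M :: "_ \<Rightarrow> real^'n^'m"
  by (induction I rule: infinite_finite_induct) (simp_all add: matrix_vector_mult_add_rdistrib)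

lemma gram_kernel:
  assumes "finite I"
  shows "gram I r *v y = 0 \<longleftrightarrow> (\<forall>k\<in>I. r k \<bullet> y = 0)"
proof
  have gram_mult: "gram I r *v y = (\<Sum>k\<in>I. (r k \<bullet> y) *\<^sub>R r k)"
    by (simp add: gram_def sum_matrix_vector_mult outer_mult_vec)
  show "gram I r *v y = 0" if "\<forall>k\<in>I. r k \<bullet> y = 0" unfolding gram_mult using that by simp
  assume "gram I r *v y = 0"
  then have "0 = (\<Sum>k\<in>I. (r k \<bullet> y) *\<^sub>R r k) \<bullet> y" by (simp add: gram_mult)
  also have "\<dots> = (\<Sum>k\<in>I. (r k \<bullet> y)\<^sup>2)" by (simp add: inner_sum_left power2_eq_square)
  finally show "\<forall>k\<in>I. r k \<bullet> y = 0" using assms by (simp add: sum_nonneg_eq_0_iff)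
qed

lemma linear_functional_eq_inner:
  fixes f :: "real^'n \<Rightarrow> real"
  assumes "linear f"
  shows "f y = (\<chi> i. f (axis i 1)) \<bullet> y"
proof -
  have "f y = f (\<Sum>i\<in>UNIV. (y $ i) *s axis i 1)" by (simp add: basis_expansion)
  then show ?thesis
    by (simp add: linear_sum[OF assms] linear_cmul[OF assms] scalar_mult_eq_scaleR inner_vec_def mult.commute)
qed

lemma generically_trivial_common_kernel:
  fixes f :: "'k \<Rightarrow> ('v \<Rightarrow> real^3) \<Rightarrow> real^'n \<Rightarrow> real"
  assumes finite_index: "finite I" and lin: "\<And>k u. k \<in> I \<Longrightarrow> linear (f k u)"
    and coefficients: "\<And>k y. k \<in> I \<Longrightarrow> coord_poly (\<lambda>u. f k u y)"
    and witness: "\<exists>u. \<forall>y. (\<forall>k\<in>I. f k u y = 0) \<longrightarrow> y = 0"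
  shows "generically (\<lambda>u. \<forall>y. (\<forall>k\<in>I. f k u y = 0) \<longrightarrow> y = 0)"
proof -
  define r where "r u k = (\<chi> i. f k u (axis i 1))" for u k
  have "f k u y = r u k \<bullet> y" if "k \<in> I" for k u y
    unfolding r_def by (rule linear_functional_eq_inner[OF lin[OF that]])
  then have kernel: "gram I (r u) *v y = 0 \<longleftrightarrow> (\<forall>k\<in>I. f k u y = 0)" for u y
    by (simp add: gram_kernel[OF finite_index])
  have injective_iff: "(\<forall>y. (\<forall>k\<in>I. f k u y = 0) \<longrightarrow> y = 0) \<longleftrightarrow> det (gram I (r u)) \<noteq> 0" for u
    using kernel[of u] matrix_left_invertible_ker[of "gram I (r u)"] invertible_det_nz[of "gram I (r u)"]
    by (metis invertible_left_inverse)
  have "coord_poly (\<lambda>u. gram I (r u) $ i $ j)" for i j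
    unfolding gram_def outer_def r_def sum_component vec_lambda_beta
    by (intro coord_poly_sum cp_mult coefficients)
  then have "coord_poly (\<lambda>u. det (gram I (r u)))" by (rule coord_poly_det)
  then show ?thesis unfolding injective_iff generically_def using witness unfolding injective_iff by blast
qed

section \<open>Infinitesimal rigidity of graphs for quadratic forms\<close>

definition qf :: "real^'n^'n \<Rightarrow> real^'n \<Rightarrow> real" where
  "qf M n = n \<bullet> (M *v n)"

lemma qf_linear_combination:
  "qf M (a *\<^sub>R x + b *\<^sub>R y) = a\<^sup>2 * qf M x + b\<^sup>2 * qf M y + a * b * (x \<bullet> (M *v y) + y \<bullet> (M *v x))"
  by (simp add: qf_def matrix_vector_right_distrib matrix_vector_mult_scaleR inner_add_left
      inner_add_right algebra_simps power2_eq_square)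

lemma qf_scale: "qf M (c *\<^sub>R x) = c\<^sup>2 * qf M x"
  using qf_linear_combination[of M c x 0 0] by simp

lemma qf_add: "qf M (x + y) = qf M x + qf M y + (x \<bullet> (M *v y) + y \<bullet> (M *v x))"
  using qf_linear_combination[of M 1 x 1 y] by simp

lemma qf_minus [simp]: "qf M (- x) = qf M x"
  using qf_scale[of M "-1" x] by simp

lemma qf_cross_commute: "qf M (cross3 x y) = qf M (cross3 y x)"
  by (subst cross_skew) simp

lemma qf_diff_matrix: "qf (M - N) n = qf M n - qf N n"
  by (simp add: qf_def matrix_vector_mult_diff_rdistrib inner_diff_right)

lemma qf_add_matrix: "qf (M + N) n = qf M n + qf N n"
  by (simp add: qf_def matrix_vector_mult_add_rdistrib inner_add_right)

lemma qf_scale_matrix: "qf (c *\<^sub>R M) n = c * qf M n"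
  by (simp add: qf_def scaleR_matrix_vector_assoc[symmetric])

lemma qf_zero [simp]: "qf 0 n = 0" "qf M 0 = 0"
  by (simp_all add: qf_def)

lemma qf_eq_sum: "qf M n = (\<Sum>i\<in>UNIV. \<Sum>j\<in>UNIV. n $ i * M $ i $ j * n $ j)"
  by (simp add: qf_def inner_vec_def matrix_vector_mult_def sum_distrib_left mult.assoc)

lemma qf_outer: "qf (outer a b) n = (a \<bullet> n) * (b \<bullet> n)"
  by (simp add: qf_def outer_mult_vec inner_commute)

lemma inner_outer: "M \<bullet> outer a b = a \<bullet> (M *v b)"
  by (simp add: outer_def inner_vec_def matrix_vector_mult_def sum_distrib_left mult_ac)

lemma inner_outer_self: "M \<bullet> outer a a = qf M a"
  by (simp add: inner_outer qf_def)

lemma triple_product_cyclic: "a \<bullet> cross3 b c = b \<bullet> cross3 c a"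
  by (metis cross_triple inner_commute)

lemma triple_product_swap: "a \<bullet> cross3 b c = - (a \<bullet> cross3 c b)" "a \<bullet> cross3 b c = - (b \<bullet> cross3 a c)"
  by (simp_all add: cross_components inner_vec_def sum_3 algebra_simps)

lemma triple_product_scaleR:
  "(a \<bullet> cross3 b c) *\<^sub>R n = (n \<bullet> a) *\<^sub>R cross3 b c + (n \<bullet> b) *\<^sub>R cross3 c a + (n \<bullet> c) *\<^sub>R cross3 a b"
  by (simp add: vec_eq_iff forall_3 cross_components inner_vec_def sum_3) (simp add: algebra_simps)

lemma triple_product_cramer:
  "(a \<bullet> cross3 b c) *\<^sub>R x = (x \<bullet> cross3 b c) *\<^sub>R a + (a \<bullet> cross3 x c) *\<^sub>R b + (a \<bullet> cross3 b x) *\<^sub>R c"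
  by (simp add: vec_eq_iff forall_3 cross_components inner_vec_def sum_3) (simp add: algebra_simps)

lemma dual_basis_expansion:
  fixes a b c n :: "real^3"
  assumes "a \<bullet> cross3 b c \<noteq> 0"
  shows "n = (n \<bullet> a / (a \<bullet> cross3 b c)) *\<^sub>R cross3 b c + (n \<bullet> b / (a \<bullet> cross3 b c)) *\<^sub>R cross3 c a
     + (n \<bullet> c / (a \<bullet> cross3 b c)) *\<^sub>R cross3 a b"
proof -
  let ?d = "a \<bullet> cross3 b c"
  have "n = (1/?d) *\<^sub>R (?d *\<^sub>R n)" using assms by simp
  also have "\<dots> = (n \<bullet> a / ?d) *\<^sub>R cross3 b c + (n \<bullet> b / ?d) *\<^sub>R cross3 c a + (n \<bullet> c / ?d) *\<^sub>R cross3 a b"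
    unfolding triple_product_scaleR by (simp add: scaleR_add_right)
  finally show ?thesis .
qed

lemma dual_basis_expansion_perp:
  fixes a b c n :: "real^3"
  assumes "a \<bullet> cross3 b c \<noteq> 0" "n \<bullet> a = 0"
  shows "n = (n \<bullet> b / (a \<bullet> cross3 b c)) *\<^sub>R cross3 c a + (n \<bullet> c / (a \<bullet> cross3 b c)) *\<^sub>R cross3 a b"
  using dual_basis_expansion[OF assms(1), of n] assms(2) by simp

definition agree_on_perp :: "real^'n \<Rightarrow> real^'n^'n \<Rightarrow> real^'n^'n \<Rightarrow> bool" where
  "agree_on_perp p M N \<longleftrightarrow> (\<forall>n. n \<bullet> p = 0 \<longrightarrow> qf M n = qf N n)"

lemma agree_on_perpD: "agree_on_perp p M N \<Longrightarrow> n \<bullet> p = 0 \<Longrightarrow> qf M n = qf N n"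
  by (simp add: agree_on_perp_def)

lemma agree_on_perp_cross:
  assumes "agree_on_perp p M N"
  shows "qf M (cross3 p x) = qf N (cross3 p x)" "qf M (cross3 x p) = qf N (cross3 x p)"
  using assms by (simp_all add: agree_on_perp_def dot_cross_self)

text \<open>On the plane orthogonal to \<open>p\<close> the difference is a binary quadratic form with three distinct
  projective zeros.\<close>
lemma agree_on_perp_three_directions:
  assumes indep: "p \<bullet> cross3 w1 w2 \<noteq> 0" "p \<bullet> cross3 w1 w3 \<noteq> 0" "p \<bullet> cross3 w2 w3 \<noteq> 0"
    and zeros: "qf M (cross3 p w1) = qf N (cross3 p w1)" "qf M (cross3 p w2) = qf N (cross3 p w2)"
      "qf M (cross3 p w3) = qf N (cross3 p w3)"
  shows "agree_on_perp p M N"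
proof -
  let ?D = "M - N" and ?d = "p \<bullet> cross3 w1 w2" and ?x = "cross3 w2 p" and ?y = "cross3 p w1"
  let ?mixed = "?x \<bullet> (?D *v ?y) + ?y \<bullet> (?D *v ?x)"
  have basis_zeros: "qf ?D ?x = 0" "qf ?D ?y = 0"
    using zeros(1,2) by (simp_all add: qf_diff_matrix qf_cross_commute[of _ w2 p])
  have mixed_form: "qf ?D n = (n \<bullet> w1 / ?d) * (n \<bullet> w2 / ?d) * ?mixed" if "n \<bullet> p = 0" for n
    by (subst dual_basis_expansion_perp[OF indep(1) that], subst qf_linear_combination) (simp add: basis_zeros)
  have "cross3 p w3 \<bullet> p = 0" by (simp add: dot_cross_self)
  from mixed_form[OF this] zeros(3)
  have "(cross3 p w3 \<bullet> w1 / ?d) * (cross3 p w3 \<bullet> w2 / ?d) * ?mixed = 0" by (simp add: qf_diff_matrix)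
  moreover have "cross3 p w3 \<bullet> w \<noteq> 0" if "p \<bullet> cross3 w w3 \<noteq> 0" for w
    using that triple_product_swap(2)[of p w w3] by (simp add: inner_commute)
  ultimately have "?mixed = 0" using indep by simp
  then show ?thesis using mixed_form by (simp add: agree_on_perp_def qf_diff_matrix)
qed

lemma qf_eq_if_agree_on_three_planes:
  assumes indep: "a \<bullet> cross3 b c \<noteq> 0"
    and agree: "agree_on_perp a M N" "agree_on_perp b M N" "agree_on_perp c M N"
  shows "qf M n = qf N n"
proof -
  let ?D = "M - N"
  have vanish: "qf ?D m = 0" if "m \<bullet> a = 0 \<or> m \<bullet> b = 0 \<or> m \<bullet> c = 0" for m
    using that agree by (auto simp: agree_on_perp_def qf_diff_matrix)
  define x y z where xyz: "x = (n \<bullet> a / (a \<bullet> cross3 b c)) *\<^sub>R cross3 b c"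
    "y = (n \<bullet> b / (a \<bullet> cross3 b c)) *\<^sub>R cross3 c a" "z = (n \<bullet> c / (a \<bullet> cross3 b c)) *\<^sub>R cross3 a b"
  have perp: "x \<bullet> b = 0" "x \<bullet> c = 0" "y \<bullet> c = 0" "y \<bullet> a = 0" "z \<bullet> a = 0" "z \<bullet> b = 0"
    by (simp_all add: xyz dot_cross_self)
  have "qf ?D (x + y + z) = qf ?D (x + y) + qf ?D (y + z) + qf ?D (x + z) - qf ?D x - qf ?D y - qf ?D z"
    by (simp add: qf_add matrix_vector_right_distrib inner_add_left inner_add_right)
  also have "\<dots> = 0" by (simp add: vanish perp inner_add_left)
  finally show ?thesis using dual_basis_expansion[OF indep, of n] by (simp add: xyz qf_diff_matrix)
qed

text \<open>The form \<open>M\<close> is determined by its values and polarisations on the basis dual to \<open>a\<close>, \<open>b\<close>, \<open>c\<close>.\<close>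
lemma triangle_global_form:
  assumes indep: "a \<bullet> cross3 b c \<noteq> 0"
    and edges: "qf A (cross3 a b) = qf B (cross3 a b)" "qf B (cross3 b c) = qf C (cross3 b c)"
     "qf A (cross3 c a) = qf C (cross3 c a)"
  obtains M where "agree_on_perp a A M" "agree_on_perp b B M" "agree_on_perp c C M"
proof
  let ?d = "a \<bullet> cross3 b c"
  let ?bc = "cross3 b c" let ?ca = "cross3 c a" let ?ab = "cross3 a b"
  let ?polar = "\<lambda>A x y. x \<bullet> (A *v y) + y \<bullet> (A *v x)"
  define M where "M = (1 / ?d\<^sup>2) *\<^sub>R (qf B ?bc *\<^sub>R outer a a + qf A ?ca *\<^sub>R outer b b + qf A ?ab *\<^sub>R outer c c
     + ?polar A ?ca ?ab *\<^sub>R outer b c + ?polar B ?ab ?bc *\<^sub>R outer c a + ?polar C ?bc ?ca *\<^sub>R outer a b)"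
  have qf_M: "qf M n = (qf B ?bc * (a \<bullet> n)\<^sup>2 + qf A ?ca * (b \<bullet> n)\<^sup>2 + qf A ?ab * (c \<bullet> n)\<^sup>2
     + ?polar A ?ca ?ab * (b \<bullet> n) * (c \<bullet> n) + ?polar B ?ab ?bc * (c \<bullet> n) * (a \<bullet> n)
     + ?polar C ?bc ?ca * (a \<bullet> n) * (b \<bullet> n)) / ?d\<^sup>2" for n
    unfolding M_def qf_scale_matrix qf_add_matrix qf_outer by (simp add: power2_eq_square mult.assoc)
  have cyclic: "b \<bullet> cross3 c a = ?d" "c \<bullet> cross3 a b = ?d"
    using triple_product_cyclic by metis+
  have "qf A n = qf M n" if "n \<bullet> a = 0" for n
    using dual_basis_expansion_perp[OF indep that] that qf_M[of n]
      qf_linear_combination[of A "n \<bullet> b / ?d" ?ca "n \<bullet> c / ?d" ?ab]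
    by (simp add: inner_commute[of _ n] add_divide_distrib power_divide) (simp add: power2_eq_square mult_ac)
  then show "agree_on_perp a A M" by (simp add: agree_on_perp_def)
  have "qf B n = qf M n" if "n \<bullet> b = 0" for n
    using dual_basis_expansion_perp[of b c a n] indep that qf_M[of n] edges(1)
      qf_linear_combination[of B "n \<bullet> c / ?d" ?ab "n \<bullet> a / ?d" ?bc]
    by (simp add: cyclic inner_commute[of _ n] add_divide_distrib power_divide) (simp add: power2_eq_square mult_ac)
  then show "agree_on_perp b B M" by (simp add: agree_on_perp_def)
  have "qf C n = qf M n" if "n \<bullet> c = 0" for n
    using dual_basis_expansion_perp[of c a b n] indep that qf_M[of n] edges(2,3)
      qf_linear_combination[of C "n \<bullet> a / ?d" ?bc "n \<bullet> b / ?d" ?ca]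
    by (simp add: cyclic inner_commute[of _ n] add_divide_distrib power_divide) (simp add: power2_eq_square mult_ac)
  then show "agree_on_perp c C M" by (simp add: agree_on_perp_def)
qed

lemma transpose_zero [simp]: "transpose 0 = (0 :: real^'n^'m)"
  by (simp add: transpose_def vec_eq_iff)

lemma symmetric_inner_swap: "transpose M = M \<Longrightarrow> x \<bullet> (M *v y) = y \<bullet> (M *v x)" for M :: "real^'n^'n"
  by (metis dot_lmul_matrix inner_commute transpose_matrix_vector)

lemma symmetric_eq_zero_if_qf_zero:
  assumes sym: "transpose M = M" and zero: "\<And>n. qf M n = 0"
  shows "M = 0"
proof -
  have "x \<bullet> (M *v y) = 0" for x y
    using qf_add[of M x y] symmetric_inner_swap[OF sym, of x y] by (simp add: zero)
  then have "M *v y = 0" for y using inner_eq_zero_iff by blast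
  then show ?thesis by (simp add: matrix_eq)
qed

lemma symmetric_eq_if_agree_on_perp:
  assumes sym: "transpose M = M" "transpose N = N" and kernel: "M *v p = 0" "N *v p = 0"
    and agree: "agree_on_perp p M N"
  shows "M = N"
proof -
  let ?D = "M - N"
  have sym_D: "transpose ?D = ?D" using sym by (simp add: transpose_def vec_eq_iff)
  have kernel_D: "?D *v p = 0" by (simp add: kernel matrix_vector_mult_diff_rdistrib)
  have "qf ?D n = 0" for n
  proof -
    let ?t = "(n \<bullet> p) / (p \<bullet> p)"
    let ?m = "n - ?t *\<^sub>R p"
    have "?m \<bullet> p = 0" by (cases "p = 0") (simp_all add: inner_diff_left)
    then have "qf ?D ?m = 0" using agree by (simp add: agree_on_perp_def qf_diff_matrix)
    moreover have "p \<bullet> (?D *v ?m) = 0" using symmetric_inner_swap[OF sym_D, of p ?m] kernel_D by simp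
    moreover have "qf ?D p = 0" by (simp add: qf_def kernel_D)
    ultimately have "qf ?D (1 *\<^sub>R ?m + ?t *\<^sub>R p) = 0" by (subst qf_linear_combination) (simp add: kernel_D)
    then show ?thesis by simp
  qed
  from symmetric_eq_zero_if_qf_zero[OF sym_D this] show ?thesis by simp
qed

definition proj_perp :: "real^'n \<Rightarrow> real^'n^'n" where
  "proj_perp p = mat 1 - (1 / (p \<bullet> p)) *\<^sub>R outer p p"

lemma proj_perp_mult_vec: "proj_perp p *v x = x - (p \<bullet> x / (p \<bullet> p)) *\<^sub>R p"
  by (simp add: proj_perp_def matrix_vector_mult_diff_rdistrib scaleR_matrix_vector_assoc[symmetric] outer_mult_vec)

lemma transpose_proj_perp: "transpose (proj_perp p) = proj_perp p"
  by (simp add: proj_perp_def transpose_def outer_def vec_eq_iff mat_def mult.commute)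

definition perp_part :: "real^'n \<Rightarrow> real^'n^'n \<Rightarrow> real^'n^'n" where
  "perp_part p M = proj_perp p ** ((1/2) *\<^sub>R (M + transpose M)) ** proj_perp p"

lemma transpose_perp_part: "transpose (perp_part p M) = perp_part p M"
proof -
  have "transpose ((1/2) *\<^sub>R (M + transpose M)) = (1/2) *\<^sub>R (M + transpose M)"
    by (simp add: transpose_def vec_eq_iff)
  then show ?thesis by (simp add: perp_part_def matrix_transpose_mul transpose_proj_perp matrix_mul_assoc)
qed

lemma perp_part_kernel: "perp_part p M *v p = 0"
  by (simp add: perp_part_def matrix_vector_mul_assoc[symmetric] proj_perp_mult_vec)

lemma agree_on_perp_perp_part: "agree_on_perp p (perp_part p M) M"
  unfolding agree_on_perp_def
proof (intro allI impI)
  fix n assume "n \<bullet> p = 0"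
  then have fixed: "proj_perp p *v n = n" by (simp add: proj_perp_mult_vec inner_commute)
  let ?S = "(1/2) *\<^sub>R (M + transpose M)"
  have "qf (perp_part p M) n = n \<bullet> (proj_perp p *v (?S *v n))"
    by (simp add: qf_def perp_part_def matrix_vector_mul_assoc[symmetric] fixed)
  also have "\<dots> = (?S *v n) \<bullet> n"
    using symmetric_inner_swap[OF transpose_proj_perp, of n p "?S *v n"] fixed by simp
  also have "\<dots> = (qf M n + n \<bullet> (transpose M *v n)) / 2"
    by (simp add: qf_def scaleR_matrix_vector_assoc[symmetric] matrix_vector_mult_add_rdistrib
        inner_add_right inner_commute[of _ n] add_divide_distrib)
  also have "n \<bullet> (transpose M *v n) = qf M n"
    by (metis dot_lmul_matrix inner_commute transpose_matrix_vector qf_def)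
  finally show "qf (perp_part p M) n = qf M n" by simp
qed

definition compatible :: "('v \<Rightarrow> real^3) \<Rightarrow> 'v set set \<Rightarrow> ('v \<Rightarrow> real^3^3) \<Rightarrow> bool" where
  "compatible u E A \<longleftrightarrow> (\<forall>x y. {x,y} \<in> E \<longrightarrow> qf (A x) (cross3 (u x) (u y)) = qf (A y) (cross3 (u x) (u y)))"

lemma compatibleD: "compatible u E A \<Longrightarrow> {x,y} \<in> E \<Longrightarrow> qf (A x) (cross3 (u x) (u y)) = qf (A y) (cross3 (u x) (u y))"
  unfolding compatible_def by blast

lemma compatible_mono: "compatible u F A \<Longrightarrow> E \<subseteq> F \<Longrightarrow> compatible u E A"
  unfolding compatible_def by blast

lemma compatible_cong:
  assumes comp: "compatible u E A" and agree: "\<And>x. x \<in> \<Union>E \<Longrightarrow> agree_on_perp (u x) (B x) (A x - M)"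
  shows "compatible u E B"
  unfolding compatible_def
proof (intro allI impI)
  fix x y assume edge: "{x,y} \<in> E"
  then have "x \<in> \<Union>E" "y \<in> \<Union>E" by auto
  then have "qf (B x) (cross3 (u x) (u y)) = qf (A x - M) (cross3 (u x) (u y))"
    "qf (B y) (cross3 (u x) (u y)) = qf (A y - M) (cross3 (u x) (u y))"
    using agree agree_on_perp_cross by blast+
  then show "qf (B x) (cross3 (u x) (u y)) = qf (B y) (cross3 (u x) (u y))"
    using compatibleD[OF comp edge] by (simp add: qf_diff_matrix)
qed

definition rigid :: "('v \<Rightarrow> real^3) \<Rightarrow> 'v set set \<Rightarrow> bool" where
  "rigid u E \<longleftrightarrow> (\<forall>A. compatible u E A \<longrightarrow> (\<exists>B. \<forall>x\<in>\<Union>E. agree_on_perp (u x) (A x) B))"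

lemma rigidE:
  assumes "rigid u E" "compatible u E A"
  obtains B where "\<And>x. x \<in> \<Union>E \<Longrightarrow> agree_on_perp (u x) (A x) B"
  using assms unfolding rigid_def by blast

text \<open>Rigidity with the global forms factored out, by pinning the three vertices of a triangle;
  each form is normalised to have \<open>u x\<close> in its kernel, so that the solution space depends
  polynomially on \<open>u\<close>.\<close>
definition pinned_solution :: "('v \<Rightarrow> real^3) \<Rightarrow> 'v set set \<Rightarrow> 'v set \<Rightarrow> ('v \<Rightarrow> real^3^3) \<Rightarrow> bool" where
  "pinned_solution u E T A \<longleftrightarrow> compatible u E A \<and> (\<forall>x. transpose (A x) = A x) \<and> (\<forall>x. A x *v u x = 0) \<and>
     (\<forall>x. x \<in> T \<or> x \<notin> \<Union>E \<longrightarrow> A x = 0)"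

lemma pinned_solutionD:
  assumes "pinned_solution u E T A"
  shows "compatible u E A" "transpose (A x) = A x" "A x *v u x = 0" "x \<in> T \<or> x \<notin> \<Union>E \<Longrightarrow> A x = 0"
  using assms by (auto simp: pinned_solution_def)

definition pinned_rigid :: "('v \<Rightarrow> real^3) \<Rightarrow> 'v set set \<Rightarrow> 'v set \<Rightarrow> bool" where
  "pinned_rigid u E T \<longleftrightarrow> (\<forall>A. pinned_solution u E T A \<longrightarrow> (\<forall>x. A x = 0))"

lemma rigid_pinned_zero:
  assumes "rigid u E" "compatible u E A"
    and triangle: "{a,b,c} \<subseteq> \<Union>E" "u a \<bullet> cross3 (u b) (u c) \<noteq> 0" "A a = 0" "A b = 0" "A c = 0"
    and x: "x \<in> \<Union>E"
  shows "agree_on_perp (u x) (A x) 0"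
proof -
  obtain B where B: "\<And>x. x \<in> \<Union>E \<Longrightarrow> agree_on_perp (u x) (A x) B" using rigidE[OF assms(1,2)] by blast
  have "qf B n = qf 0 n" for n
  proof (rule qf_eq_if_agree_on_three_planes[OF triangle(2)])
    show "agree_on_perp (u a) B 0" "agree_on_perp (u b) B 0" "agree_on_perp (u c) B 0"
      using B[of a] B[of b] B[of c] triangle by (auto simp: agree_on_perp_def)
  qed
  then show ?thesis using B[OF x] by (simp add: agree_on_perp_def)
qed

lemma compatible_triangle_global_form:
  assumes comp: "compatible u E A" and edges: "{a,b} \<in> E" "{b,c} \<in> E" "{c,a} \<in> E"
    and indep: "u a \<bullet> cross3 (u b) (u c) \<noteq> 0"
  obtains M where "\<And>x. x \<in> {a,b,c} \<Longrightarrow> agree_on_perp (u x) (A x) M"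
proof -
  have "qf (A a) (cross3 (u c) (u a)) = qf (A c) (cross3 (u c) (u a))" using compatibleD[OF comp edges(3)] by simp
  from triangle_global_form[OF indep compatibleD[OF comp edges(1)] compatibleD[OF comp edges(2)] this]
  obtain M where "agree_on_perp (u a) (A a) M" "agree_on_perp (u b) (A b) M" "agree_on_perp (u c) (A c) M"
    by blast
  then show ?thesis using that[of M] by blast
qed

lemma rigid_if_pinned_rigid:
  assumes pinned: "pinned_rigid u E {a,b,c}" and edges: "{a,b} \<in> E" "{b,c} \<in> E" "{c,a} \<in> E"
    and indep: "u a \<bullet> cross3 (u b) (u c) \<noteq> 0"
  shows "rigid u E"
  unfolding rigid_def
proof (intro allI impI)
  fix A assume comp: "compatible u E A"
  obtain M where M: "\<And>x. x \<in> {a,b,c} \<Longrightarrow> agree_on_perp (u x) (A x) M"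
    using compatible_triangle_global_form[OF comp edges indep] by blast
  define B where "B x = (if x \<in> \<Union>E then perp_part (u x) (A x - M) else 0)" for x
  have agree: "agree_on_perp (u x) (B x) (A x - M)" if "x \<in> \<Union>E" for x
    using that agree_on_perp_perp_part by (simp add: B_def)
  have normalised: "transpose (B x) = B x" "B x *v u x = 0" for x
    by (simp_all add: B_def transpose_perp_part perp_part_kernel)
  have "B x = 0" if x: "x \<in> {a,b,c}" for x
  proof (rule symmetric_eq_if_agree_on_perp[OF normalised(1) _ normalised(2)])
    have "x \<in> \<Union>E" using x edges by auto
    then show "agree_on_perp (u x) (B x) 0"
      using agree[of x] M[OF x] by (simp add: agree_on_perp_def qf_diff_matrix)
  qed simp_all
  moreover have "B x = 0" if "x \<notin> \<Union>E" for x using that by (simp add: B_def)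
  ultimately have "pinned_solution u E {a,b,c} B"
    unfolding pinned_solution_def using compatible_cong[OF comp agree] normalised by blast
  then have "B x = 0" for x using pinned by (simp add: pinned_rigid_def)
  then show "\<exists>M. \<forall>x\<in>\<Union>E. agree_on_perp (u x) (A x) M"
    using agree by (intro exI[of _ M]) (simp add: agree_on_perp_def qf_diff_matrix)
qed

lemma rigid_Un:
  assumes rigid: "rigid u E" "rigid u F"
    and common: "{a,b,c} \<subseteq> \<Union>E \<inter> \<Union>F" and indep: "u a \<bullet> cross3 (u b) (u c) \<noteq> 0"
  shows "rigid u (E \<union> F)"
  unfolding rigid_def
proof (intro allI impI)
  fix A assume A: "compatible u (E \<union> F) A"
  obtain B where B: "\<And>x. x \<in> \<Union>E \<Longrightarrow> agree_on_perp (u x) (A x) B"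
    using rigidE[OF rigid(1) compatible_mono[OF A]] by blast
  obtain C where C: "\<And>x. x \<in> \<Union>F \<Longrightarrow> agree_on_perp (u x) (A x) C"
    using rigidE[OF rigid(2) compatible_mono[OF A]] by blast
  have "agree_on_perp (u x) B C" if "x \<in> \<Union>E \<inter> \<Union>F" for x
    using B[of x] C[of x] that by (simp add: agree_on_perp_def)
  then have "qf B n = qf C n" for n
    using common by (intro qf_eq_if_agree_on_three_planes[OF indep]) auto
  then show "\<exists>B. \<forall>x\<in>\<Union>(E \<union> F). agree_on_perp (u x) (A x) B"
    using B C by (intro exI[of _ B]) (metis agree_on_perp_def UnE Union_Un_distrib)
qed

lemma rigid_superset:
  assumes "rigid u E" "E \<subseteq> F" "\<Union>F \<subseteq> \<Union>E"
  shows "rigid u F"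
  unfolding rigid_def
proof (intro allI impI)
  fix A assume "compatible u F A"
  then obtain B where "\<And>x. x \<in> \<Union>E \<Longrightarrow> agree_on_perp (u x) (A x) B"
    using rigidE[OF assms(1) compatible_mono] assms(2) by blast
  then show "\<exists>B. \<forall>x\<in>\<Union>F. agree_on_perp (u x) (A x) B" using assms(3) by blast
qed

lemma rigid_K4:
  assumes distinct: "distinct [a,b,c,d]" and indep: "triples_independent u"
  shows "rigid u {{a,b},{b,c},{c,a},{d,a},{d,b},{d,c}}" (is "rigid u ?E")
  unfolding rigid_def
proof (intro allI impI)
  fix A assume comp: "compatible u ?E A"
  obtain M where M: "\<And>x. x \<in> {a,b,c} \<Longrightarrow> agree_on_perp (u x) (A x) M"
  proof (rule compatible_triangle_global_form[OF comp])
    show "u a \<bullet> cross3 (u b) (u c) \<noteq> 0" using triples_independentD[OF indep, of a b c] distinct by auto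
  qed auto
  have apex: "qf (A d) (cross3 (u d) (u x)) = qf M (cross3 (u d) (u x))" if "x \<in> {a,b,c}" for x
  proof -
    have edge: "{d,x} \<in> ?E" using that by auto
    show ?thesis by (rule trans[OF compatibleD[OF comp edge] agree_on_perp_cross(2)[OF M[OF that]]])
  qed
  have "agree_on_perp (u d) (A d) M"
  proof (rule agree_on_perp_three_directions)
    show "u d \<bullet> cross3 (u a) (u b) \<noteq> 0" "u d \<bullet> cross3 (u a) (u c) \<noteq> 0" "u d \<bullet> cross3 (u b) (u c) \<noteq> 0"
      using distinct by (auto intro!: triples_independentD[OF indep])
  qed (simp_all add: apex)
  then show "\<exists>B. \<forall>x\<in>\<Union>?E. agree_on_perp (u x) (A x) B"
    using M by (intro exI[of _ M]) auto
qed

lemma generically_pinned_rigid: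
  fixes E :: "'v::finite set set"
  assumes witness: "\<exists>u. pinned_rigid u E T"
  shows "generically (\<lambda>u. pinned_rigid u E T)"
proof -
  define A :: "real^('v \<times> 3 \<times> 3) \<Rightarrow> 'v \<Rightarrow> real^3^3" where "A y x = (\<chi> i j. y $ (x,i,j))" for y x
  have A_add: "A (y + z) x = A y x + A z x" and A_scale: "A (c *\<^sub>R y) x = c *\<^sub>R A y x" for y z x c
    by (simp_all add: A_def vec_eq_iff)
  define symmetry :: "(('v \<Rightarrow> real^3) \<Rightarrow> real^('v \<times> 3 \<times> 3) \<Rightarrow> real) set" where
    "symmetry = (\<lambda>(x,i,j) u y. A y x $ i $ j - A y x $ j $ i) ` UNIV"
  define kernel :: "(('v \<Rightarrow> real^3) \<Rightarrow> real^('v \<times> 3 \<times> 3) \<Rightarrow> real) set" where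
    "kernel = (\<lambda>(x,i) u y. (A y x *v u x) $ i) ` UNIV"
  define edge :: "(('v \<Rightarrow> real^3) \<Rightarrow> real^('v \<times> 3 \<times> 3) \<Rightarrow> real) set" where
    "edge = (\<lambda>(x,z) u y. qf (A y x) (cross3 (u x) (u z)) - qf (A y z) (cross3 (u x) (u z))) ` {(x,z). {x,z} \<in> E}"
  define pin :: "(('v \<Rightarrow> real^3) \<Rightarrow> real^('v \<times> 3 \<times> 3) \<Rightarrow> real) set" where
    "pin = (\<lambda>(x,i,j) u y. A y x $ i $ j) ` {(x,i,j). x \<in> T \<or> x \<notin> \<Union>E}"
  note equation_defs = symmetry_def kernel_def edge_def pin_def
  let ?equations = "symmetry \<union> kernel \<union> edge \<union> pin"
  have solution_iff: "pinned_solution u E T (A y) \<longleftrightarrow> (\<forall>f\<in>?equations. f u y = 0)" for u y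
    unfolding pinned_solution_def compatible_def ball_Un equation_defs
    by (auto simp: vec_eq_iff transpose_def)
  have zero_iff: "y = 0 \<longleftrightarrow> (\<forall>x. A y x = 0)" for y
    by (auto simp: A_def vec_eq_iff)
  have surj: "\<exists>y. B = A y" for B
    by (rule exI[of _ "\<chi> k. case k of (x,i,j) \<Rightarrow> B x $ i $ j"]) (simp add: A_def fun_eq_iff vec_eq_iff)
  have pinned_rigid_iff: "pinned_rigid u E T \<longleftrightarrow> (\<forall>y. (\<forall>f\<in>?equations. f u y = 0) \<longrightarrow> y = 0)" for u
    unfolding pinned_rigid_def solution_iff[symmetric] zero_iff using surj by metis
  have coord_poly_qf: "coord_poly (\<lambda>u. qf M (cross3 (u x) (u z)))" for M and x z :: 'v
    unfolding qf_eq_sum by (intro coord_poly_sum cp_mult cp_const coord_poly_cross)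
  have "generically (\<lambda>u. \<forall>y. (\<forall>f\<in>?equations. f u y = 0) \<longrightarrow> y = 0)"
  proof (rule generically_trivial_common_kernel)
    show "finite ?equations" unfolding equation_defs by simp
    show "linear (f u)" if "f \<in> ?equations" for f u
      using that unfolding equation_defs
      by (auto intro!: linearI simp: A_add A_scale qf_add_matrix qf_scale_matrix
          matrix_vector_mult_add_rdistrib scaleR_matrix_vector_assoc[symmetric] algebra_simps)
    show "coord_poly (\<lambda>u. f u y)" if "f \<in> ?equations" for f y
      using that unfolding equation_defs
      by (auto simp: matrix_vector_mult_def
          intro!: cp_const coord_poly_diff coord_poly_qf coord_poly_sum cp_mult cp_coord)
    show "\<exists>u. \<forall>y. (\<forall>f\<in>?equations. f u y = 0) \<longrightarrow> y = 0" using witness unfolding pinned_rigid_iff .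
  qed
  then show ?thesis unfolding pinned_rigid_iff .
qed

lemma tendsto_cross3:
  "(f \<longlongrightarrow> a) F \<Longrightarrow> (g \<longlongrightarrow> b) F \<Longrightarrow> ((\<lambda>x. cross3 (f x) (g x)) \<longlongrightarrow> cross3 a b) F"
  using bounded_bilinear.tendsto bilinear_cross bilinear_conv_bounded_bilinear by blast

lemma tendsto_qf:
  "(M \<longlongrightarrow> N) F \<Longrightarrow> (f \<longlongrightarrow> a) F \<Longrightarrow> ((\<lambda>x. qf (M x) (f x)) \<longlongrightarrow> qf N a) F"
  unfolding qf_eq_sum by (intro tendsto_intros)

lemma tendsto_matrix_vector_mult:
  fixes f :: "_ \<Rightarrow> real^'n"
  assumes "(M \<longlongrightarrow> N) F" "(f \<longlongrightarrow> a) F"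
  shows "((\<lambda>x. M x *v f x) \<longlongrightarrow> N *v a) F"
  by (rule vec_tendstoI) (simp add: matrix_vector_mult_def, intro tendsto_intros assms)

lemma tendsto_transpose:
  fixes M :: "_ \<Rightarrow> real^'n^'m"
  assumes "(M \<longlongrightarrow> N) F"
  shows "((\<lambda>x. transpose (M x)) \<longlongrightarrow> transpose N) F"
  unfolding transpose_def by (intro vec_tendstoI) (simp add: tendsto_vec_nth assms)

lemma pinned_solution_scale:
  assumes "pinned_solution u E T A" shows "pinned_solution u E T (\<lambda>x. c *\<^sub>R A x)"
  using assms unfolding pinned_solution_def compatible_def
  by (auto simp: qf_scale_matrix scaleR_matrix_vector_assoc[symmetric] transpose_def vec_eq_iff)

lemma pinned_solution_limit:
  assumes solution: "\<And>n::nat. pinned_solution (U n) E T (X n)"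
    and U: "\<And>x. (\<lambda>n. U n x) \<longlonglongrightarrow> u x" and X: "\<And>x. (\<lambda>n. X n x) \<longlonglongrightarrow> l x"
  shows "pinned_solution u E T l"
  unfolding pinned_solution_def compatible_def
proof (intro conjI allI impI)
  note solution = pinned_solutionD[OF solution]
  fix x y assume "{x,y} \<in> E"
  then have edge: "qf (X n x) (cross3 (U n x) (U n y)) = qf (X n y) (cross3 (U n x) (U n y))" for n
    using compatibleD[OF solution(1)] by blast
  have lim: "(\<lambda>n. qf (X n z) (cross3 (U n x) (U n y))) \<longlonglongrightarrow> qf (l z) (cross3 (u x) (u y))" for z
    by (intro tendsto_qf tendsto_cross3 X U)
  show "qf (l x) (cross3 (u x) (u y)) = qf (l y) (cross3 (u x) (u y))"
    using LIMSEQ_unique[OF lim[of x, unfolded edge] lim[of y]] .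
next
  note solution = pinned_solutionD[OF solution]
  fix x
  have "(\<lambda>n. X n x) \<longlonglongrightarrow> transpose (l x)" using tendsto_transpose[OF X[of x]] by (simp add: solution(2))
  then show "transpose (l x) = l x" by (rule LIMSEQ_unique[OF _ X])
  have "(\<lambda>n. X n x *v U n x) \<longlonglongrightarrow> l x *v u x" by (intro tendsto_matrix_vector_mult X U)
  then show "l x *v u x = 0" by (simp add: solution(3) LIMSEQ_const_iff)
  show "l x = 0" if "x \<in> T \<or> x \<notin> \<Union>E"
    using X[of x] by (simp add: solution(4)[OF that] LIMSEQ_const_iff)
qed

lemma unit_pinned_solution:
  fixes E :: "'v::finite set set"
  assumes "\<not> pinned_rigid u E T"
  shows "\<exists>Y :: real^3^3^'v. norm Y = 1 \<and> pinned_solution u E T (\<lambda>x. Y $ x)"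
proof -
  obtain A x where A: "pinned_solution u E T A" "A x \<noteq> 0"
    using assms unfolding pinned_rigid_def by blast
  let ?Z = "(\<chi> x. A x) :: real^3^3^'v"
  have "?Z \<noteq> 0" using A(2) by (auto simp: vec_eq_iff[of _ "0::real^3^3^'v"])
  then have "norm ((1 / norm ?Z) *\<^sub>R ?Z) = 1" by simp
  moreover have "pinned_solution u E T (\<lambda>x. ((1 / norm ?Z) *\<^sub>R ?Z) $ x)"
    using pinned_solution_scale[OF A(1), of "1 / norm ?Z"] by simp
  ultimately show ?thesis by blast
qed

lemma nonzero_limit_of_pinned_solutions:
  fixes E :: "'v::finite set set"
  assumes "\<And>n::nat. \<not> pinned_rigid (U n) E T"
  obtains X l r where "strict_mono (r :: nat \<Rightarrow> nat)" "\<And>n. pinned_solution (U (r n)) E T (X n)"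
    "\<And>x. (\<lambda>n. X n x) \<longlonglongrightarrow> l x" "\<exists>x. l x \<noteq> (0 :: real^3^3)"
proof -
  obtain Y where Y: "\<And>n. norm (Y n :: real^3^3^'v) = 1" "\<And>n. pinned_solution (U n) E T (\<lambda>x. Y n $ x)"
    using unit_pinned_solution[OF assms] by metis
  have "compact (sphere (0::real^3^3^'v) 1)" by simp
  then obtain l r where lim: "l \<in> sphere 0 1" "strict_mono r" "(Y \<circ> r) \<longlonglongrightarrow> l"
    unfolding compact_def using Y(1) by (metis dist_0_norm mem_sphere)
  show ?thesis
  proof (rule that[of r "\<lambda>n x. Y (r n) $ x" "\<lambda>x. l $ x"])
    show "strict_mono r" by fact
    show "pinned_solution (U (r n)) E T (\<lambda>x. Y (r n) $ x)" for n by (rule Y(2))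
    show "(\<lambda>n. Y (r n) $ x) \<longlonglongrightarrow> l $ x" for x using tendsto_vec_nth[OF lim(3), of x] by (simp add: o_def)
    have "l \<noteq> 0" using lim(1) by auto
    then show "\<exists>x. l $ x \<noteq> 0" by (auto simp: vec_eq_iff[of l 0])
  qed
qed

definition contract :: "'v \<Rightarrow> 'v \<Rightarrow> 'v \<Rightarrow> 'v" where
  "contract s t x = (if x = t then s else x)"

text \<open>Let \<open>t\<close> tend to \<open>s\<close> in direction \<open>z\<close>: the equation of the edge \<open>st\<close>, divided by the square of the
  distance, survives in the limit.\<close>
lemma limit_along_edge:
  fixes u :: "'v::finite \<Rightarrow> real^3"
  assumes s_neq_t: "s \<noteq> t" and edge: "{s,t} \<in> E" and "\<nexists>u. pinned_rigid u E T"
  obtains l where "pinned_solution (u \<circ> contract s t) E T l" "\<exists>x. l x \<noteq> 0"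
    "qf (l s) (cross3 (u s) z) = qf (l t) (cross3 (u s) z)"
proof -
  define U where "U n = u(t := u s + (1 / real (Suc n)) *\<^sub>R z)" for n
  obtain X l and r :: "nat \<Rightarrow> nat" where r: "strict_mono r"
    and X: "\<And>n. pinned_solution (U (r n)) E T (X n)" "\<And>x. (\<lambda>n. X n x) \<longlonglongrightarrow> l x" and nonzero: "\<exists>x. l x \<noteq> 0"
    using nonzero_limit_of_pinned_solutions[of U E T] assms(3) by metis
  have "(\<lambda>n. U n x) \<longlonglongrightarrow> (u \<circ> contract s t) x" for x
  proof (cases "x = t")
    case True
    have "(\<lambda>n. u s + (1 / real (Suc n)) *\<^sub>R z) \<longlonglongrightarrow> u s + 0 *\<^sub>R z"
      by (intro tendsto_intros LIMSEQ_Suc lim_1_over_n)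
    then show ?thesis using True by (simp add: U_def contract_def)
  qed (simp add: U_def contract_def)
  then have U_lim: "(\<lambda>n. U (r n) x) \<longlonglongrightarrow> (u \<circ> contract s t) x" for x
    using LIMSEQ_subseq_LIMSEQ[OF _ r] by (fastforce simp: o_def)
  have edge: "qf (X n s) (cross3 (u s) z) = qf (X n t) (cross3 (u s) z)" for n
  proof -
    let ?\<epsilon> = "1 / real (Suc (r n))"
    have "cross3 (U (r n) s) (U (r n) t) = ?\<epsilon> *\<^sub>R cross3 (u s) z"
      using s_neq_t by (simp add: U_def cross_add_right cross_mult_right)
    moreover have "qf (X n s) (cross3 (U (r n) s) (U (r n) t)) = qf (X n t) (cross3 (U (r n) s) (U (r n) t))"
      by (rule compatibleD[OF pinned_solutionD(1)[OF X(1)] edge])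
    ultimately have "?\<epsilon>\<^sup>2 * qf (X n s) (cross3 (u s) z) = ?\<epsilon>\<^sup>2 * qf (X n t) (cross3 (u s) z)"
      by (simp only: qf_scale)
    then show ?thesis by simp
  qed
  have lim: "(\<lambda>n. qf (X n x) (cross3 (u s) z)) \<longlonglongrightarrow> qf (l x) (cross3 (u s) z)" for x
    by (intro tendsto_qf X(2) tendsto_const)
  have "qf (l s) (cross3 (u s) z) = qf (l t) (cross3 (u s) z)"
    using LIMSEQ_unique[OF lim[of s, unfolded edge] lim[of t]] .
  then show ?thesis using that pinned_solution_limit[OF X(1) U_lim X(2)] nonzero by blast
qed

lemma split_vertices_agree:
  assumes solution: "pinned_solution (u \<circ> contract s t) E T l" and indep: "triples_independent u"
    and distinct: "distinct [c1,c2,s,t]"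
    and neighbours: "{s,c1} \<in> E" "{t,c1} \<in> E" "{s,c2} \<in> E" "{t,c2} \<in> E"
    and edge: "qf (l s) (cross3 (u s) (u c1 + u c2)) = qf (l t) (cross3 (u s) (u c1 + u c2))"
  shows "l s = l t"
proof (rule symmetric_eq_if_agree_on_perp)
  note solution = pinned_solutionD[OF solution]
  show "transpose (l s) = l s" "transpose (l t) = l t" by (rule solution(2))+
  show "l s *v u s = 0" "l t *v u s = 0"
    using solution(3)[of s] solution(3)[of t] by (auto simp: contract_def)
  have triangle: "u s \<bullet> cross3 (u c1) (u c2) \<noteq> 0"
    using distinct by (intro triples_independentD[OF indep]) auto
  have neighbour: "qf (l s) (cross3 (u s) (u c)) = qf (l t) (cross3 (u s) (u c))"
    if "{s,c} \<in> E" "{t,c} \<in> E" "c \<noteq> t" for c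
    using compatibleD[OF solution(1) that(1)] compatibleD[OF solution(1) that(2)] that(3)
    by (simp add: contract_def split: if_splits)
  show "agree_on_perp (u s) (l s) (l t)"
  proof (rule agree_on_perp_three_directions[OF triangle])
    show "u s \<bullet> cross3 (u c1) (u c1 + u c2) \<noteq> 0" using triangle by (simp add: cross_add_right)
    show "u s \<bullet> cross3 (u c2) (u c1 + u c2) \<noteq> 0"
      using triangle triple_product_swap(1)[of "u s" "u c2" "u c1"] by (simp add: cross_add_right)
  qed (use neighbour neighbours distinct edge in auto)
qed

lemma compatible_contract:
  assumes comp: "compatible (u \<circ> contract s t) E l" and "l s = l t"
    and image: "E' \<subseteq> (`) (contract s t) ` E" and pairs: "\<And>e. e \<in> E \<Longrightarrow> card e = 2"
  shows "compatible u E' l"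
  unfolding compatible_def
proof (intro allI impI)
  have l_contract: "l (contract s t x) = l x" for x using assms(2) by (simp add: contract_def)
  fix x y assume "{x,y} \<in> E'"
  then obtain e where e: "e \<in> E" "{x,y} = contract s t ` e" using image by blast
  then obtain x' y' where e_eq: "e = {x',y'}" using pairs[OF e(1)] by (auto simp: card_2_iff)
  have "qf (l x') (cross3 (u (contract s t x')) (u (contract s t y'))) =
    qf (l y') (cross3 (u (contract s t x')) (u (contract s t y')))"
    using compatibleD[OF comp, of x' y'] e(1) e_eq by simp
  moreover have "x = contract s t x' \<and> y = contract s t y' \<or> x = contract s t y' \<and> y = contract s t x'"
    using e(2) e_eq by (simp add: doubleton_eq_iff)
  ultimately show "qf (l x) (cross3 (u x) (u y)) = qf (l y) (cross3 (u x) (u y))"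
    by (auto simp: l_contract qf_cross_commute[of _ "u (contract s t y')"])
qed

lemma vertex_split:
  fixes u :: "'v::finite \<Rightarrow> real^3"
  assumes s_neq_t: "s \<noteq> t" and indep: "triples_independent u" and rigid: "rigid u E'"
    and image: "E' \<subseteq> (`) (contract s t) ` E" and pairs: "\<And>e. e \<in> E \<Longrightarrow> card e = 2"
    and vertices: "s \<in> \<Union>E'" "\<Union>E \<subseteq> insert t (\<Union>E')"
    and edge: "{s,t} \<in> E" and distinct: "distinct [c1,c2,s,t]"
    and neighbours: "{s,c1} \<in> E" "{t,c1} \<in> E" "{s,c2} \<in> E" "{t,c2} \<in> E"
    and triangle: "distinct (map (contract s t) [a,b,c])" "contract s t ` {a,b,c} \<subseteq> \<Union>E'"
  shows "\<exists>u. pinned_rigid u E {a,b,c}"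
proof (rule ccontr)
  assume "\<nexists>u. pinned_rigid u E {a,b,c}"
  then obtain l where l: "pinned_solution (u \<circ> contract s t) E {a,b,c} l" and nonzero: "\<exists>x. l x \<noteq> 0"
    and limit_edge: "qf (l s) (cross3 (u s) (u c1 + u c2)) = qf (l t) (cross3 (u s) (u c1 + u c2))"
    using limit_along_edge[OF s_neq_t edge, of _ u "u c1 + u c2"] by metis
  note solution = pinned_solutionD[OF l]
  have agree: "l s = l t" by (rule split_vertices_agree[OF l indep distinct neighbours limit_edge])
  have comp: "compatible u E' l" by (rule compatible_contract[OF solution(1) agree image pairs])
  have pinned: "l (contract s t x) = 0" if "x \<in> {a,b,c}" for x
    using solution(4)[of x] that agree by (auto simp: contract_def)
  have indep_triangle: "u (contract s t a) \<bullet> cross3 (u (contract s t b)) (u (contract s t c)) \<noteq> 0"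
    using triangle(1) by (intro triples_independentD[OF indep]) simp
  have zero: "l x = 0" if x: "x \<in> \<Union>E'" for x
  proof (rule symmetric_eq_if_agree_on_perp)
    have "x \<noteq> t" using x image s_neq_t by (auto simp: contract_def)
    then show "l x *v u x = 0" using solution(3)[of x] by (simp add: contract_def)
    show "agree_on_perp (u x) (l x) 0"
      using triangle(2) pinned by (intro rigid_pinned_zero[OF rigid comp _ indep_triangle _ _ _ x]) auto
  qed (simp_all add: solution(2))
  have "l x = 0" for x
    using zero[of x] zero[OF vertices(1)] agree vertices(2) solution(4)[of x] by (cases "x \<in> \<Union>E") auto
  then show False using nonzero by blast
qed

section \<open>Minimal cycles are generically rigid\<close>

definition degree2 :: "'v set set \<Rightarrow> 'v set \<Rightarrow> nat" where
  "degree2 S e = card {T\<in>S. e \<subseteq> T}"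

definition cycle2 :: "'v set set \<Rightarrow> bool" where
  "cycle2 S \<longleftrightarrow> (\<forall>T\<in>S. card T = 3) \<and> (\<forall>e. card e = 2 \<longrightarrow> even (degree2 S e))"

definition min_cycle :: "'v set set \<Rightarrow> bool" where
  "min_cycle S \<longleftrightarrow> cycle2 S \<and> S \<noteq> {} \<and> (\<forall>D\<subseteq>S. cycle2 D \<longrightarrow> D = {} \<or> D = S)"

definition edges2 :: "'v set set \<Rightarrow> 'v set set" where
  "edges2 S = {e. card e = 2 \<and> (\<exists>T\<in>S. e \<subseteq> T)}"

abbreviation generically_rigid :: "'v set set \<Rightarrow> bool" where
  "generically_rigid E \<equiv> generically (\<lambda>u. rigid u E)"

lemma min_cycle_card: "min_cycle S \<Longrightarrow> T \<in> S \<Longrightarrow> card T = 3"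
  by (simp add: min_cycle_def cycle2_def)

lemma Union_edges2:
  assumes "\<And>T. T \<in> S \<Longrightarrow> card T = 3"
  shows "\<Union>(edges2 S) = \<Union>S"
proof
  show "\<Union>S \<subseteq> \<Union>(edges2 S)"
  proof
    fix x assume "x \<in> \<Union>S"
    then obtain T where T: "T \<in> S" "x \<in> T" by blast
    then obtain y where "y \<in> T" "y \<noteq> x" using assms[OF T(1)] by (auto simp: card_3_iff)
    then have "{x,y} \<in> edges2 S" using T by (auto simp: edges2_def)
    then show "x \<in> \<Union>(edges2 S)" by blast
  qed
qed (auto simp: edges2_def)

lemma pair_in_edges2: "x \<noteq> y \<Longrightarrow> {x,y} \<subseteq> T \<Longrightarrow> T \<in> S \<Longrightarrow> {x,y} \<in> edges2 S"
  by (auto simp: edges2_def)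

lemma edges2_Un: "edges2 (S \<union> S') = edges2 S \<union> edges2 S'"
  by (auto simp: edges2_def)

lemma degree2_pos: "degree2 S e \<noteq> 0 \<Longrightarrow> \<exists>T\<in>S. e \<subseteq> T"
  unfolding degree2_def by (metis (no_types, lifting) Collect_empty_eq card.empty)

lemma card_filter_Diff:
  assumes "finite S" "D \<subseteq> S"
  shows "card {T\<in>S. P T} = card {T\<in>D. P T} + card {T\<in>S - D. P T}"
proof -
  have "{T\<in>S. P T} = {T\<in>D. P T} \<union> {T\<in>S - D. P T}" using assms(2) by blast
  moreover have "finite D" using assms finite_subset by blast
  ultimately show ?thesis using assms(1) by (simp add: card_Un_disjoint disjoint_iff)
qed

lemma sum_degree2_star:
  fixes S :: "'v::finite set set"
  assumes "\<And>T. T \<in> S \<Longrightarrow> card T = 3"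
  shows "(\<Sum>c\<in>-{s}. degree2 S {s,c}) = 2 * card {T\<in>S. s \<in> T}"
proof -
  have "(\<Sum>c\<in>-{s}. degree2 S {s,c}) = (\<Sum>c\<in>-{s}. \<Sum>T\<in>S. if s \<in> T \<and> c \<in> T then 1 else 0)"
    by (intro sum.cong refl) (simp add: degree2_def sum.If_cases Int_def)
  also have "\<dots> = (\<Sum>T\<in>S. \<Sum>c\<in>-{s}. if s \<in> T \<and> c \<in> T then 1 else 0)" by (rule sum.swap)
  also have "\<dots> = (\<Sum>T\<in>S. if s \<in> T then 2 else 0)"
  proof (intro sum.cong refl)
    fix T assume "T \<in> S"
    then have "s \<in> T \<Longrightarrow> card (- {s} \<inter> T) = 2"
      using assms by (simp add: Diff_eq[symmetric] Int_commute[of "- {s}"])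
    then show "(\<Sum>c\<in>-{s}. if s \<in> T \<and> c \<in> T then 1 else 0) = (if s \<in> T then 2 else (0::nat))"
      by (simp add: sum.If_cases)
  qed
  also have "\<dots> = 2 * card {T\<in>S. s \<in> T}" by (simp add: sum.If_cases Int_def mult.commute)
  finally show ?thesis .
qed

locale contraction =
  fixes S :: "'v::finite set set" and s t :: 'v
  assumes min_cycle: "min_cycle S" and s_neq_t: "s \<noteq> t" and edge: "\<exists>T\<in>S. {s,t} \<subseteq> T"
begin

abbreviation contract_image :: "'v set \<Rightarrow> 'v set" where
  "contract_image T \<equiv> contract s t ` T"

definition remaining :: "'v set set" where
  "remaining = {T\<in>S. \<not> {s,t} \<subseteq> T}"

definition image_degree :: "'v set set \<Rightarrow> 'v set \<Rightarrow> nat" where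
  "image_degree D e = card {T\<in>D. e \<subseteq> contract_image T}"

text \<open>Balanced sets are those whose image under the contraction of \<open>t\<close> to \<open>s\<close> is a cycle modulo 2, counted
  with multiplicity.\<close>
definition balanced :: "'v set set \<Rightarrow> bool" where
  "balanced D \<longleftrightarrow> D \<subseteq> remaining \<and> (\<forall>e. card e = 2 \<longrightarrow> even (image_degree D e))"

definition min_balanced :: "'v set set \<Rightarrow> bool" where
  "min_balanced D \<longleftrightarrow> balanced D \<and> D \<noteq> {} \<and> (\<forall>D'\<subseteq>D. balanced D' \<longrightarrow> D' = {} \<or> D' = D)"

definition piece :: "'v set set \<Rightarrow> 'v set set" where
  "piece D = insert {s,t} (edges2 D)"

lemma card_triangle: "T \<in> S \<Longrightarrow> card T = 3"
  using min_cycle by (rule min_cycle_card)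

lemma even_degree: "card e = 2 \<Longrightarrow> even (degree2 S e)"
  using min_cycle by (auto simp: min_cycle_def cycle2_def)

lemma subcycle: "D \<subseteq> S \<Longrightarrow> cycle2 D \<Longrightarrow> D = {} \<or> D = S"
  using min_cycle by (auto simp: min_cycle_def)

lemma remaining_subset: "remaining \<subseteq> S" by (auto simp: remaining_def)

lemma balanced_subset: "balanced D \<Longrightarrow> D \<subseteq> remaining"
  by (simp add: balanced_def)

lemma balanced_card: "balanced D \<Longrightarrow> T \<in> D \<Longrightarrow> card T = 3"
  using balanced_subset remaining_subset card_triangle by blast

lemma triangle_on_edge: "T \<in> S \<Longrightarrow> {s,t,c} \<subseteq> T \<Longrightarrow> c \<notin> {s,t} \<Longrightarrow> T = {s,t,c}"
  using card_triangle[of T] s_neq_t card_seteq[of T "{s,t,c}"] by auto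

lemma contract_image_eq: "contract_image T = (if t \<in> T then insert s (T - {t}) else T)"
  by (auto simp: contract_def image_iff)

lemma inj_on_contract: "T \<in> remaining \<Longrightarrow> inj_on (contract s t) T"
  by (auto simp: remaining_def contract_def inj_on_def)

lemma card_contract_image: "T \<in> remaining \<Longrightarrow> card (contract_image T) = 3"
  using card_triangle[of T] by (simp add: card_image inj_on_contract remaining_def)

lemma degree2_contract_image:
  assumes "inj_on contract_image D"
  shows "degree2 (contract_image ` D) e = image_degree D e"
proof -
  have "{T\<in>contract_image ` D. e \<subseteq> T} = contract_image ` {T\<in>D. e \<subseteq> contract_image T}" by blast
  moreover have "inj_on contract_image {T\<in>D. e \<subseteq> contract_image T}" using assms by (rule inj_on_subset) blast
  ultimately show ?thesis by (simp add: degree2_def image_degree_def card_image)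
qed

lemma balanced_iff_cycle2_image:
  assumes "D \<subseteq> remaining" "inj_on contract_image D"
  shows "balanced D \<longleftrightarrow> cycle2 (contract_image ` D)"
  using assms(1) card_contract_image
  by (auto simp: balanced_def cycle2_def degree2_contract_image[OF assms(2)])

lemma image_degree_Diff: "D' \<subseteq> D \<Longrightarrow> image_degree D e = image_degree D' e + image_degree (D - D') e"
  unfolding image_degree_def by (intro card_filter_Diff finite)

lemma balanced_Diff:
  assumes "balanced D" "balanced D'" "D' \<subseteq> D"
  shows "balanced (D - D')"
  using assms(1,2) image_degree_Diff[OF assms(3)] by (auto simp: balanced_def)

lemma balanced_Un:
  assumes "balanced D" "balanced D'" "D \<inter> D' = {}"
  shows "balanced (D \<union> D')"
proof -
  have "D \<union> D' - D = D'" using assms(3) by blast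
  then show ?thesis using assms(1,2) image_degree_Diff[of D "D \<union> D'"] by (auto simp: balanced_def)
qed

lemma image_degree_removed: "t \<in> e \<Longrightarrow> image_degree D e = 0"
  using s_neq_t by (auto simp: image_degree_def contract_def)

lemma image_degree_unaffected: "s \<notin> e \<Longrightarrow> t \<notin> e \<Longrightarrow> image_degree D e = degree2 D e"
  unfolding image_degree_def degree2_def contract_image_eq
  by (intro arg_cong[where f = card] Collect_cong) auto

lemma image_degree_merged:
  assumes D: "D \<subseteq> remaining" and c: "c \<notin> {s,t}"
  shows "image_degree D {s,c} = degree2 D {s,c} + degree2 D {t,c}"
proof -
  have "{T\<in>D. {s,c} \<subseteq> contract_image T} = {T\<in>D. {s,c} \<subseteq> T} \<union> {T\<in>D. {t,c} \<subseteq> T}"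
    using c s_neq_t by (auto simp: contract_image_eq)
  moreover have "{T\<in>D. {s,c} \<subseteq> T} \<inter> {T\<in>D. {t,c} \<subseteq> T} = {}" using D by (auto simp: remaining_def)
  ultimately show ?thesis by (simp add: image_degree_def degree2_def card_Un_disjoint)
qed

lemma balanced_iff_degrees:
  "balanced D \<longleftrightarrow> D \<subseteq> remaining \<and> (\<forall>e. card e = 2 \<longrightarrow> s \<notin> e \<longrightarrow> t \<notin> e \<longrightarrow> even (degree2 D e)) \<and>
     (\<forall>c. c \<notin> {s,t} \<longrightarrow> even (degree2 D {s,c} + degree2 D {t,c}))" (is "_ \<longleftrightarrow> ?degrees")
proof
  assume balanced: "balanced D"
  note D = balanced_subset[OF balanced]
  have even_image: "even (image_degree D e)" if "card e = 2" for e using balanced that by (simp add: balanced_def)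
  have "even (degree2 D e)" if "card e = 2" "s \<notin> e" "t \<notin> e" for e
    using even_image[OF that(1)] image_degree_unaffected[OF that(2,3)] by simp
  moreover have "even (degree2 D {s,c} + degree2 D {t,c})" if "c \<notin> {s,t}" for c
    using even_image[of "{s,c}"] that image_degree_merged[OF D that] by auto
  ultimately show ?degrees using D by blast
next
  assume degrees: ?degrees
  then have D: "D \<subseteq> remaining" by blast
  have "even (image_degree D e)" if e: "card e = 2" for e
  proof -
    consider "t \<in> e" | "s \<notin> e" "t \<notin> e" | "s \<in> e" "t \<notin> e" by blast
    then show ?thesis
    proof cases
      case 1 then show ?thesis by (simp add: image_degree_removed)
    next
      case 2 then show ?thesis using degrees e by (simp add: image_degree_unaffected)
    next
      case 3
      then obtain c where "e = {s,c}" "c \<notin> {s,t}" using e by (auto simp: card_2_iff doubleton_eq_iff)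
      then show ?thesis using degrees image_degree_merged[OF D] by simp
    qed
  qed
  then show "balanced D" using D by (simp add: balanced_def)
qed

lemma degree_remaining_unaffected:
  assumes e: "card e = 2" "s \<notin> e" "t \<notin> e"
  shows "degree2 remaining e = degree2 S e"
proof -
  have "T \<in> remaining" if T: "T \<in> S" "e \<subseteq> T" for T
  proof (rule ccontr)
    assume "T \<notin> remaining"
    then have "e \<union> {s,t} \<subseteq> T" using T by (auto simp: remaining_def)
    then have "card (e \<union> {s,t}) \<le> 3" using card_triangle[OF T(1)] by (metis card_mono finite)
    then show False using e s_neq_t by (simp add: card_Un_disjoint)
  qed
  then have "{T\<in>remaining. e \<subseteq> T} = {T\<in>S. e \<subseteq> T}" using remaining_subset by blast
  then show ?thesis by (simp add: degree2_def)
qed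

lemma degree_remaining_at_edge:
  assumes "x \<in> {s,t}" "c \<notin> {s,t}"
  shows "degree2 S {x,c} = degree2 remaining {x,c} + card ({{s,t,c}} \<inter> S)"
proof -
  have "{T\<in>S - remaining. {x,c} \<subseteq> T} = {{s,t,c}} \<inter> S"
    using triangle_on_edge assms by (auto simp: remaining_def)
  then show ?thesis using card_filter_Diff[OF finite remaining_subset] by (simp add: degree2_def)
qed

lemma balanced_remaining: "balanced remaining"
  unfolding balanced_iff_degrees
proof (intro conjI allI impI)
  show "even (degree2 remaining e)" if "card e = 2" "s \<notin> e" "t \<notin> e" for e
    using degree_remaining_unaffected[OF that] even_degree[OF that(1)] by simp
  show "even (degree2 remaining {s,c} + degree2 remaining {t,c})" if c: "c \<notin> {s,t}" for c
    using degree_remaining_at_edge[OF _ c, of s] degree_remaining_at_edge[OF _ c, of t]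
      even_degree[of "{s,c}"] even_degree[of "{t,c}"] c by auto
qed simp

lemma degree_edge: "D \<subseteq> remaining \<Longrightarrow> degree2 D {s,t} = 0"
  using degree2_pos[of D "{s,t}"] by (auto simp: remaining_def)

lemma balanced_cycle2_empty:
  assumes "balanced D" "cycle2 D"
  shows "D = {}"
proof -
  have "D \<subseteq> remaining" "D \<subseteq> S" using assms(1) balanced_subset remaining_subset by blast+
  moreover have "remaining \<noteq> S" using edge by (auto simp: remaining_def)
  ultimately show ?thesis using subcycle[OF _ assms(2)] remaining_subset by blast
qed

lemma ex_odd_neighbour:
  assumes balanced: "balanced D" and nonempty: "D \<noteq> {}"
  shows "\<exists>c\<in>-{s}. odd (degree2 D {s,c})"
proof (rule ccontr)
  assume "\<not> ?thesis"
  then have even_s: "even (degree2 D {s,c})" if "c \<noteq> s" for c using that by blast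
  have "even (degree2 D e)" if e: "card e = 2" for e
  proof -
    consider "s \<notin> e" "t \<notin> e" | c where "c \<noteq> s" "e = {s,c}" | c where "c \<notin> {s,t}" "e = {t,c}"
      using e by (auto simp: card_2_iff) (metis doubleton_eq_iff)+
    then show ?thesis
    proof cases
      case 1 then show ?thesis using balanced e by (simp add: balanced_iff_degrees)
    next
      case 2 then show ?thesis using even_s by blast
    next
      case 3
      then have "even (degree2 D {s,c} + degree2 D {t,c})" using balanced by (simp add: balanced_iff_degrees)
      then show ?thesis using even_s[of c] 3 by simp
    qed
  qed
  then have "cycle2 D" using balanced_card[OF balanced] by (simp add: cycle2_def)
  then show False using balanced_cycle2_empty balanced nonempty by blast
qed

lemma two_odd_neighbours:
  assumes balanced: "balanced D" and "D \<noteq> {}"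
  obtains c1 c2 where "distinct [c1,c2,s,t]" "odd (degree2 D {s,c1})" "odd (degree2 D {s,c2})"
    "odd (degree2 D {t,c1})" "odd (degree2 D {t,c2})"
proof -
  let ?odd = "{c\<in>-{s}. odd (degree2 D {s,c})}"
  have "even (\<Sum>c\<in>-{s}. degree2 D {s,c})"
    using sum_degree2_star[of D s] balanced_card[OF balanced] by simp
  then have even_card: "even (card ?odd)" by (simp add: even_sum_iff)
  obtain c1 where c1: "c1 \<in> ?odd" using ex_odd_neighbour[OF assms] by blast
  have "?odd \<noteq> {c1}" using even_card by (metis card_1_singleton_iff odd_one One_nat_def)
  then obtain c2 where c2: "c2 \<in> ?odd" "c2 \<noteq> c1" using c1 by blast
  have off_edge: "c \<notin> {s,t}" if "c \<in> ?odd" for c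
    using that degree_edge[OF balanced_subset[OF balanced]] by auto
  have "odd (degree2 D {t,c})" if "c \<in> ?odd" for c
  proof -
    have "even (degree2 D {s,c} + degree2 D {t,c})"
      using balanced off_edge[OF that] by (simp add: balanced_iff_degrees)
    then show ?thesis using that by simp
  qed
  then show ?thesis using that[of c1 c2] c1 c2 off_edge s_neq_t by auto
qed

lemma min_balanced_containing:
  assumes "balanced R" "T \<in> R"
  obtains D where "min_balanced D" "D \<subseteq> R" "T \<in> D"
proof -
  let ?candidate = "\<lambda>D. balanced D \<and> D \<subseteq> R \<and> T \<in> D"
  obtain D where D: "?candidate D" "\<And>D'. ?candidate D' \<Longrightarrow> card D \<le> card D'"
    using assms ex_has_least_nat[of ?candidate R card] by blast
  have "min_balanced D" unfolding min_balanced_def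
  proof (intro conjI allI impI)
    fix D' assume D': "D' \<subseteq> D" "balanced D'"
    show "D' = {} \<or> D' = D"
    proof (cases "T \<in> D'")
      case True
      then have "card D \<le> card D'" using D D' by blast
      then show ?thesis using D'(1) by (metis card_seteq finite)
    next
      case False
      have "balanced (D - D')" using balanced_Diff D' D(1) by blast
      then have "card D \<le> card (D - D')" using D False by blast
      then have "D - D' = D" by (metis card_seteq finite Diff_subset)
      then show ?thesis using D'(1) by blast
    qed
  qed (use D in auto)
  then show ?thesis using that D by blast
qed

lemma min_balanced_subset: "min_balanced D \<Longrightarrow> D \<subseteq> remaining"
  by (simp add: min_balanced_def balanced_subset)

lemma balanced_pair:
  assumes "insert s A \<in> remaining" "insert t A \<in> remaining" "s \<notin> A" "t \<notin> A"
  shows "balanced {insert s A, insert t A}"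
proof -
  have distinct: "insert s A \<noteq> insert t A" using assms s_neq_t by blast
  have images: "contract_image (insert s A) = insert s A" "contract_image (insert t A) = insert s A"
    unfolding contract_image_eq using assms s_neq_t by auto
  have "even (image_degree {insert s A, insert t A} e)" for e
  proof (cases "e \<subseteq> insert s A")
    case True
    then have "{T\<in>{insert s A, insert t A}. e \<subseteq> contract_image T} = {insert s A, insert t A}"
      using images by auto
    then show ?thesis using distinct by (simp only: image_degree_def) simp
  next
    case False
    then have "{T\<in>{insert s A, insert t A}. e \<subseteq> contract_image T} = {}" using images by auto
    then show ?thesis by (simp only: image_degree_def) simp
  qed
  then show ?thesis using assms(1,2) by (simp add: balanced_def)
qed

lemma contract_image_collision:
  assumes "T \<in> remaining" "T' \<in> remaining" "T \<noteq> T'" "contract_image T = contract_image T'"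
  obtains A where "s \<notin> A" "t \<notin> A" "{T,T'} = {insert s A, insert t A}"
proof -
  have collision: "\<exists>A. s \<notin> A \<and> t \<notin> A \<and> T = insert t A \<and> T' = insert s A"
    if T: "T \<in> remaining" "contract_image T = contract_image T'" "t \<in> T" "t \<notin> T'" for T T'
    using T by (intro exI[of _ "T - {t}"]) (auto simp: remaining_def contract_image_eq)
  have "\<not> (t \<in> T \<longleftrightarrow> t \<in> T')"
  proof
    assume "t \<in> T \<longleftrightarrow> t \<in> T'"
    then have "t \<in> T" "t \<in> T'" "insert s (T - {t}) = insert s (T' - {t})"
      using assms(3,4) by (auto simp: contract_image_eq split: if_splits)
    moreover from this have "s \<notin> T" "s \<notin> T'" using assms(1,2) by (auto simp: remaining_def)
    ultimately have "T - {t} = T' - {t}" by (metis Diff_iff insert_ident)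
    then show False using \<open>t \<in> T\<close> \<open>t \<in> T'\<close> assms(3) by blast
  qed
  then consider "t \<in> T" "t \<notin> T'" | "t \<in> T'" "t \<notin> T" by blast
  then show ?thesis
  proof cases
    case 1 then show ?thesis using that collision[OF assms(1,4)] by (metis insert_commute)
  next
    case 2 then show ?thesis using that collision[OF assms(2) assms(4)[symmetric]] by (metis insert_commute)
  qed
qed

lemma min_balanced_not_injective:
  assumes D: "min_balanced D" and "\<not> inj_on contract_image D"
  obtains a b where "distinct [a,b,s,t]" "D = {{s,a,b},{t,a,b}}"
proof -
  note remaining = min_balanced_subset[OF D]
  obtain T T' where T: "T \<in> D" "T' \<in> D" "T \<noteq> T'" "contract_image T = contract_image T'"
    using assms(2) by (auto simp: inj_on_def)
  then have T_remaining: "T \<in> remaining" "T' \<in> remaining" using remaining by blast+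
  obtain A where A: "s \<notin> A" "t \<notin> A" "{T,T'} = {insert s A, insert t A}"
    using contract_image_collision[OF T_remaining T(3,4)] .
  then have members: "insert s A \<in> D" "insert t A \<in> D" using T(1,2) by (metis insert_subset empty_subsetI)+
  then have "balanced {insert s A, insert t A}" using balanced_pair A remaining by blast
  then have D_eq: "D = {insert s A, insert t A}"
    using D members unfolding min_balanced_def by (metis empty_not_insert insert_subset empty_subsetI)
  have "card (insert s A) = 3" using card_triangle members remaining remaining_subset by blast
  then obtain a b where "A = {a,b}" "a \<noteq> b" using A(1) by (auto simp: card_2_iff)
  then show ?thesis using that[of a b] D_eq A s_neq_t by auto
qed

lemma rigid_piece_not_injective:
  assumes "min_balanced D" "\<not> inj_on contract_image D" "triples_independent u"
  shows "rigid u (piece D)"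
proof -
  obtain a b where distinct: "distinct [a,b,s,t]" and D: "D = {{s,a,b},{t,a,b}}"
    using min_balanced_not_injective[OF assms(1,2)] .
  let ?K4 = "{{a,b},{b,s},{s,a},{t,a},{t,b},{t,s}}"
  show ?thesis
  proof (rule rigid_superset[OF rigid_K4[OF distinct assms(3)]])
    show "?K4 \<subseteq> piece D" using distinct by (auto simp: piece_def edges2_def D insert_commute)
    show "\<Union>(piece D) \<subseteq> \<Union>?K4" by (auto simp: piece_def edges2_def D)
  qed
qed

lemma min_cycle_contract_image:
  assumes D: "min_balanced D" and inj: "inj_on contract_image D"
  shows "min_cycle (contract_image ` D)"
  unfolding min_cycle_def
proof (intro conjI allI impI)
  note remaining = min_balanced_subset[OF D]
  show "cycle2 (contract_image ` D)" "contract_image ` D \<noteq> {}"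
    using D balanced_iff_cycle2_image[OF remaining inj] by (auto simp: min_balanced_def)
  fix C assume C: "C \<subseteq> contract_image ` D" "cycle2 C"
  then obtain D' where D': "D' \<subseteq> D" "C = contract_image ` D'" by (auto simp: subset_image_iff)
  then have "balanced D'"
    using C(2) balanced_iff_cycle2_image[OF order_trans[OF D'(1) remaining] inj_on_subset[OF inj D'(1)]]
    by simp
  then have "D' = {} \<or> D' = D" using D D'(1) by (simp add: min_balanced_def)
  then show "C = {} \<or> C = contract_image ` D" using D'(2) by blast
qed

lemma Union_contract_image_less:
  assumes "D \<subseteq> remaining"
  shows "card (\<Union>(contract_image ` D)) < card (\<Union>S)"
proof (intro psubset_card_mono psubsetI)
  have edge_covered: "s \<in> \<Union>S" "t \<in> \<Union>S" using edge by auto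
  have "t \<notin> \<Union>(contract_image ` D)" using s_neq_t by (auto simp: contract_def)
  then show "\<Union>(contract_image ` D) \<noteq> \<Union>S" using edge_covered(2) by metis
  show "\<Union>(contract_image ` D) \<subseteq> \<Union>S"
  proof
    fix x assume "x \<in> \<Union>(contract_image ` D)"
    then obtain T y where "T \<in> D" "y \<in> T" "x = contract s t y" by blast
    then show "x \<in> \<Union>S" using assms remaining_subset edge_covered(1) by (auto simp: contract_def)
  qed
qed simp

lemma Union_piece: "balanced D \<Longrightarrow> \<Union>(piece D) = {s,t} \<union> \<Union>D"
  unfolding piece_def using Union_edges2[OF balanced_card] by simp

lemma pair_in_piece: "T \<in> D \<Longrightarrow> {x,y} \<subseteq> T \<Longrightarrow> x \<noteq> y \<Longrightarrow> {x,y} \<in> piece D"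
  unfolding piece_def by (intro insertI2 pair_in_edges2)

lemma odd_pair_in_piece: "odd (degree2 D {x,y}) \<Longrightarrow> x \<noteq> y \<Longrightarrow> {x,y} \<in> piece D"
  using degree2_pos[of D "{x,y}"] pair_in_piece by (metis even_zero)

lemma edges2_contract_image: "edges2 (contract_image ` D) \<subseteq> contract_image ` piece D"
proof
  fix e assume "e \<in> edges2 (contract_image ` D)"
  then obtain T where T: "T \<in> D" "e \<subseteq> contract_image T" "card e = 2" by (auto simp: edges2_def)
  then obtain x y where xy: "{x,y} \<subseteq> T" "e = contract_image {x,y}" "x \<noteq> y"
    by (auto simp: card_2_iff subset_iff image_iff) blast
  show "e \<in> contract_image ` piece D"
    unfolding xy(2) by (rule imageI) (rule pair_in_piece[OF T(1) xy(1,3)])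
qed

lemma pinned_rigid_piece:
  assumes D: "min_balanced D" "inj_on contract_image D" and T: "{a,b,c} \<in> D" "distinct [a,b,c]"
    and u: "rigid u (edges2 (contract_image ` D))" "triples_independent u"
  shows "\<exists>u. pinned_rigid u (piece D) {a,b,c}"
proof -
  note remaining = min_balanced_subset[OF D(1)]
  have balanced: "balanced D" "D \<noteq> {}" using D(1) by (auto simp: min_balanced_def)
  obtain c1 c2 where neighbours: "distinct [c1,c2,s,t]" "odd (degree2 D {s,c1})" "odd (degree2 D {s,c2})"
    "odd (degree2 D {t,c1})" "odd (degree2 D {t,c2})" using two_odd_neighbours[OF balanced] .
  have Union_image: "\<Union>(edges2 (contract_image ` D)) = \<Union>(contract_image ` D)"
    using remaining card_contract_image by (intro Union_edges2) blast
  have s_covered: "s \<in> \<Union>(contract_image ` D)"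
  proof -
    obtain T where "T \<in> D" "{s,c1} \<subseteq> T" using degree2_pos[of D "{s,c1}"] neighbours(2) by (metis even_zero)
    then show ?thesis using s_neq_t by (auto simp: contract_image_eq)
  qed
  show ?thesis
  proof (rule vertex_split[OF s_neq_t u(2,1) edges2_contract_image])
    show "card e = 2" if "e \<in> piece D" for e using that s_neq_t by (auto simp: piece_def edges2_def)
    show "s \<in> \<Union>(edges2 (contract_image ` D))" using s_covered Union_image by simp
    show "\<Union>(piece D) \<subseteq> insert t (\<Union>(edges2 (contract_image ` D)))"
      using s_covered unfolding Union_image Union_piece[OF balanced(1)] by (auto simp: contract_image_eq)
    show "{s,t} \<in> piece D" by (simp add: piece_def)
    show "distinct [c1,c2,s,t]" by fact
    show "{s,c1} \<in> piece D" "{t,c1} \<in> piece D" "{s,c2} \<in> piece D" "{t,c2} \<in> piece D"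
      using odd_pair_in_piece neighbours by auto
    have "inj_on (contract s t) {a,b,c}" using T(1) remaining inj_on_contract by blast
    then show "distinct (map (contract s t) [a,b,c])" using T(2) by (subst distinct_map) auto
    show "contract_image {a,b,c} \<subseteq> \<Union>(edges2 (contract_image ` D))"
      unfolding Union_image by (rule Union_upper) (use T(1) in blast)
  qed
qed

lemma generically_rigid_piece_injective:
  assumes D: "min_balanced D" "inj_on contract_image D"
    and image: "generically_rigid (edges2 (contract_image ` D))"
  shows "generically_rigid (piece D)"
proof -
  obtain u where u: "rigid u (edges2 (contract_image ` D))" "triples_independent u"
    using generically_ex[OF generically_conj[OF image generically_triples_independent]] by blast
  obtain T where "T \<in> D" using D(1) by (auto simp: min_balanced_def)
  moreover have "card T = 3" using calculation D(1) balanced_card by (auto simp: min_balanced_def)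
  ultimately obtain a b c where T: "{a,b,c} \<in> D" "distinct [a,b,c]" by (auto simp: card_3_iff)
  have "generically (\<lambda>u. pinned_rigid u (piece D) {a,b,c} \<and> triples_independent u)"
    by (intro generically_conj generically_pinned_rigid generically_triples_independent
        pinned_rigid_piece[OF D T u])
  then show ?thesis
  proof (rule generically_mono, elim conjE)
    fix u :: "'v \<Rightarrow> real^3"
    assume pinned: "pinned_rigid u (piece D) {a,b,c}" and indep: "triples_independent u"
    have "{a,b} \<in> piece D" "{b,c} \<in> piece D" "{c,a} \<in> piece D" using pair_in_piece[OF T(1)] T(2) by auto
    from rigid_if_pinned_rigid[OF pinned this triples_independentD[OF indep T(2)]]
    show "rigid u (piece D)" .
  qed
qed

lemma generically_rigid_piece:
  assumes IH: "\<And>S' :: 'v set set. card (\<Union>S') < card (\<Union>S) \<Longrightarrow> min_cycle S' \<Longrightarrow> generically_rigid (edges2 S')"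
    and D: "min_balanced D"
  shows "generically_rigid (piece D)"
proof (cases "inj_on contract_image D")
  case True
  have "generically_rigid (edges2 (contract_image ` D))"
    by (intro IH Union_contract_image_less min_cycle_contract_image min_balanced_subset D True)
  then show ?thesis by (rule generically_rigid_piece_injective[OF D True])
next
  case False
  show ?thesis
    by (rule generically_mono[OF generically_triples_independent]) (rule rigid_piece_not_injective[OF D False])
qed

lemma generically_rigid_piece_Un:
  assumes rigid: "generically_rigid (piece D)" "generically_rigid (piece D')"
    and balanced: "balanced D" "balanced D'" and c: "c \<notin> {s,t}" "c \<in> \<Union>D" "c \<in> \<Union>D'"
  shows "generically_rigid (piece (D \<union> D'))"
proof -
  have "generically (\<lambda>u. (rigid u (piece D) \<and> rigid u (piece D')) \<and> triples_independent u)"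
    by (intro generically_conj rigid generically_triples_independent)
  then show ?thesis
  proof (rule generically_mono, elim conjE)
    fix u :: "'v \<Rightarrow> real^3"
    assume u: "rigid u (piece D)" "rigid u (piece D')" "triples_independent u"
    have "piece (D \<union> D') = piece D \<union> piece D'" by (simp add: piece_def edges2_Un)
    moreover have "rigid u (piece D \<union> piece D')"
    proof (rule rigid_Un[OF u(1,2)])
      show "{s,t,c} \<subseteq> \<Union>(piece D) \<inter> \<Union>(piece D')" using c by (simp add: Union_piece balanced)
      show "u s \<bullet> cross3 (u t) (u c) \<noteq> 0" using c(1) s_neq_t by (intro triples_independentD[OF u(3)]) auto
    qed
    ultimately show "rigid u (piece (D \<union> D'))" by simp
  qed
qed

lemma other_triangle:
  assumes T: "T \<in> S" "{s,t} \<subseteq> T" and x: "x \<in> T" "x \<notin> {s,t}"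
  shows "\<exists>T'\<in>remaining. {s,x} \<subseteq> T'"
proof -
  have T_eq: "T = {s,t,x}" using triangle_on_edge T x by auto
  have "even (card {T\<in>S. {s,x} \<subseteq> T})" using even_degree[of "{s,x}"] x(2) by (auto simp: degree2_def)
  then have "{T\<in>S. {s,x} \<subseteq> T} \<noteq> {T}" by (metis card_1_singleton_iff odd_one One_nat_def)
  then obtain T' where T': "T' \<in> S" "{s,x} \<subseteq> T'" "T' \<noteq> T" using T x by blast
  then have "t \<notin> T'" using triangle_on_edge[of T' x] T_eq x(2) by auto
  then show ?thesis using T' by (auto simp: remaining_def)
qed

lemma remaining_nonempty: "remaining \<noteq> {}"
proof -
  obtain T where T: "T \<in> S" "{s,t} \<subseteq> T" using edge by blast
  have "\<not> T \<subseteq> {s,t}" using card_triangle[OF T(1)] card_mono[of "{s,t}" T] s_neq_t by auto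
  then show ?thesis using other_triangle[OF T] by blast
qed

definition separated :: "'v set set \<Rightarrow> bool" where
  "separated D \<longleftrightarrow> (\<forall>T\<in>remaining. T \<inter> \<Union>D \<subseteq> {s,t} \<or> T \<in> D)"

definition completion :: "'v set set \<Rightarrow> 'v set set" where
  "completion D = D \<union> {T\<in>S. {s,t} \<subseteq> T \<and> \<not> T \<inter> \<Union>D \<subseteq> {s,t}}"

lemma completion_subset: "D \<subseteq> remaining \<Longrightarrow> completion D \<subseteq> S"
  using remaining_subset by (auto simp: completion_def)

lemma vertex_of_completion:
  assumes T: "T \<in> completion D" "x \<in> T" "x \<notin> {s,t}"
  shows "x \<in> \<Union>D"
proof (cases "T \<in> D")
  case True then show ?thesis using T by blast
next
  case False
  then obtain c where c: "T \<in> S" "{s,t} \<subseteq> T" "c \<in> T" "c \<notin> {s,t}" "c \<in> \<Union>D"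
    using T(1) by (auto simp: completion_def)
  then have "T = {s,t,c}" using triangle_on_edge by auto
  then show ?thesis using c T by blast
qed

lemma degree_completion:
  assumes "D \<subseteq> remaining" "separated D" and c: "c \<in> e" "c \<notin> {s,t}" "c \<in> \<Union>D"
  shows "degree2 (completion D) e = degree2 S e"
proof -
  have "T \<in> completion D" if "T \<in> S" "e \<subseteq> T" for T
  proof -
    have "c \<in> T \<inter> \<Union>D" using that c by blast
    then show ?thesis using that assms(2) c(2) by (auto simp: separated_def completion_def remaining_def)
  qed
  then have "{T\<in>completion D. e \<subseteq> T} = {T\<in>S. e \<subseteq> T}" using completion_subset[OF assms(1)] by blast
  then show ?thesis by (simp add: degree2_def)
qed

lemma even_degree_completion:
  assumes "D \<subseteq> remaining" "separated D" and e: "card e = 2" "e \<noteq> {s,t}"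
  shows "even (degree2 (completion D) e)"
proof -
  obtain c where c: "c \<in> e" "c \<notin> {s,t}" using e by (auto simp: card_2_iff)
  show ?thesis
  proof (cases "c \<in> \<Union>D")
    case True then show ?thesis using degree_completion[OF assms(1,2) c] even_degree[OF e(1)] by simp
  next
    case False
    then have "{T\<in>completion D. e \<subseteq> T} = {}" using vertex_of_completion c by blast
    then show ?thesis unfolding degree2_def by (metis card.empty even_zero)
  qed
qed

lemma cycle2_completion:
  assumes "D \<subseteq> remaining" "separated D"
  shows "cycle2 (completion D)"
proof -
  have card: "card T = 3" if "T \<in> completion D" for T
    using that completion_subset[OF assms(1)] card_triangle by blast
  have handshake: "(\<Sum>c\<in>-{s}. degree2 (completion D) {s,c}) = 2 * card {T\<in>completion D. s \<in> T}"
    by (rule sum_degree2_star) (rule card)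
  have "(\<Sum>c\<in>-{s}. degree2 (completion D) {s,c}) =
    degree2 (completion D) {s,t} + (\<Sum>c\<in>-{s}-{t}. degree2 (completion D) {s,c})"
    using s_neq_t by (intro sum.remove) auto
  then have "even (degree2 (completion D) {s,t} + (\<Sum>c\<in>-{s}-{t}. degree2 (completion D) {s,c}))"
    unfolding handshake by (metis dvd_triv_left)
  moreover have "even (\<Sum>c\<in>-{s}-{t}. degree2 (completion D) {s,c})"
    by (rule dvd_sum, rule even_degree_completion[OF assms]) (auto simp: doubleton_eq_iff)
  ultimately have "even (degree2 (completion D) {s,t})" by simp
  then have "even (degree2 (completion D) e)" if "card e = 2" for e
    using even_degree_completion[OF assms that] by metis
  then show ?thesis using card by (simp add: cycle2_def)
qed

lemma separated_eq_remaining: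
  assumes "D \<subseteq> remaining" "separated D" "D \<noteq> {}"
  shows "D = remaining"
proof -
  have "completion D = S"
    using subcycle[OF completion_subset cycle2_completion] assms by (auto simp: completion_def)
  then show ?thesis using assms(1) by (auto simp: completion_def remaining_def)
qed

text \<open>A maximal rigid union of pieces is separated, as otherwise a further piece could be glued on.\<close>
lemma generically_rigid_piece_remaining:
  assumes IH: "\<And>S' :: 'v set set. card (\<Union>S') < card (\<Union>S) \<Longrightarrow> min_cycle S' \<Longrightarrow> generically_rigid (edges2 S')"
  shows "generically_rigid (piece remaining)"
proof -
  let ?rigid_part = "\<lambda>D. balanced D \<and> D \<noteq> {} \<and> generically_rigid (piece D)"
  have "\<exists>D. ?rigid_part D"
  proof -
    obtain T where "T \<in> remaining" using remaining_nonempty by blast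
    then obtain D where "min_balanced D" using min_balanced_containing[OF balanced_remaining] by blast
    then show ?thesis using generically_rigid_piece[OF IH] by (auto simp: min_balanced_def)
  qed
  then obtain D where D: "?rigid_part D" and max: "\<And>D'. ?rigid_part D' \<Longrightarrow> card D' \<le> card D"
    using ex_has_greatest_nat[of ?rigid_part _ card "Suc (card (UNIV :: 'v set set))"]
    by (metis card_mono finite subset_UNIV le_imp_less_Suc)
  note remaining = balanced_subset[OF conjunct1[OF D]]
  have "separated D"
  proof (rule ccontr)
    assume "\<not> separated D"
    then obtain T c where T: "T \<in> remaining - D" "c \<in> T" "c \<in> \<Union>D" "c \<notin> {s,t}"
      by (auto simp: separated_def)
    have "balanced (remaining - D)" by (intro balanced_Diff balanced_remaining remaining) (simp add: D)
    then obtain D' where D': "min_balanced D'" "D' \<subseteq> remaining - D" "T \<in> D'"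
      using min_balanced_containing T(1) by metis
    then have balanced': "balanced D'" by (simp add: min_balanced_def)
    have "generically_rigid (piece (D \<union> D'))"
      using D balanced' T D'(3) generically_rigid_piece[OF IH D'(1)]
      by (intro generically_rigid_piece_Un[of D D' c]) auto
    moreover have "balanced (D \<union> D')" by (rule balanced_Un) (use D balanced' D'(2) in auto)
    ultimately have "card (D \<union> D') \<le> card D" using max D by blast
    moreover have "D \<subset> D \<union> D'" using D'(2,3) by blast
    ultimately show False by (metis finite psubset_card_mono not_le)
  qed
  then have "D = remaining" using separated_eq_remaining remaining D by blast
  then show ?thesis using D by simp
qed

lemma generically_rigid_edges2:
  assumes IH: "\<And>S' :: 'v set set. card (\<Union>S') < card (\<Union>S) \<Longrightarrow> min_cycle S' \<Longrightarrow> generically_rigid (edges2 S')"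
  shows "generically_rigid (edges2 S)"
proof (rule generically_mono[OF generically_rigid_piece_remaining[OF IH]])
  show "rigid u (edges2 S)" if "rigid u (piece remaining)" for u
  proof (rule rigid_superset[OF that])
    show "piece remaining \<subseteq> edges2 S"
      using edge s_neq_t by (auto simp: piece_def edges2_def remaining_def)
    show "\<Union>(edges2 S) \<subseteq> \<Union>(piece remaining)"
    proof
      fix x assume "x \<in> \<Union>(edges2 S)"
      then obtain T where T: "T \<in> S" "x \<in> T" by (auto simp: edges2_def)
      then have "x \<in> {s,t} \<union> \<Union>remaining"
        using other_triangle[OF T(1) _ T(2)] by (cases "T \<in> remaining") (auto simp: remaining_def)
      then show "x \<in> \<Union>(piece remaining)" using Union_piece[OF balanced_remaining] by simp
    qed
  qed
qed

end

theorem min_cycle_generically_rigid: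
  fixes S :: "'v::finite set set"
  assumes "min_cycle S"
  shows "generically_rigid (edges2 S)"
  using assms
proof (induction "card (\<Union>S)" arbitrary: S rule: less_induct)
  case less
  obtain T where T: "T \<in> S" "card T = 3" using less(2) by (auto simp: min_cycle_def cycle2_def)
  then obtain s t where "s \<in> T" "t \<in> T" "s \<noteq> t" by (auto simp: card_3_iff)
  then interpret contraction S s t using less(2) T by unfold_locales auto
  show ?case using generically_rigid_edges2 less(1) by blast
qed

section \<open>Dimensions of spaces of functions\<close>

definition (in vector_space) finite_dim :: "'b set \<Rightarrow> bool" where
  "finite_dim V \<longleftrightarrow> (\<exists>G. finite G \<and> V \<subseteq> span G)"

context vector_space
begin

lemma finite_dim_subset: "finite_dim W \<Longrightarrow> V \<subseteq> W \<Longrightarrow> finite_dim V"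
  unfolding finite_dim_def by blast

lemma finite_dim_independent_finite: "finite_dim V \<Longrightarrow> B \<subseteq> V \<Longrightarrow> independent B \<Longrightarrow> finite B"
  unfolding finite_dim_def using independent_span_bound by blast

lemma dim_zero: "dim {0} = 0"
  using dim_le_card[of "{0}" "{}"] by simp

lemma subspace_eq_of_dim_le:
  assumes U: "subspace U" and UW: "U \<subseteq> W" and finite_dim: "finite_dim W" and dim_le: "dim W \<le> dim U"
  shows "U = W"
proof -
  obtain B where B: "B \<subseteq> U" "independent B" "U \<subseteq> span B" "card B = dim U"
    using basis_exists by blast
  obtain C where C: "B \<subseteq> C" "C \<subseteq> W" "independent C" "W \<subseteq> span C"
    using maximal_independent_subset_extend[OF _ B(2), of W] B(1) UW by (metis order_trans)
  have "finite C" by (rule finite_dim_independent_finite[OF finite_dim C(2,3)])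
  moreover have "card C = dim W" using basis_card_eq_dim[OF C(2,4,3)] by simp
  ultimately have "B = C" using dim_le B(4) C(1) by (metis card_seteq)
  then have "W \<subseteq> span U" using C(4) span_mono[OF B(1)] by blast
  then show ?thesis using UW span_eq_iff[of U] U by blast
qed

lemma span_disjoint_of_independent:
  assumes C: "independent C" "B \<subseteq> C" and x: "x \<in> span B" "x \<in> span (C - B)"
  shows "x = 0"
proof -
  have "representation C x = representation B x" by (rule representation_extend[OF C(1) x(1) C(2)])
  moreover have "representation C x = representation (C - B) x"
    by (rule representation_extend[OF C(1) x(2) Diff_subset])
  ultimately have "representation C x b = 0" for b
    using representation_ne_zero by (metis Diff_iff)
  moreover have "x \<in> span C" using x(1) span_mono[OF C(2)] by blast
  ultimately show ?thesis using sum_nonzero_representation_eq[OF C(1)] by fastforce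
qed

end

text \<open>A basis \<open>B\<close> of the kernel extends to a basis \<open>C\<close> of \<open>V\<close>; then \<open>f\<close> maps \<open>C - B\<close> bijectively to a basis
  of the image.\<close>
lemma (in vector_space_pair) dim_kernel_image:
  assumes lin: "Vector_Spaces.linear s1 s2 f" and V: "vs1.subspace V" and finite_dim: "vs1.finite_dim V"
  shows "vs1.dim V = vs1.dim {x\<in>V. f x = 0} + vs2.dim (f ` V)"
proof -
  obtain B where B: "B \<subseteq> {x\<in>V. f x = 0}" "vs1.independent B" "{x\<in>V. f x = 0} \<subseteq> vs1.span B"
    "card B = vs1.dim {x\<in>V. f x = 0}"
    using vs1.basis_exists by blast
  then have "B \<subseteq> V" by auto
  then obtain C where C: "B \<subseteq> C" "C \<subseteq> V" "vs1.independent C" "V \<subseteq> vs1.span C"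
    using vs1.maximal_independent_subset_extend[OF _ B(2)] by metis
  have span_C: "vs1.span C = V" using C V vs1.span_subspace by blast
  let ?D = "C - B"
  have inj: "inj_on f (vs1.span ?D)"
  proof (subst linear_inj_on_iff_eq_0[OF lin vs1.subspace_span], intro ballI impI)
    fix x assume x: "x \<in> vs1.span ?D" "f x = 0"
    then have "x \<in> V" using vs1.span_mono[of ?D C] span_C by blast
    then have "x \<in> vs1.span B" using B(3) x(2) by blast
    then show "x = 0" using vs1.span_disjoint_of_independent[OF C(3,1)] x(1) by blast
  qed
  have "f ` ?D \<subseteq> f ` C" "f ` C \<subseteq> insert 0 (f ` ?D)" using B(1) by auto
  then have "vs2.span (f ` C) = vs2.span (f ` ?D)"
    using vs2.span_mono vs2.span_insert_0 by (metis subset_antisym)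
  then have "f ` V = vs2.span (f ` ?D)" using linear_span_image[OF lin, of C] span_C by simp
  moreover have "vs2.independent (f ` ?D)"
    using linear_independent_injective_image[OF lin _ inj] vs1.independent_mono[OF C(3)] by auto
  ultimately have "vs2.dim (f ` V) = card (f ` ?D)"
    using vs2.dim_span_eq_card_independent by simp
  also have "\<dots> = card ?D" by (rule card_image) (rule inj_on_subset[OF inj vs1.span_superset])
  finally have dim_image: "vs2.dim (f ` V) = card ?D" .
  have "finite C" by (rule vs1.finite_dim_independent_finite[OF finite_dim C(2,3)])
  then have "card C = card B + card ?D"
    using C(1) by (metis card_Diff_subset card_mono finite_subset le_add_diff_inverse)
  moreover have "vs1.dim V = card C" using vs1.basis_card_eq_dim[OF C(2,4,3)] by simp
  ultimately show ?thesis using dim_image B(4) by simp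
qed

lemma (in vector_space) dim_functional_kernel:
  assumes lin: "Vector_Spaces.linear scale (*) \<phi>" and V: "subspace V" "finite_dim V"
    and nonzero: "x \<in> V" "\<phi> x \<noteq> 0"
  shows "dim V = dim {y\<in>V. \<phi> y = 0} + 1"
proof -
  interpret pair: vector_space_pair scale "(*) :: 'a \<Rightarrow> 'a \<Rightarrow> 'a"
    ..
  have "k \<in> \<phi> ` V" for k
  proof (rule image_eqI)
    show "scale (k / \<phi> x) x \<in> V" by (rule subspace_scale[OF V(1) nonzero(1)])
    show "k = \<phi> (scale (k / \<phi> x) x)" using nonzero(2) by (simp add: pair.linear_scale[OF lin])
  qed
  then have "\<phi> ` V = UNIV" by blast
  moreover have "vector_space_over_itself.dim (UNIV :: 'a set) = 1"
    by (simp add: vector_space_over_itself.dim_UNIV)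
  ultimately show ?thesis using pair.dim_kernel_image[OF lin V] by simp
qed

lemma (in vector_space) separating_functional:
  assumes S: "subspace S" and x: "x \<notin> S"
  obtains \<phi> where "Vector_Spaces.linear scale (*) \<phi>" "\<And>y. y \<in> S \<Longrightarrow> \<phi> y = 0" "\<phi> x = 1"
proof -
  interpret pair: vector_space_pair scale "(*) :: 'a \<Rightarrow> 'a \<Rightarrow> 'a"
    ..
  obtain B where B: "B \<subseteq> S" "independent B" "S \<subseteq> span B" using basis_exists by metis
  then have span: "span B = S" using S span_subspace by blast
  then have "independent (insert x B)" using B(2) x by (simp add: independent_insertI)
  then obtain \<phi> where \<phi>: "Vector_Spaces.linear scale (*) \<phi>" "\<forall>b\<in>insert x B. \<phi> b = (if b = x then 1 else 0)"
    using pair.linear_independent_extend[of "insert x B" "\<lambda>b. if b = x then 1 else 0"] by blast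
  have "\<phi> b = 0" if "b \<in> B" for b using \<phi>(2) that x B(1) by auto
  then have "\<phi> y = 0" if "y \<in> S" for y using pair.linear_eq_0_on_span[OF \<phi>(1), of B y] that span by simp
  then show ?thesis using that \<phi> by simp
qed

interpretation fs: vector_space "\<lambda>c (f::'x \<Rightarrow> real). \<lambda>x. c * f x"
  by unfold_locales (simp_all add: fun_eq_iff distrib_left distrib_right)

interpretation ts: vector_space "\<lambda>c (F::'i \<Rightarrow> 'x \<Rightarrow> real). \<lambda>i x. c * F i x"
  by unfold_locales (simp_all add: fun_eq_iff distrib_left distrib_right)

interpretation tt: vector_space_pair "\<lambda>c (F::'i \<Rightarrow> 'x \<Rightarrow> real). \<lambda>i x. c * F i x"
   "\<lambda>c (F::'j \<Rightarrow> 'y \<Rightarrow> real). \<lambda>i x. c * F i x" ..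

interpretation tf: vector_space_pair "\<lambda>c (F::'i \<Rightarrow> 'x \<Rightarrow> real). \<lambda>i x. c * F i x"
   "\<lambda>c (f::'y \<Rightarrow> real). \<lambda>x. c * f x" ..

interpretation ft: vector_space_pair "\<lambda>c (f::'y \<Rightarrow> real). \<lambda>x. c * f x"
   "\<lambda>c (F::'i \<Rightarrow> 'x \<Rightarrow> real). \<lambda>i x. c * F i x" ..

interpretation ff: vector_space_pair "\<lambda>c (f::'x \<Rightarrow> real). \<lambda>x. c * f x"
   "\<lambda>c (f::'y \<Rightarrow> real). \<lambda>x. c * f x" ..

lemma fdim_eq: "fdim = fs.dim" by (simp add: fdim_def fun_eq_iff)
lemma tdim_eq: "tdim = ts.dim" by (simp add: tdim_def fun_eq_iff)

lemma sum_fun_apply: "(\<Sum>i\<in>I. f i) x = (\<Sum>i\<in>I. f i x)"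
  for f :: "'i \<Rightarrow> 'x \<Rightarrow> 'a::comm_monoid_add"
  by (induction I rule: infinite_finite_induct) auto

lemma fs_subspace_pointwise:
  assumes "fs.subspace V"
  shows "(\<lambda>x. 0) \<in> V"
    and "f \<in> V \<Longrightarrow> g \<in> V \<Longrightarrow> (\<lambda>x. f x + g x) \<in> V"
    and "f \<in> V \<Longrightarrow> (\<lambda>x. - f x) \<in> V"
    and "f \<in> V \<Longrightarrow> g \<in> V \<Longrightarrow> (\<lambda>x. f x - g x) \<in> V"
    and "(\<And>i. i \<in> I \<Longrightarrow> h i \<in> V) \<Longrightarrow> (\<lambda>x. \<Sum>i\<in>I. h i x) \<in> V"
  using fs.subspace_0[OF assms] fs.subspace_add[OF assms, of f g] fs.subspace_neg[OF assms, of f]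
    fs.subspace_diff[OF assms, of f g] fs.subspace_sum[OF assms, of I h]
  by (simp_all add: zero_fun_def plus_fun_def fun_Compl_def fun_diff_def sum_fun_apply[abs_def])

lemma ts_subspace_pointwise:
  assumes "ts.subspace V"
  shows "F \<in> V \<Longrightarrow> G \<in> V \<Longrightarrow> (\<lambda>i x. F i x - G i x) \<in> V"
    and "(\<And>k. k \<in> I \<Longrightarrow> H k \<in> V) \<Longrightarrow> (\<lambda>i x. \<Sum>k\<in>I. H k i x) \<in> V"
  using ts.subspace_diff[OF assms, of F G] ts.subspace_sum[OF assms, of I H]
  by (simp_all add: fun_diff_def sum_fun_apply[abs_def])

definition direct_sum :: "'i set \<Rightarrow> ('i \<Rightarrow> ('x \<Rightarrow> real) set) \<Rightarrow> ('i \<Rightarrow> 'x \<Rightarrow> real) set" where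
  "direct_sum I W = {F. (\<forall>i\<in>I. F i \<in> W i) \<and> (\<forall>i. i \<notin> I \<longrightarrow> F i = (\<lambda>x. 0))}"

lemma direct_sum_subspace:
  assumes W: "\<And>i. i \<in> I \<Longrightarrow> fs.subspace (W i)"
  shows "ts.subspace (direct_sum I W)"
proof (rule ts.subspaceI)
  show "0 \<in> direct_sum I W" using fs.subspace_0[OF W] by (simp add: direct_sum_def zero_fun_def)
  show "F + G \<in> direct_sum I W" if "F \<in> direct_sum I W" "G \<in> direct_sum I W" for F G
    using that fs.subspace_add[OF W] by (simp add: direct_sum_def plus_fun_def)
  show "(\<lambda>i x. c * F i x) \<in> direct_sum I W" if "F \<in> direct_sum I W" for c F
    using that fs.subspace_scale[OF W] by (simp add: direct_sum_def)
qed

definition single :: "'i \<Rightarrow> ('x \<Rightarrow> real) \<Rightarrow> 'i \<Rightarrow> 'x \<Rightarrow> real" where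
  "single i h = (\<lambda>j. if j = i then h else (\<lambda>x. 0))"

lemma linear_single: "Vector_Spaces.linear (\<lambda>c f x. c * f x) (\<lambda>c F i x. c * F i x) (single i)"
  by unfold_locales (auto simp: single_def fun_eq_iff)

lemma single_in_direct_sum:
  "i \<in> I \<Longrightarrow> h \<in> W i \<Longrightarrow> (\<And>j. j \<in> I \<Longrightarrow> fs.subspace (W j)) \<Longrightarrow> single i h \<in> direct_sum I W"
  using fs_subspace_pointwise(1) by (auto simp: single_def direct_sum_def)

lemma direct_sum_decomposition:
  assumes "finite I" "F \<in> direct_sum I W"
  shows "F = (\<Sum>i\<in>I. single i (F i))"
proof (intro ext)
  fix j x
  have "(\<Sum>i\<in>I. single i (F i) j x) = (\<Sum>i\<in>I. if i = j then F j x else 0)"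
    by (intro sum.cong) (auto simp: single_def)
  also have "\<dots> = F j x" using assms by (auto simp: direct_sum_def)
  finally show "F j x = (\<Sum>i\<in>I. single i (F i)) j x" by (simp add: sum_fun_apply)
qed

lemma direct_sum_finite_dim:
  assumes "finite I" and W: "\<And>i. i \<in> I \<Longrightarrow> fs.finite_dim (W i)"
  shows "ts.finite_dim (direct_sum I W)"
proof -
  obtain G where G: "\<And>i. i \<in> I \<Longrightarrow> finite (G i)" "\<And>i. i \<in> I \<Longrightarrow> W i \<subseteq> fs.span (G i)"
    using W unfolding fs.finite_dim_def by metis
  let ?H = "\<Union>i\<in>I. single i ` G i"
  have "F \<in> ts.span ?H" if F: "F \<in> direct_sum I W" for F
  proof -
    have "single i (F i) \<in> ts.span ?H" if i: "i \<in> I" for i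
    proof -
      have "F i \<in> fs.span (G i)" using F i G(2) by (auto simp: direct_sum_def)
      then have "single i (F i) \<in> ts.span (single i ` G i)"
        by (subst ft.linear_span_image[OF linear_single]) (rule imageI)
      also have "\<dots> \<subseteq> ts.span ?H" by (rule ts.span_mono) (use i in blast)
      finally show ?thesis .
    qed
    then have "(\<Sum>i\<in>I. single i (F i)) \<in> ts.span ?H" by (rule ts.span_sum)
    then show ?thesis using direct_sum_decomposition[OF assms(1) F] by simp
  qed
  moreover have "finite ?H" using assms(1) G(1) by blast
  ultimately show ?thesis unfolding ts.finite_dim_def by (intro exI[of _ ?H]) blast
qed

lemma direct_sum_dim:
  assumes "finite I" "\<And>i. i \<in> I \<Longrightarrow> fs.finite_dim (W i)" "\<And>i. i \<in> I \<Longrightarrow> fs.subspace (W i)"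
  shows "ts.dim (direct_sum I W) = (\<Sum>i\<in>I. fs.dim (W i))"
  using assms
proof (induction I rule: finite_induct)
  case empty
  have "direct_sum {} W = {0}" by (auto simp: direct_sum_def zero_fun_def fun_eq_iff)
  then show ?case by (simp add: ts.dim_zero)
next
  case (insert k I)
  let ?V = "direct_sum (insert k I) W"
  have lin: "Vector_Spaces.linear (\<lambda>c F i x. c * F i x) (\<lambda>c f x. c * f x) (\<lambda>F. F k)"
    by unfold_locales (auto simp: fun_eq_iff distrib_left distrib_right)
  have kernel: "{F\<in>?V. F k = 0} = direct_sum I W"
    using insert(2) fs.subspace_0[OF insert(5)[of k]] by (fastforce simp: direct_sum_def zero_fun_def)
  have "w \<in> (\<lambda>F. F k) ` ?V" if "w \<in> W k" for w
    using single_in_direct_sum[of k "insert k I" w W] that insert(5)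
    by (intro image_eqI[of _ _ "single k w"]) (auto simp: single_def)
  then have image: "(\<lambda>F. F k) ` ?V = W k" by (auto simp: direct_sum_def)
  have "ts.dim ?V = ts.dim {F\<in>?V. F k = 0} + fs.dim ((\<lambda>F. F k) ` ?V)"
    using insert by (intro tf.dim_kernel_image[OF lin] direct_sum_subspace direct_sum_finite_dim) auto
  then show ?case using insert kernel image by simp
qed

definition supported :: "'x set \<Rightarrow> ('x \<Rightarrow> real) set" where
  "supported I = {f. \<forall>x. x \<notin> I \<longrightarrow> f x = 0}"

lemma supported_subspace: "fs.subspace (supported I)"
  by (rule fs.subspaceI) (auto simp: supported_def)

lemma supported_finite_dim:
  assumes "finite I" shows "fs.finite_dim (supported I)"
proof -
  let ?\<delta> = "\<lambda>i x. if x = i then 1 else (0::real)"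
  have "f \<in> fs.span (?\<delta> ` I)" if f: "f \<in> supported I" for f
  proof -
    have "f = (\<Sum>i\<in>I. (\<lambda>x. f i * ?\<delta> i x))"
      using f assms by (simp add: fun_eq_iff sum_fun_apply supported_def if_distrib cong: if_cong)
    also have "\<dots> \<in> fs.span (?\<delta> ` I)" by (intro fs.span_sum fs.span_scale fs.span_base) auto
    finally show ?thesis .
  qed
  then show ?thesis unfolding fs.finite_dim_def using assms by blast
qed

lemma linear_evaluation: "Vector_Spaces.linear (\<lambda>c f x. c * f x) (*) (\<lambda>f. f x :: real)"
  by unfold_locales (auto simp: distrib_left distrib_right)

lemma supported_dim: "finite I \<Longrightarrow> fs.dim (supported I) = card I"
proof (induction I rule: finite_induct)
  case empty
  have "supported {} = {0 :: 'a \<Rightarrow> real}" by (auto simp: supported_def fun_eq_iff)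
  then show ?case using fs.dim_zero by simp
next
  case (insert k I)
  have "fs.dim (supported (insert k I)) = fs.dim {f\<in>supported (insert k I). f k = 0} + 1"
    using insert by (intro fs.dim_functional_kernel[OF linear_evaluation supported_subspace,
          of _ "\<lambda>x. if x = k then 1 else 0"] supported_finite_dim) (auto simp: supported_def)
  moreover have "{f\<in>supported (insert k I). f k = 0} = supported I" using insert(2) by (auto simp: supported_def)
  ultimately show ?case using insert by simp
qed


lemma linear_sum_over: "Vector_Spaces.linear (\<lambda>c F i x. c * F i x) (\<lambda>c f x. c * f x) (\<lambda>F. \<Sum>i\<in>I. F i)"
  by unfold_locales (auto simp: sum.distrib fun_eq_iff sum_fun_apply sum_distrib_left distrib_left distrib_right)

lemma dim_zero_sum:
  assumes "finite I" and W: "\<And>i. i \<in> I \<Longrightarrow> fs.finite_dim (W i)" "\<And>i. i \<in> I \<Longrightarrow> fs.subspace (W i)"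
  shows "ts.dim {F\<in>direct_sum I W. (\<Sum>i\<in>I. F i) = 0} + fs.dim ((\<lambda>F. \<Sum>i\<in>I. F i) ` direct_sum I W)
    = (\<Sum>i\<in>I. fs.dim (W i))"
  using tf.dim_kernel_image[OF linear_sum_over direct_sum_subspace direct_sum_finite_dim, of I W I]
    direct_sum_dim[OF assms] assms
  by simp

lemma sum_single: "finite I \<Longrightarrow> i \<in> I \<Longrightarrow> (\<Sum>j\<in>I. single i h j) = h"
  unfolding single_def zero_fun_def[symmetric] by simp

lemma sum_over_constant:
  assumes "finite I" "i \<in> I" "fs.subspace X"
  shows "(\<lambda>F. \<Sum>i\<in>I. F i) ` direct_sum I (\<lambda>_. X) = X"
proof
  show "(\<lambda>F. \<Sum>i\<in>I. F i) ` direct_sum I (\<lambda>_. X) \<subseteq> X"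
    by (auto simp: direct_sum_def intro: fs.subspace_sum[OF assms(3)])
  show "X \<subseteq> (\<lambda>F. \<Sum>i\<in>I. F i) ` direct_sum I (\<lambda>_. X)"
  proof
    fix h assume "h \<in> X"
    then have "single i h \<in> direct_sum I (\<lambda>_. X)" using assms by (intro single_in_direct_sum)
    then show "h \<in> (\<lambda>F. \<Sum>i\<in>I. F i) ` direct_sum I (\<lambda>_. X)" using sum_single[OF assms(1,2), of h] by (metis imageI)
  qed
qed

section \<open>Forms in three variables\<close>

lemma finite_mdeg: "finite {m. mdeg m = d}" "finite {m. mdeg m \<le> d}"
proof -
  have "{m. mdeg m \<le> d} \<subseteq> {..d} \<times> {..d} \<times> {..d}" by (auto simp: mdeg_def)
  then show "finite {m. mdeg m \<le> d}" by (rule finite_subset) simp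
  then show "finite {m. mdeg m = d}" by (rule finite_subset[rotated]) auto
qed

definition mono_comb :: "(nat \<times> nat \<times> nat) set \<Rightarrow> (nat \<times> nat \<times> nat \<Rightarrow> real) \<Rightarrow> real^3 \<Rightarrow> real" where
  "mono_comb M coef p = (\<Sum>m\<in>M. coef m * mono3 m p)"

lemma forms_eq_range: "forms d = range (mono_comb {m. mdeg m = d})"
  by (auto simp: forms_def mono_comb_def[abs_def])

lemma polys_eq_Union: "polys = (\<Union>N. range (mono_comb {m. mdeg m \<le> N}))"
  by (auto simp: polys_def mono_comb_def[abs_def])

lemma linear_mono_comb: "Vector_Spaces.linear (\<lambda>c f x. c * f x) (\<lambda>c f x. c * f x) (mono_comb M)"
  by unfold_locales
    (simp_all add: mono_comb_def fun_eq_iff algebra_simps sum.distrib sum_distrib_left)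

lemma forms_subspace: "fs.subspace (forms d)"
  unfolding forms_eq_range by (rule ff.linear_subspace_image[OF linear_mono_comb fs.subspace_UNIV])

lemmas forms_0 = fs_subspace_pointwise(1)[OF forms_subspace]
  and forms_add = fs_subspace_pointwise(2)[OF forms_subspace]
  and forms_diff = fs_subspace_pointwise(4)[OF forms_subspace]
  and forms_sum = fs_subspace_pointwise(5)[OF forms_subspace]
  and forms_scale = fs.subspace_scale[OF forms_subspace]

lemma mono3_in_forms: "mono3 m \<in> forms (mdeg m)"
proof -
  have "mono3 m = mono_comb {m'. mdeg m' = mdeg m} (\<lambda>m'. if m' = m then 1 else 0)"
    by (simp add: mono_comb_def fun_eq_iff if_distrib[of "\<lambda>c. c * _"] finite_mdeg cong: if_cong)
  then show ?thesis unfolding forms_eq_range by blast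
qed

lemma mono_comb_in_forms: "M \<subseteq> {m. mdeg m = d} \<Longrightarrow> mono_comb M coef \<in> forms d"
  unfolding mono_comb_def[abs_def] by (intro forms_sum forms_scale) (use mono3_in_forms in blast)

lemma mono_comb_union_disjoint:
  "finite M \<Longrightarrow> finite N \<Longrightarrow> M \<inter> N = {} \<Longrightarrow> mono_comb (M \<union> N) coef p = mono_comb M coef p + mono_comb N coef p"
  by (simp add: mono_comb_def sum.union_disjoint)

lemma mono_comb_extend:
  assumes "M \<subseteq> N" "finite N"
  shows "mono_comb M coef = mono_comb N (\<lambda>m. if m \<in> M then coef m else 0)"
  unfolding mono_comb_def using assms by (intro ext sum.mono_neutral_cong_left) auto

lemma forms_finite_dim: "fs.finite_dim (forms d)"
proof -
  have "mono_comb M coef \<in> fs.span (mono3 ` M)" for M coef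
  proof -
    have "mono_comb M coef = (\<Sum>m\<in>M. (\<lambda>p. coef m * mono3 m p))"
      by (simp add: fun_eq_iff sum_fun_apply mono_comb_def)
    also have "\<dots> \<in> fs.span (mono3 ` M)" by (intro fs.span_sum fs.span_scale fs.span_base) auto
    finally show ?thesis .
  qed
  then have "forms d \<subseteq> fs.span (mono3 ` {m. mdeg m = d})" by (auto simp: forms_eq_range)
  then show ?thesis unfolding fs.finite_dim_def using finite_mdeg(1) by blast
qed

lemma mono3_mult: "mono3 (a,b,c) p * mono3 (a',b',c') p = mono3 (a+a',b+b',c+c') p"
  by (simp add: mono3_def power_add)

lemma forms_mult:
  assumes "f \<in> forms d" "g \<in> forms e"
  shows "(\<lambda>p. f p * g p) \<in> forms (d + e)"
proof -
  obtain a b where f: "f = mono_comb {m. mdeg m = d} a" and g: "g = mono_comb {m. mdeg m = e} b"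
    using assms unfolding forms_eq_range by blast
  have mono: "(\<lambda>p. mono3 m p * mono3 m' p) \<in> forms (d + e)" if "mdeg m = d" "mdeg m' = e" for m m'
  proof -
    obtain x y z x' y' z' where m: "m = (x,y,z)" "m' = (x',y',z')" by (metis prod.exhaust)
    then have "mdeg (x+x',y+y',z+z') = d + e" using that by (simp add: mdeg_def)
    then show ?thesis using mono3_in_forms[of "(x+x',y+y',z+z')"] by (simp add: m mono3_mult)
  qed
  have "(\<lambda>p. \<Sum>m\<in>{m. mdeg m = d}. \<Sum>m'\<in>{m. mdeg m = e}. (a m * b m') * (mono3 m p * mono3 m' p)) \<in> forms (d + e)"
    using mono by (intro forms_sum forms_scale) auto
  moreover have "(\<lambda>p. f p * g p) =
    (\<lambda>p. \<Sum>m\<in>{m. mdeg m = d}. \<Sum>m'\<in>{m. mdeg m = e}. (a m * b m') * (mono3 m p * mono3 m' p))"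
    by (simp add: f g mono_comb_def sum_product mult_ac)
  ultimately show ?thesis by simp
qed

lemma coord_in_forms: "(\<lambda>p. p $ i) \<in> forms 1"
proof -
  have "mono3 (1,0,0) = (\<lambda>p. p $ 1)" "mono3 (0,1,0) = (\<lambda>p. p $ 2)" "mono3 (0,0,1) = (\<lambda>p. p $ 3)"
    by (simp_all add: mono3_def fun_eq_iff)
  then show ?thesis
    using exhaust_3[of i] mono3_in_forms[of "(1,0,0)"] mono3_in_forms[of "(0,1,0)"] mono3_in_forms[of "(0,0,1)"]
    by (auto simp: mdeg_def)
qed

lemma const_in_forms: "(\<lambda>p. c) \<in> forms 0"
  using forms_scale[OF mono3_in_forms[of "(0,0,0)"], of c] by (simp add: mdeg_def mono3_def)

lemma inner_in_forms: "(\<lambda>p. n \<bullet> p) \<in> forms 1"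
  unfolding inner_vec_def inner_real_def by (intro forms_sum forms_scale coord_in_forms)

lemma inner_square_in_forms: "(\<lambda>p. (n \<bullet> p)\<^sup>2) \<in> forms 2"
  using forms_mult[OF inner_in_forms inner_in_forms, of n n] by (simp add: power2_eq_square numeral_2_eq_2)

lemma mono3_scaled: "mono3 m (t *\<^sub>R p) = t ^ mdeg m * mono3 m p"
  by (cases m) (simp add: mono3_def mdeg_def power_mult_distrib power_add)

lemma forms_homogeneous: "f \<in> forms d \<Longrightarrow> f (t *\<^sub>R p) = t ^ d * f p"
  unfolding forms_eq_range
  by (auto simp: mono_comb_def mono3_scaled sum_distrib_left mult_ac intro!: sum.cong)

lemma forms_continuous:
  assumes "f \<in> forms d" shows "continuous_on UNIV f"
proof -
  have "continuous_on UNIV (mono3 m)" for m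
    by (cases m) (simp add: mono3_def, intro continuous_intros)
  then show ?thesis using assms unfolding forms_def by (auto intro!: continuous_intros)
qed

lemma homogeneous_component_eq:
  assumes f: "f \<in> forms d" and g: "\<And>k. g k \<in> forms k" and "d \<le> N" and sum: "\<And>p. f p = (\<Sum>k\<le>N. g k p)"
  shows "f = g d"
proof
  fix p
  have "poly (monom (f p) d) t = poly (\<Sum>k\<le>N. monom (g k p) k) t" for t
  proof -
    have "t ^ d * f p = (\<Sum>k\<le>N. t ^ k * g k p)"
      using sum[of "t *\<^sub>R p"] forms_homogeneous[OF f, of t p] forms_homogeneous[OF g, of _ t p] by simp
    then show ?thesis by (simp add: poly_monom poly_sum mult.commute)
  qed
  then have "monom (f p) d = (\<Sum>k\<le>N. monom (g k p) k)" by (simp add: poly_eq_poly_eq_iff[symmetric] fun_eq_iff)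
  then have "f p = coeff (\<Sum>k\<le>N. monom (g k p) k) d" by (metis coeff_monom)
  also have "\<dots> = (\<Sum>k\<le>N. if k = d then g d p else 0)"
    unfolding coeff_sum by (intro sum.cong) (auto simp: coeff_monom)
  also have "\<dots> = g d p" using \<open>d \<le> N\<close> by simp
  finally show "f p = g d p" .
qed

lemma polys_homogeneous_components:
  assumes "G \<in> polys"
  shows "\<exists>g N. (\<forall>k. g k \<in> forms k) \<and> (\<forall>M\<ge>N. \<forall>p. G p = (\<Sum>k\<le>M. g k p))"
proof -
  obtain N coef where G: "G = mono_comb {m. mdeg m \<le> N} coef" using assms unfolding polys_eq_Union by blast
  let ?coef = "\<lambda>m. if mdeg m \<le> N then coef m else 0"
  define g where "g k = mono_comb {m. mdeg m = k} ?coef" for k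
  have "G p = (\<Sum>k\<le>M. g k p)" if "M \<ge> N" for M p
  proof -
    have "(\<Sum>k\<le>M. g k p) = (\<Sum>k\<in>{..M}. \<Sum>m\<in>{m\<in>{m. mdeg m \<le> M}. mdeg m = k}. ?coef m * mono3 m p)"
      unfolding g_def mono_comb_def by (intro sum.cong) auto
    also have "\<dots> = mono_comb {m. mdeg m \<le> M} ?coef p"
      unfolding mono_comb_def by (rule sum.group) (auto simp: finite_mdeg)
    also have "\<dots> = G p"
      using mono_comb_extend[of "{m. mdeg m \<le> N}" "{m. mdeg m \<le> M}" coef] that
      by (simp add: G finite_mdeg subset_iff)
    finally show ?thesis ..
  qed
  moreover have "g k \<in> forms k" for k unfolding g_def by (rule mono_comb_in_forms) simp
  ultimately show ?thesis by blast
qed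

lemma forms_subset_polys: "forms d \<subseteq> polys"
proof
  fix f assume "f \<in> forms d"
  then obtain coef where "f = mono_comb {m. mdeg m = d} coef" unfolding forms_eq_range by blast
  also have "\<dots> = mono_comb {m. mdeg m \<le> d} (\<lambda>m. if mdeg m = d then coef m else 0)"
    using mono_comb_extend[of "{m. mdeg m = d}" "{m. mdeg m \<le> d}" coef] by (simp add: finite_mdeg subset_iff)
  finally show "f \<in> polys" unfolding polys_eq_Union by blast
qed

definition sq_comb :: "('v \<Rightarrow> real^3) \<Rightarrow> 'v set set \<Rightarrow> ('v set \<Rightarrow> real^3 \<Rightarrow> real) \<Rightarrow> real^3 \<Rightarrow> real" where
  "sq_comb u T H p = (\<Sum>\<tau>\<in>T. (normal u \<tau> \<bullet> p)\<^sup>2 * H \<tau> p)"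

lemma sq_ideal_eq_image: "sq_ideal u T = sq_comb u T ` {H. \<forall>\<tau>\<in>T. H \<tau> \<in> polys}"
  unfolding sq_ideal_def sq_comb_def[abs_def] by blast

lemma linear_sq_comb: "Vector_Spaces.linear (\<lambda>c F i x. c * F i x) (\<lambda>c f x. c * f x) (sq_comb u T)"
  by unfold_locales
    (simp_all add: sq_comb_def fun_eq_iff algebra_simps sum.distrib sum_distrib_left)

lemma sq_comb_cong: "(\<And>\<tau>. \<tau> \<in> T \<Longrightarrow> H \<tau> = H' \<tau>) \<Longrightarrow> sq_comb u T H = sq_comb u T H'"
  by (simp add: sq_comb_def fun_eq_iff)

lemma sq_comb_in_forms:
  assumes "\<And>\<tau>. \<tau> \<in> T \<Longrightarrow> H \<tau> \<in> forms e"
  shows "sq_comb u T H \<in> forms (e + 2)"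
proof -
  have "(\<lambda>p. (normal u \<tau> \<bullet> p)\<^sup>2 * H \<tau> p) \<in> forms (e + 2)" if "\<tau> \<in> T" for \<tau>
    using forms_mult[OF inner_square_in_forms assms[OF that]] by (simp only: add.commute)
  then show ?thesis unfolding sq_comb_def[abs_def] by (rule forms_sum)
qed

text \<open>The summands are split into homogeneous components and those of degree \<open>d\<close> are compared.\<close>
lemma sq_ideal_form_eq_sq_comb:
  assumes T: "finite T" and f: "f \<in> sq_ideal u T" "f \<in> forms d"
  obtains h where "\<And>\<tau> k. \<tau> \<in> T \<Longrightarrow> h \<tau> k \<in> forms k"
    "f = (if d < 2 then (\<lambda>p. 0) else sq_comb u T (\<lambda>\<tau>. h \<tau> (d - 2)))"
proof -
  obtain G where G: "f = sq_comb u T G" "\<And>\<tau>. \<tau> \<in> T \<Longrightarrow> G \<tau> \<in> polys"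
    using f(1) unfolding sq_ideal_eq_image by blast
  then have "\<forall>\<tau>\<in>T. \<exists>h N. (\<forall>k. h k \<in> forms k) \<and> (\<forall>M\<ge>N. \<forall>p. G \<tau> p = (\<Sum>k\<le>M. h k p))"
    using polys_homogeneous_components by blast
  then obtain h N where h: "\<And>\<tau> k. \<tau> \<in> T \<Longrightarrow> h \<tau> k \<in> forms k"
    "\<And>\<tau> M p. \<tau> \<in> T \<Longrightarrow> M \<ge> N \<tau> \<Longrightarrow> G \<tau> p = (\<Sum>k\<le>M. h \<tau> k p)" by metis
  define M where "M = d + (\<Sum>\<tau>\<in>T. N \<tau>)"
  have "N \<tau> \<le> M" if "\<tau> \<in> T" for \<tau> using that T member_le_sum[of \<tau> T N] by (simp add: M_def)
  then have G_eq: "G \<tau> p = (\<Sum>k\<le>M. h \<tau> k p)" if "\<tau> \<in> T" for \<tau> p using h(2) that by blast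
  define g where "g k = (if k < 2 then (\<lambda>p. 0) else sq_comb u T (\<lambda>\<tau>. h \<tau> (k - 2)))" for k
  have "g k \<in> forms k" for k
  proof (cases "k < 2")
    case False
    then have "k - 2 + 2 = k" by simp
    then show ?thesis
      using sq_comb_in_forms[of T "\<lambda>\<tau>. h \<tau> (k - 2)" "k - 2" u] h(1) False by (simp only: g_def if_False)
  qed (simp add: g_def forms_0)
  moreover have "f p = (\<Sum>k\<le>Suc (Suc M). g k p)" for p
  proof -
    have "f p = (\<Sum>\<tau>\<in>T. \<Sum>k\<le>M. (normal u \<tau> \<bullet> p)\<^sup>2 * h \<tau> k p)"
      by (simp add: G(1) sq_comb_def G_eq sum_distrib_left)
    also have "\<dots> = (\<Sum>k\<le>M. sq_comb u T (\<lambda>\<tau>. h \<tau> k) p)" unfolding sq_comb_def by (rule sum.swap)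
    finally show ?thesis by (simp add: sum.atMost_Suc_shift g_def del: sum.atMost_Suc)
  qed
  ultimately have "f = g d" by (intro homogeneous_component_eq[OF f(2), of g "Suc (Suc M)"]) (auto simp: M_def)
  then show ?thesis using that[of h] h(1) by (simp only: g_def)
qed

lemma zero_in_sq_ideal: "(\<lambda>p. 0) \<in> sq_ideal u T"
proof -
  have "(\<lambda>p. 0) = sq_comb u T (\<lambda>\<tau> p. 0)" by (simp add: sq_comb_def fun_eq_iff)
  then show ?thesis unfolding sq_ideal_eq_image using forms_subset_polys[of 0] forms_0[of 0] by blast
qed

lemma sq_ideal_low_degree:
  assumes "finite T" "d < 2" shows "sq_ideal u T \<inter> forms d = {\<lambda>p. 0}"
proof -
  have "f = (\<lambda>p. 0)" if "f \<in> sq_ideal u T \<inter> forms d" for f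
    using that assms by (auto elim: sq_ideal_form_eq_sq_comb[OF assms(1)])
  then show ?thesis using zero_in_sq_ideal forms_0 by blast
qed

lemma sq_ideal_forms:
  assumes "finite T"
  shows "sq_ideal u T \<inter> forms (e + 2) = sq_comb u T ` {H. \<forall>\<tau>. H \<tau> \<in> forms e}"
proof
  show "sq_comb u T ` {H. \<forall>\<tau>. H \<tau> \<in> forms e} \<subseteq> sq_ideal u T \<inter> forms (e + 2)"
    unfolding sq_ideal_eq_image using sq_comb_in_forms forms_subset_polys by blast
  show "sq_ideal u T \<inter> forms (e + 2) \<subseteq> sq_comb u T ` {H. \<forall>\<tau>. H \<tau> \<in> forms e}"
  proof
    fix f assume "f \<in> sq_ideal u T \<inter> forms (e + 2)"
    then obtain h where h: "\<And>\<tau> k. \<tau> \<in> T \<Longrightarrow> h \<tau> k \<in> forms k" "f = sq_comb u T (\<lambda>\<tau>. h \<tau> e)"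
      using sq_ideal_form_eq_sq_comb[OF assms, of f u "e + 2"] by auto
    let ?H = "\<lambda>\<tau>. if \<tau> \<in> T then h \<tau> e else (\<lambda>p. 0)"
    have "f = sq_comb u T ?H" unfolding h(2) by (rule sq_comb_cong) simp
    moreover have "\<forall>\<tau>. ?H \<tau> \<in> forms e" using h(1) forms_0 by simp
    ultimately show "f \<in> sq_comb u T ` {H. \<forall>\<tau>. H \<tau> \<in> forms e}" by blast
  qed
qed

lemma family_of_forms_subspace: "ts.subspace {H. \<forall>i. H i \<in> forms e}"
  by (rule ts.subspaceI) (auto simp: zero_fun_def plus_fun_def forms_0 forms_add forms_scale)

lemma sq_ideal_forms_subspace:
  assumes "finite T"
  shows "fs.subspace (sq_ideal u T \<inter> forms d)"
proof (cases "d < 2")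
  case True
  then show ?thesis using fs.subspace_single_0 by (simp add: sq_ideal_low_degree[OF assms] zero_fun_def)
next
  case False
  then obtain e where "d = e + 2" by (metis le_add_diff_inverse2 not_less)
  then show ?thesis
    using tf.linear_subspace_image[OF linear_sq_comb family_of_forms_subspace]
    by (simp only: sq_ideal_forms[OF assms])
qed

lemma sq_ideal_forms_finite_dim: "fs.finite_dim (sq_ideal u T \<inter> forms d)"
  by (rule fs.finite_dim_subset[OF forms_finite_dim]) (rule Int_lower2)

lemma sq_ideal_mono:
  assumes "finite T'" "T \<subseteq> T'"
  shows "sq_ideal u T \<subseteq> sq_ideal u T'"
proof
  fix f assume "f \<in> sq_ideal u T"
  then obtain G where G: "f = sq_comb u T G" "\<And>\<tau>. \<tau> \<in> T \<Longrightarrow> G \<tau> \<in> polys" unfolding sq_ideal_eq_image by blast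
  let ?G = "\<lambda>\<tau>. if \<tau> \<in> T then G \<tau> else (\<lambda>p. 0)"
  have "f = sq_comb u T' ?G"
    unfolding G(1) sq_comb_def fun_eq_iff
    by (intro allI sum.mono_neutral_cong_left) (use assms in auto)
  moreover have "?G \<tau> \<in> polys" for \<tau> using G(2) forms_0[of 0] forms_subset_polys[of 0] by auto
  ultimately show "f \<in> sq_ideal u T'" unfolding sq_ideal_eq_image by blast
qed

lemma sq_ideal_forms_cases:
  assumes T: "finite T" and f: "f \<in> sq_ideal u T \<inter> forms d"
  obtains (zero) "f = (\<lambda>p. 0)" | (comb) e H where "d = e + 2" "\<And>\<tau>. H \<tau> \<in> forms e" "f = sq_comb u T H"
proof (cases "d < 2")
  case True
  then show ?thesis using f sq_ideal_low_degree[OF T] zero by blast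
next
  case False
  then obtain e where d: "d = e + 2" by (metis le_add_diff_inverse2 not_less)
  then show ?thesis using f comb[OF d] unfolding d sq_ideal_forms[OF T] by blast
qed

lemma sq_ideal_forms_mult:
  assumes T: "finite T" and f: "f \<in> sq_ideal u T \<inter> forms d" and q: "q \<in> forms k"
  shows "(\<lambda>p. q p * f p) \<in> sq_ideal u T \<inter> forms (d + k)"
  using T f
proof (cases rule: sq_ideal_forms_cases)
  case zero
  then show ?thesis using fs_subspace_pointwise(1)[OF sq_ideal_forms_subspace[OF T]] by simp
next
  case (comb e H)
  have "(\<lambda>p. q p * f p) = sq_comb u T (\<lambda>\<tau> p. H \<tau> p * q p)"
    by (simp add: comb(3) sq_comb_def fun_eq_iff sum_distrib_left mult_ac)
  moreover have "(\<lambda>p. H \<tau> p * q p) \<in> forms (e + k)" for \<tau> by (rule forms_mult[OF comb(2) q])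
  ultimately have "(\<lambda>p. q p * f p) \<in> sq_ideal u T \<inter> forms (e + k + 2)" unfolding sq_ideal_forms[OF T] by blast
  then show ?thesis by (simp add: comb(1) add.commute add.left_commute)
qed

lemma normal_square_in_ideal:
  assumes "finite T" "\<tau> \<in> T" shows "(\<lambda>p. (normal u \<tau> \<bullet> p)\<^sup>2) \<in> sq_ideal u T \<inter> forms 2"
proof -
  have "(\<lambda>p. (normal u \<tau> \<bullet> p)\<^sup>2) = sq_comb u {\<tau>} (\<lambda>\<tau> p. 1)" by (simp add: sq_comb_def fun_eq_iff)
  then have "(\<lambda>p. (normal u \<tau> \<bullet> p)\<^sup>2) \<in> sq_ideal u {\<tau>}"
    unfolding sq_ideal_eq_image using const_in_forms[of 1] forms_subset_polys[of 0] by blast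
  then show ?thesis using sq_ideal_mono[of T "{\<tau>}" u] assms inner_square_in_forms by auto
qed

lemma single_sq_comb:
  "single v (sq_comb u T H) w p = (\<Sum>\<tau>\<in>T. H \<tau> p * single v (\<lambda>p. (normal u \<tau> \<bullet> p)\<^sup>2) w p)"
  by (simp add: single_def sq_comb_def mult.commute)

definition forms_pred :: "nat \<Rightarrow> (real^3 \<Rightarrow> real) set" where
  "forms_pred e = (if e = 0 then {\<lambda>p. 0} else forms (e - 1))"

lemma forms_pred_subspace: "fs.subspace (forms_pred e)"
  using fs.subspace_single_0 by (auto simp: forms_pred_def forms_subspace zero_fun_def)

lemmas forms_pred_0 = fs_subspace_pointwise(1)[OF forms_pred_subspace]
  and forms_pred_uminus = fs_subspace_pointwise(3)[OF forms_pred_subspace]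
  and forms_pred_sum = fs_subspace_pointwise(5)[OF forms_pred_subspace]
  and forms_pred_scale = fs.subspace_scale[OF forms_pred_subspace]

lemma coord_times_forms_pred: "f \<in> forms_pred e \<Longrightarrow> (\<lambda>p. p $ i * f p) \<in> forms e"
  using forms_mult[OF coord_in_forms, of f "e - 1" i] by (auto simp: forms_pred_def forms_0 split: if_splits)

lemma mono_comb_divide_by_coord:
  assumes "\<And>m. m \<in> M \<Longrightarrow> mdeg (l m) + 1 = e" "\<And>m p. m \<in> M \<Longrightarrow> mono3 m p = p $ i * mono3 (l m) p"
  obtains B where "B \<in> forms_pred e" "\<And>p. mono_comb M coef p = p $ i * B p"
proof
  have "mono3 (l m) \<in> forms_pred e" if "m \<in> M" for m
    using mono3_in_forms[of "l m"] assms(1)[OF that] by (auto simp: forms_pred_def)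
  then show "(\<lambda>p. \<Sum>m\<in>M. coef m * mono3 (l m) p) \<in> forms_pred e"
    by (intro forms_pred_sum forms_pred_scale)
  show "mono_comb M coef p = p $ i * (\<Sum>m\<in>M. coef m * mono3 (l m) p)" for p
    by (simp add: mono_comb_def assms(2) sum_distrib_left mult_ac)
qed

lemma mono_comb_divide_by_third:
  assumes "\<And>m. m \<in> M \<Longrightarrow> mdeg m = e \<and> snd (snd m) > 0"
  obtains C where "C \<in> forms_pred e" "\<And>p. mono_comb M coef p = p $ 3 * C p"
proof (rule mono_comb_divide_by_coord[where l = "\<lambda>(a,b,c). (a,b,c - 1)" and i = 3])
  show "mdeg ((\<lambda>(a,b,c). (a,b,c - 1)) m) + 1 = e" if "m \<in> M" for m
    using assms[OF that] by (auto simp: mdeg_def split: prod.splits)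
  show "mono3 m p = p $ 3 * mono3 ((\<lambda>(a,b,c). (a,b,c - 1)) m) p" if "m \<in> M" for m p
    using assms[OF that] by (auto simp: mono3_def gr0_conv_Suc split: prod.splits)
qed (rule that)

lemma forms_split_off_third:
  assumes "f \<in> forms e"
  obtains C coef where "C \<in> forms_pred e"
    "\<And>p. f p = p $ 3 * C p + mono_comb {m. mdeg m = e \<and> snd (snd m) = 0} coef p"
proof -
  obtain coef where f: "f = mono_comb {m. mdeg m = e} coef" using assms unfolding forms_eq_range by blast
  let ?third = "{m. mdeg m = e \<and> snd (snd m) > 0}" and ?rest = "{m. mdeg m = e \<and> snd (snd m) = 0}"
  obtain C where C: "C \<in> forms_pred e" "\<And>p. mono_comb ?third coef p = p $ 3 * C p"
    using mono_comb_divide_by_third[of ?third e coef] by auto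
  have "{m. mdeg m = e} = ?third \<union> ?rest" by auto
  moreover have "finite ?third" "finite ?rest" by (auto intro: finite_subset[OF _ finite_mdeg(1)[of e]])
  moreover have "?third \<inter> ?rest = {}" by auto
  ultimately have "f p = mono_comb ?third coef p + mono_comb ?rest coef p" for p
    unfolding f by (metis (no_types, lifting) mono_comb_union_disjoint)
  then show ?thesis using that C by simp
qed

lemma mono_comb_without_third:
  assumes "p $ 1 = q $ 1" "p $ 2 = q $ 2"
  shows "mono_comb {m. mdeg m = e \<and> snd (snd m) = 0} coef p = mono_comb {m. mdeg m = e \<and> snd (snd m) = 0} coef q"
  unfolding mono_comb_def using assms by (intro sum.cong) (auto simp: mono3_def)

lemma forms_division:
  assumes "f \<in> forms e"
  obtains A B k where "A \<in> forms_pred e" "B \<in> forms_pred e"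
    "\<And>p. f p = p $ 2 * A p + p $ 3 * B p + k * (p $ 1) ^ e"
proof -
  obtain B coef where B: "B \<in> forms_pred e"
    "\<And>p. f p = p $ 3 * B p + mono_comb {m. mdeg m = e \<and> snd (snd m) = 0} coef p"
    using forms_split_off_third[OF assms] by blast
  let ?second = "{m. mdeg m = e \<and> snd (snd m) = 0 \<and> fst (snd m) > 0}"
  obtain A where A: "A \<in> forms_pred e" "\<And>p. mono_comb ?second coef p = p $ 2 * A p"
  proof (rule mono_comb_divide_by_coord[where coef = coef and l = "\<lambda>(a,b,c). (a,b - 1,c)" and i = 2])
    show "mdeg ((\<lambda>(a,b,c). (a,b - 1,c)) m) + 1 = e" if "m \<in> ?second" for m
      using that by (auto simp: mdeg_def split: prod.splits)
    show "mono3 m p = p $ 2 * mono3 ((\<lambda>(a,b,c). (a,b - 1,c)) m) p" if "m \<in> ?second" for m p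
      using that by (auto simp: mono3_def gr0_conv_Suc split: prod.splits)
  qed (rule that)
  have "{m. mdeg m = e \<and> snd (snd m) = 0} = ?second \<union> {(e,0,0)}" by (auto simp: mdeg_def)
  moreover have "finite ?second" by (auto intro: finite_subset[OF _ finite_mdeg(1)[of e]])
  ultimately have "mono_comb {m. mdeg m = e \<and> snd (snd m) = 0} coef p
    = p $ 2 * A p + coef (e,0,0) * (p $ 1) ^ e" for p
    using mono_comb_union_disjoint[of ?second "{(e,0,0)}" coef p] A(2) by (simp add: mono_comb_def mono3_def)
  then have "f p = p $ 2 * A p + p $ 3 * B p + coef (e,0,0) * (p $ 1) ^ e" for p using B(2)[of p] by simp
  then show ?thesis using that A(1) B(1) by blast
qed

lemma zero_if_zero_off_hyperplane:
  fixes f :: "real^'n \<Rightarrow> real"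
  assumes "continuous_on UNIV f" and "\<And>p. p $ i \<noteq> 0 \<Longrightarrow> f p = 0"
  shows "f p = 0"
proof -
  have "interior {p :: real^'n. axis i 1 \<bullet> p = 0} = {}" by (rule interior_hyperplane) (simp add: axis_eq_0_iff)
  then have dense: "closure (- {p :: real^'n. p $ i = 0}) = UNIV"
    by (simp add: closure_complement inner_axis')
  show ?thesis
    by (rule continuous_constant_on_closure[of "- {p. p $ i = 0}"]) (use assms in \<open>auto simp: dense\<close>)
qed

lemma koszul_exact_explicit:
  fixes g :: "3 \<Rightarrow> real^3 \<Rightarrow> real"
  assumes g: "\<And>j. g j \<in> forms e" and relation: "\<And>p. (\<Sum>j\<in>UNIV. g j p * p $ j) = 0"
  obtains A B C where "A \<in> forms_pred e" "B \<in> forms_pred e" "C \<in> forms_pred e"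
    "\<And>p. g 1 p = p $ 2 * A p + p $ 3 * B p" "\<And>p. g 2 p = - (p $ 1 * A p) + p $ 3 * C p"
    "\<And>p. g 3 p = - (p $ 1 * B p) - p $ 2 * C p"
proof -
  have relation: "g 1 p * p $ 1 + g 2 p * p $ 2 + g 3 p * p $ 3 = 0" for p using relation[of p] by (simp add: sum_3)
  obtain A B k where AB: "A \<in> forms_pred e" "B \<in> forms_pred e"
    "\<And>p. g 1 p = p $ 2 * A p + p $ 3 * B p + k * (p $ 1) ^ e"
    using forms_division[OF g[of 1]] by blast
  have "k = 0" using relation[of "axis 1 1"] AB(3)[of "axis 1 1"] by (simp add: axis_def)
  then have g1_eq: "g 1 p = p $ 2 * A p + p $ 3 * B p" for p using AB(3) by simp
  let ?h2 = "\<lambda>p. g 2 p + p $ 1 * A p"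
  have h2_in_forms: "?h2 \<in> forms e" by (intro forms_add g coord_times_forms_pred AB)
  obtain C coef where C: "C \<in> forms_pred e"
    "\<And>p. ?h2 p = p $ 3 * C p + mono_comb {m. mdeg m = e \<and> snd (snd m) = 0} coef p"
    using forms_split_off_third[OF h2_in_forms] by blast
  define r where "r = mono_comb {m. mdeg m = e \<and> snd (snd m) = 0} coef"
  have r_zero: "r p = 0" for p
  proof (rule zero_if_zero_off_hyperplane)
    show "continuous_on UNIV r" unfolding r_def by (rule forms_continuous[of _ e], rule mono_comb_in_forms) auto
    fix p :: "real^3" assume p: "p $ 2 \<noteq> 0"
    let ?q = "\<chi> i. if i = 3 then 0 else p $ i"
    have "?q $ 2 * ?h2 ?q = 0" using relation[of ?q] g1_eq[of ?q] by (simp add: algebra_simps)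
    then have "?h2 ?q = 0" using p by simp
    then have "r ?q = 0" using C(2)[of ?q] by (simp add: r_def)
    moreover have "r ?q = r p" unfolding r_def by (rule mono_comb_without_third) simp_all
    ultimately show "r p = 0" by simp
  qed
  have g2_eq: "g 2 p = - (p $ 1 * A p) + p $ 3 * C p" for p
    using C(2)[of p] r_zero[of p] unfolding r_def by simp
  have "g 3 p + p $ 1 * B p + p $ 2 * C p = 0" for p
  proof (rule zero_if_zero_off_hyperplane)
    show "continuous_on UNIV (\<lambda>p. g 3 p + p $ 1 * B p + p $ 2 * C p)"
      by (rule forms_continuous[of _ e]) (intro forms_add g coord_times_forms_pred AB C)
    fix p :: "real^3" assume "p $ 3 \<noteq> 0"
    moreover have "p $ 3 * (g 3 p + p $ 1 * B p + p $ 2 * C p) = 0"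
      using relation[of p] by (simp add: g1_eq g2_eq algebra_simps)
    ultimately show "g 3 p + p $ 1 * B p + p $ 2 * C p = 0" by simp
  qed
  then have "g 3 p = - (p $ 1 * B p) - p $ 2 * C p" for p by (smt (verit))
  then show ?thesis using that AB(1,2) C(1) g1_eq g2_eq by blast
qed

lemma koszul_exact:
  fixes g :: "3 \<Rightarrow> real^3 \<Rightarrow> real"
  assumes "\<And>j. g j \<in> forms e" "\<And>p. (\<Sum>j\<in>UNIV. g j p * p $ j) = 0"
  obtains a where "\<And>j k. a j k \<in> forms_pred e" "\<And>j k p. a j k p = - a k j p"
    "\<And>j p. g j p = (\<Sum>k\<in>UNIV. a j k p * p $ k)"
proof -
  obtain A B C where ABC: "A \<in> forms_pred e" "B \<in> forms_pred e" "C \<in> forms_pred e"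
    and g: "\<And>p. g 1 p = p $ 2 * A p + p $ 3 * B p" "\<And>p. g 2 p = - (p $ 1 * A p) + p $ 3 * C p"
      "\<And>p. g 3 p = - (p $ 1 * B p) - p $ 2 * C p"
    using koszul_exact_explicit[OF assms] by blast
  define a where "a j k = (if j = 1 \<and> k = 2 then A else if j = 2 \<and> k = 1 then (\<lambda>p. - A p)
      else if j = 1 \<and> k = 3 then B else if j = 3 \<and> k = 1 then (\<lambda>p. - B p)
      else if j = 2 \<and> k = 3 then C else if j = 3 \<and> k = 2 then (\<lambda>p. - C p) else (\<lambda>p. 0))" for j k :: 3
  have "a j k \<in> forms_pred e" for j k
    unfolding a_def by (auto intro: ABC forms_pred_uminus forms_pred_0)
  moreover have "a j k p = - a k j p" for j k p
    using exhaust_3[of j] exhaust_3[of k] by (elim disjE) (simp_all add: a_def)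
  moreover have "g j p = (\<Sum>k\<in>UNIV. a j k p * p $ k)" for j p
    using exhaust_3[of j] by (elim disjE) (simp_all add: a_def sum_3 g mult.commute)
  ultimately show ?thesis by (rule that)
qed

section \<open>Simplicial cocycles on a simply connected link\<close>

lemma finite_rat_common_denominator:
  assumes "finite (R :: rat set)"
  shows "\<exists>N::int. N > 0 \<and> (\<forall>r\<in>R. of_int N * r \<in> \<int>)"
  using assms
proof (induction R rule: finite_induct)
  case empty show ?case by (rule exI[of _ 1]) simp
next
  case (insert r R)
  then obtain N where N: "N > 0" "\<forall>r\<in>R. of_int N * r \<in> \<int>" by blast
  obtain a b where r: "r = of_int a / of_int b" "b > 0" by (metis Fract_of_int_quotient Rat_cases)
  have "of_int (N * b) * r = of_int (N * a)" using r by simp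
  then have "of_int (N * b) * r \<in> \<int>" by (metis Ints_of_int)
  moreover have "of_int (N * b) * x \<in> \<int>" if "x \<in> R" for x
  proof -
    have "of_int (N * b) * x = of_int b * (of_int N * x)" by simp
    then show ?thesis using N(2) that by (metis Ints_mult Ints_of_int)
  qed
  ultimately show ?case using N r by (intro exI[of _ "N * b"]) auto
qed

interpretation rv: vector_space "\<lambda>(q::rat) (x::real). of_rat q * x"
  by unfold_locales (simp_all add: distrib_left distrib_right of_rat_add of_rat_mult mult.assoc)

locale fan_link =
  fixes K :: "'v::finite set set" and u :: "'v \<Rightarrow> real^3"
  assumes fan: "simplicial_fan K u"
begin

lemma subface_in_K: "A \<in> K \<Longrightarrow> B \<subseteq> A \<Longrightarrow> B \<in> K"
  and vertex_in_K: "{v} \<in> K" and empty_in_K: "{} \<in> K"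
  using fan unfolding simplicial_fan_def by blast+

lemma inj_on_rays: "A \<in> K \<Longrightarrow> inj_on u A" and independent_rays: "A \<in> K \<Longrightarrow> independent (u ` A)"
  and pos_hull_Int: "A \<in> K \<Longrightarrow> B \<in> K \<Longrightarrow> pos_hull u A \<inter> pos_hull u B = pos_hull u (A \<inter> B)"
  using fan unfolding simplicial_fan_def by blast+

definition ray :: "'v \<Rightarrow> real^3" where "ray v = (1 / norm (u v)) *\<^sub>R u v"

lemma ray_nonzero: "u v \<noteq> 0"
  using independent_rays[OF vertex_in_K[of v]] dependent_zero by auto

definition coord :: "'v set \<Rightarrow> 'v \<Rightarrow> real^3 \<Rightarrow> real" where
  "coord A v = (SOME g. linear g \<and> (\<forall>w\<in>A. g (ray w) = (if w = v then 1 else 0)))"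

lemma coord:
  assumes A: "A \<in> K"
  shows linear_coord: "linear (coord A v)" and coord_ray: "w \<in> A \<Longrightarrow> coord A v (ray w) = (if w = v then 1 else 0)"
proof -
  let ?value = "\<lambda>x. if the_inv_into A u x = v then norm (u v) else 0"
  obtain g :: "real^3 \<Rightarrow> real" where g: "linear g" "\<forall>x\<in>u ` A. g x = ?value x"
    using linear_independent_extend[OF independent_rays[OF A], of ?value] by blast
  have "g (ray w) = (if w = v then 1 else 0)" if "w \<in> A" for w
    using g(2) that the_inv_into_f_f[OF inj_on_rays[OF A] that] ray_nonzero
    by (simp add: ray_def linear_cmul[OF g(1)])
  then have "\<exists>g::real^3 \<Rightarrow> real. linear g \<and> (\<forall>w\<in>A. g (ray w) = (if w = v then 1 else 0))" using g(1) by blast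
  from someI_ex[OF this] show "linear (coord A v)" "w \<in> A \<Longrightarrow> coord A v (ray w) = (if w = v then 1 else 0)"
    unfolding coord_def by blast+
qed

lemma coord_linear_combination:
  assumes A: "A \<in> K" and B: "B \<subseteq> A"
  shows "coord A w (\<Sum>v\<in>B. c v *\<^sub>R ray v) = (if w \<in> B then c w else 0)"
proof -
  have "coord A w (\<Sum>v\<in>B. c v *\<^sub>R ray v) = (\<Sum>v\<in>B. c v * coord A w (ray v))"
    by (simp add: linear_sum[OF linear_coord[OF A]] linear_cmul[OF linear_coord[OF A]])
  also have "\<dots> = (\<Sum>v\<in>B. if v = w then c v else 0)"
    using B coord_ray[OF A] by (intro sum.cong) auto
  finally show ?thesis by simp
qed

definition cell :: "'v set \<Rightarrow> (real^3) set" where "cell A = convex hull (ray ` A)"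

lemma ray_in_cell: "v \<in> A \<Longrightarrow> ray v \<in> cell A"
  by (simp add: cell_def hull_inc)

lemma lk_space_eq_Union_cells: "lk_space K u = (\<Union>A\<in>K. cell A)"
  by (simp add: lk_space_def cell_def ray_def[abs_def])

lemma closed_cell: "closed (cell A)"
  unfolding cell_def by (rule compact_imp_closed, rule compact_convex_hull, rule finite_imp_compact) simp

lemma convex_cell: "convex (cell A)"
  by (simp add: cell_def)

lemma locally_path_connected_lk: "locally path_connected (lk_space K u)"
proof -
  have "ANR (\<Union>(cell ` K))"
    by (rule ANR_finite_Union_convex_closed) (auto simp: closed_cell convex_cell)
  then show ?thesis unfolding lk_space_eq_Union_cells by (rule ANR_imp_locally_path_connected)
qed

lemma cell_convex_combination:
  assumes A: "A \<in> K" and x: "x \<in> cell A"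
  obtains c where "\<And>v. v \<in> A \<Longrightarrow> c v \<ge> 0" "sum c A = 1" "x = (\<Sum>v\<in>A. c v *\<^sub>R ray v)"
proof -
  obtain b where b: "\<forall>y\<in>ray ` A. b y \<ge> 0" "sum b (ray ` A) = 1" "(\<Sum>y\<in>ray ` A. b y *\<^sub>R y) = x"
    using x unfolding cell_def by (subst (asm) convex_hull_finite) auto
  have "inj_on ray A"
    using coord_ray[OF A] by (intro inj_onI) (metis zero_neq_one)
  then have "sum (b \<circ> ray) A = 1" "x = (\<Sum>v\<in>A. (b \<circ> ray) v *\<^sub>R ray v)"
    using b(2,3) by (simp_all add: sum.reindex)
  then show ?thesis using that[of "b \<circ> ray"] b(1) by simp
qed

lemma cell_coord:
  assumes A: "A \<in> K" and "x \<in> cell A"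
  shows "v \<in> A \<Longrightarrow> coord A v x \<ge> 0" "(\<Sum>v\<in>A. coord A v x) = 1" "x = (\<Sum>v\<in>A. coord A v x *\<^sub>R ray v)"
proof -
  obtain c where c: "\<And>v. v \<in> A \<Longrightarrow> c v \<ge> 0" "sum c A = 1" "x = (\<Sum>v\<in>A. c v *\<^sub>R ray v)"
    using cell_convex_combination[OF assms] by blast
  have "coord A v x = c v" if "v \<in> A" for v
    using coord_linear_combination[OF A order_refl, of v c] that c(3) by simp
  then show "v \<in> A \<Longrightarrow> coord A v x \<ge> 0" "(\<Sum>v\<in>A. coord A v x) = 1" "x = (\<Sum>v\<in>A. coord A v x *\<^sub>R ray v)"
    using c by simp_all
qed

lemma cell_subset_pos_hull:
  assumes "A \<in> K" shows "cell A \<subseteq> pos_hull u A"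
proof
  fix x assume x: "x \<in> cell A"
  have "x = (\<Sum>v\<in>A. (coord A v x / norm (u v)) *\<^sub>R u v)"
    using cell_coord(3)[OF assms x] by (simp add: ray_def)
  moreover have "\<forall>v\<in>A. coord A v x / norm (u v) \<ge> 0" using cell_coord(1)[OF assms x] by simp
  ultimately show "x \<in> pos_hull u A" unfolding pos_hull_def mem_Collect_eq
    by (intro exI[of _ "\<lambda>v. coord A v x / norm (u v)"] conjI)
qed

lemma cell_Int_coord:
  assumes A: "A \<in> K" "x \<in> cell A" and B: "B \<in> K" "x \<in> cell B"
  obtains c where "\<And>v. v \<in> A \<Longrightarrow> coord A v x = (if v \<in> B then c v else 0)"
    "\<And>v. v \<in> B \<Longrightarrow> coord B v x = (if v \<in> A then c v else 0)"
proof -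
  have "x \<in> pos_hull u (A \<inter> B)"
    using cell_subset_pos_hull A B pos_hull_Int[OF A(1) B(1)] by blast
  then obtain c where "x = (\<Sum>v\<in>A \<inter> B. c v *\<^sub>R u v)" unfolding pos_hull_def by blast
  then have x: "x = (\<Sum>v\<in>A \<inter> B. (c v * norm (u v)) *\<^sub>R ray v)"
    by (simp add: ray_def ray_nonzero)
  show ?thesis
  proof (rule that[of "\<lambda>v. c v * norm (u v)"])
    show "coord A v x = (if v \<in> B then c v * norm (u v) else 0)" if "v \<in> A" for v
      unfolding x using coord_linear_combination[OF A(1) Int_lower1] that by simp
    show "coord B v x = (if v \<in> A then c v * norm (u v) else 0)" if "v \<in> B" for v
      unfolding x using coord_linear_combination[OF B(1) Int_lower2] that by simp
  qed
qed

lemma coord_sum_eq: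
  assumes "A \<in> K" "x \<in> cell A" "B \<in> K" "x \<in> cell B"
  shows "(\<Sum>w\<in>A. coord A w x * g w) = (\<Sum>w\<in>B. coord B w x * g w)"
proof -
  obtain c where c: "\<And>v. v \<in> A \<Longrightarrow> coord A v x = (if v \<in> B then c v else 0)"
    "\<And>v. v \<in> B \<Longrightarrow> coord B v x = (if v \<in> A then c v else 0)"
    using cell_Int_coord[OF assms] by blast
  have "(\<Sum>w\<in>A. coord A w x * g w) = (\<Sum>w\<in>A \<inter> B. c w * g w)"
    by (rule sum.mono_neutral_cong_right) (auto simp: c)
  also have "\<dots> = (\<Sum>w\<in>B. coord B w x * g w)"
    by (rule sum.mono_neutral_cong_left) (auto simp: c)
  finally show ?thesis .
qed

lemma cell_Int_imp_faces_meet: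
  assumes A: "A \<in> K" "x \<in> cell A" and "B \<in> K" "x \<in> cell B"
  shows "A \<inter> B \<noteq> {}"
proof
  assume "A \<inter> B = {}"
  then have "coord A v x = 0" if "v \<in> A" for v using cell_Int_coord[OF assms] that by (metis disjoint_iff)
  then show False using cell_coord(2)[OF A] by simp
qed

definition cocycle :: "('v \<Rightarrow> 'v \<Rightarrow> real) \<Rightarrow> bool" where
  "cocycle c \<longleftrightarrow> (\<forall>A\<in>K. \<forall>v\<in>A. \<forall>w\<in>A. \<forall>x\<in>A. c v w + c w x = c v x)"

lemma cocycleD: "cocycle c \<Longrightarrow> A \<in> K \<Longrightarrow> v \<in> A \<Longrightarrow> w \<in> A \<Longrightarrow> x \<in> A \<Longrightarrow> c v w + c w x = c v x"
  by (simp add: cocycle_def)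

definition coboundary :: "('v \<Rightarrow> 'v \<Rightarrow> real) \<Rightarrow> bool" where
  "coboundary c \<longleftrightarrow> (\<exists>b. \<forall>A\<in>K. \<forall>v\<in>A. \<forall>w\<in>A. c v w = b w - b v)"

end

text \<open>Affine interpolation turns an integral cocycle into a map from the link to the circle; a continuous
  logarithm of this map restricts to a potential on the vertices.\<close>
locale integral_cocycle = fan_link K u for K :: "'v::finite set set" and u :: "'v \<Rightarrow> real^3" +
  fixes c :: "'v \<Rightarrow> 'v \<Rightarrow> real"
  assumes cocycle: "cocycle c" and integral: "\<And>v w. c v w \<in> \<int>"
begin

definition base :: "'v set \<Rightarrow> 'v" where "base A = (SOME v. v \<in> A)"

lemma base_in: "v \<in> A \<Longrightarrow> base A \<in> A"
  unfolding base_def by (rule someI)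

definition lift :: "'v set \<Rightarrow> real^3 \<Rightarrow> real" where
  "lift A x = (\<Sum>w\<in>A. coord A w x * c (base A) w)"

lemma continuous_on_lift:
  assumes "A \<in> K" shows "continuous_on X (lift A)"
proof -
  have "linear (lift A)" unfolding lift_def
    by (intro linear_compose_sum ballI linearI)
      (simp_all add: linear_add[OF linear_coord[OF assms]] linear_cmul[OF linear_coord[OF assms]] distrib_right)
  then show ?thesis by (simp add: linear_continuous_on linear_conv_bounded_linear)
qed

lemma lift_ray: "A \<in> K \<Longrightarrow> v \<in> A \<Longrightarrow> lift A (ray v) = c (base A) v"
  by (simp add: lift_def coord_ray if_distrib[of "\<lambda>x. x * _"] cong: if_cong)

lemma lift_rebase:
  assumes A: "A \<in> K" "x \<in> cell A" and v: "v \<in> A"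
  shows "lift A x = c (base A) v + (\<Sum>w\<in>A. coord A w x * c v w)"
proof -
  have "lift A x = (\<Sum>w\<in>A. coord A w x * (c (base A) v + c v w))"
    unfolding lift_def using cocycleD[OF cocycle A(1) base_in[OF v] v] by (intro sum.cong) auto
  then show ?thesis
    using cell_coord(2)[OF A] by (simp add: distrib_left sum.distrib sum_distrib_right[symmetric])
qed

lemma lift_diff_integral:
  assumes A: "A \<in> K" "x \<in> cell A" and B: "B \<in> K" "x \<in> cell B"
  shows "lift A x - lift B x \<in> \<int>"
proof -
  obtain v where v: "v \<in> A" "v \<in> B" using cell_Int_imp_faces_meet[OF assms] by blast
  have "lift A x - lift B x = c (base A) v - c (base B) v"
    using lift_rebase[OF A v(1)] lift_rebase[OF B v(2)] coord_sum_eq[OF assms, of "c v"] by simp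
  then show ?thesis using integral by simp
qed

definition circle_map :: "real^3 \<Rightarrow> complex" where
  "circle_map x = exp (2 * pi * lift (SOME A. A \<in> K \<and> x \<in> cell A) x * \<i>)"

lemma circle_map_on_cell:
  assumes "A \<in> K" "x \<in> cell A"
  shows "circle_map x = exp (2 * pi * lift A x * \<i>)"
proof -
  let ?B = "SOME A. A \<in> K \<and> x \<in> cell A"
  have "?B \<in> K \<and> x \<in> cell ?B" by (rule someI[of "\<lambda>A. A \<in> K \<and> x \<in> cell A"]) (rule conjI[OF assms])
  then have "lift ?B x - lift A x \<in> \<int>" using lift_diff_integral assms by blast
  then obtain n where "lift ?B x - lift A x = of_int n" by (rule Ints_cases)
  then have "2 * pi * lift ?B x * \<i> = 2 * pi * lift A x * \<i> + of_int n * (2 * of_real pi * \<i>)"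
    by (simp add: algebra_simps)
  then show ?thesis unfolding circle_map_def by (simp add: exp_add exp_integer_2pi mult_ac)
qed

lemma continuous_on_circle_map: "continuous_on (lk_space K u) circle_map"
  unfolding lk_space_eq_Union_cells
proof (rule continuous_on_closed_Union)
  show "continuous_on (cell A) circle_map" if A: "A \<in> K" for A
  proof (rule continuous_on_eq)
    show "continuous_on (cell A) (\<lambda>x. exp (2 * pi * lift A x * \<i>))"
      by (intro continuous_intros continuous_on_lift[OF A])
  qed (simp add: circle_map_on_cell[OF A])
qed (simp_all add: closed_cell)

lemma logarithm_on_cell:
  assumes g: "continuous_on (lk_space K u) g" "\<And>x. x \<in> lk_space K u \<Longrightarrow> circle_map x = exp (g x)"
    and A: "A \<in> K" and x: "x \<in> cell A" and y: "y \<in> cell A"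
  shows "g x - g y = 2 * pi * (lift A x - lift A y) * \<i>"
proof -
  have sub: "cell A \<subseteq> lk_space K u" using A unfolding lk_space_eq_Union_cells by blast
  let ?h = "\<lambda>x. 2 * pi * lift A x * \<i> + (g y - 2 * pi * lift A y * \<i>)"
  have exp_g: "exp (g z) = exp (2 * pi * lift A z * \<i>)" if "z \<in> cell A" for z
    using g(2)[of z] circle_map_on_cell[OF A that] sub that by auto
  have "g x = ?h x"
  proof (rule covering_space_lift_unique[OF covering_space_exp_punctured_plane,
        where T = "cell A" and f = circle_map
        and a = y and ?g1.0 = g and ?g2.0 = ?h])
    show "continuous_on (cell A) circle_map" "continuous_on (cell A) g"
      using continuous_on_subset[OF continuous_on_circle_map sub] continuous_on_subset[OF g(1) sub] by auto
    show "continuous_on (cell A) ?h" by (intro continuous_intros continuous_on_lift[OF A])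
    show "circle_map z = exp (g z)" if "z \<in> cell A" for z using g(2) sub that by blast
    show "circle_map z = exp (?h z)" if "z \<in> cell A" for z
      using circle_map_on_cell[OF A that] exp_g[OF y] by (simp add: exp_add exp_diff)
    show "connected (cell A)" by (intro convex_connected convex_cell)
  qed (use x y in \<open>auto simp: circle_map_def\<close>)
  then show ?thesis by (simp add: algebra_simps)
qed

lemma coboundary_if_simply_connected:
  assumes "simply_connected (lk_space K u)"
  shows "coboundary c"
proof -
  obtain g where g: "continuous_on (lk_space K u) g" "\<And>x. x \<in> lk_space K u \<Longrightarrow> circle_map x = exp (g x)"
    using continuous_logarithm_on_simply_connected[OF continuous_on_circle_map assms locally_path_connected_lk]
    by (auto simp: circle_map_def)
  have "c v w = Im (g (ray w)) / (2 * pi) - Im (g (ray v)) / (2 * pi)" if A: "A \<in> K" "v \<in> A" "w \<in> A" for A v w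
  proof -
    have "g (ray w) - g (ray v) = 2 * pi * (c (base A) w - c (base A) v) * \<i>"
      using logarithm_on_cell[OF g A(1) ray_in_cell[OF A(3)] ray_in_cell[OF A(2)]] A by (simp add: lift_ray)
    then have "Im (g (ray w)) - Im (g (ray v)) = 2 * pi * (c (base A) w - c (base A) v)"
      by (simp flip: minus_complex.simps(2))
    moreover have "c (base A) w - c (base A) v = c v w"
      using cocycleD[OF cocycle A(1) base_in[OF A(2)] A(2,3)] by simp
    ultimately show ?thesis by (simp add: diff_divide_distrib[symmetric])
  qed
  then show ?thesis unfolding coboundary_def by (intro exI[of _ "\<lambda>v. Im (g (ray v)) / (2 * pi)"]) blast
qed

end

text \<open>Real cocycles reduce to integral ones through a rational basis of the span of their values.\<close>
theorem (in fan_link) cocycle_is_coboundary: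
  assumes simply_connected: "simply_connected (lk_space K u)" and cocycle: "cocycle c"
  shows "coboundary c"
proof -
  let ?values = "(\<lambda>(v,w). c v w) ` UNIV"
  obtain B where B: "B \<subseteq> ?values" "rv.independent B" "?values \<subseteq> rv.span B" using rv.basis_exists by metis
  have finite_B: "finite B" using B(1) by (rule finite_subset) simp
  have span: "c v w \<in> rv.span B" for v w using B(3) by auto
  define rep where "rep x v w = rv.representation B (c v w) x" for x v w
  let ?coeffs = "(\<lambda>(x,v,w). rep x v w) ` (B \<times> UNIV \<times> UNIV)"
  obtain N :: int where N: "N > 0" "\<And>r. r \<in> ?coeffs \<Longrightarrow> of_int N * r \<in> \<int>"
    using finite_rat_common_denominator[of ?coeffs] finite_B by (metis finite_SigmaI finite_imageI finite)
  define d where "d x v w = (of_rat (of_int N * rep x v w) :: real)" for x v w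
  have "coboundary (d x)" if x: "x \<in> B" for x
  proof -
    have "rep x v w + rep x w z = rep x v z" if "A \<in> K" "v \<in> A" "w \<in> A" "z \<in> A" for A v w z
      unfolding rep_def using rv.representation_add[OF B(2) span span, of v w w z] cocycleD[OF cocycle that]
      by (metis (no_types))
    then have "cocycle (d x)"
      unfolding cocycle_def d_def of_rat_add[symmetric] distrib_left[symmetric] by simp
    moreover have "d x v w \<in> \<int>" for v w
    proof -
      have "of_int N * rep x v w \<in> \<int>" using x by (intro N(2) image_eqI[of _ _ "(x,v,w)"]) auto
      then show ?thesis unfolding d_def by (metis Ints_cases Ints_of_int of_rat_of_int_eq)
    qed
    ultimately interpret integral_cocycle K u "d x" by unfold_locales
    show ?thesis by (rule coboundary_if_simply_connected[OF simply_connected])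
  qed
  then obtain b where b: "\<And>x A v w. x \<in> B \<Longrightarrow> A \<in> K \<Longrightarrow> v \<in> A \<Longrightarrow> w \<in> A \<Longrightarrow> d x v w = b x w - b x v"
    unfolding coboundary_def by metis
  have "c v w = (\<Sum>x\<in>B. b x w / of_int N * x) - (\<Sum>x\<in>B. b x v / of_int N * x)"
    if A: "A \<in> K" "v \<in> A" "w \<in> A" for A v w
  proof -
    have "c v w = (\<Sum>x\<in>B. of_rat (rep x v w) * x)"
      using rv.sum_representation_eq[OF B(2) span finite_B order_refl, of v w] by (simp add: rep_def)
    also have "\<dots> = (\<Sum>x\<in>B. (b x w - b x v) / of_int N * x)"
      using b[OF _ A, symmetric] N(1) by (intro sum.cong) (simp_all add: d_def of_rat_mult)
    finally show ?thesis
      by (simp add: sum_subtractf[symmetric] diff_divide_distrib left_diff_distrib)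
  qed
  then show ?thesis unfolding coboundary_def by (intro exI[of _ "\<lambda>v. \<Sum>x\<in>B. b x v / of_int N * x"]) blast
qed

section \<open>Jumps of piecewise constant functions\<close>

locale pure_fan = fan_link K u for K :: "'v::finite set set" and u :: "'v \<Rightarrow> real^3" +
  assumes pure: "pure3 K" and hereditary: "hereditary K"
begin

lemma ex_facet_containing:
  assumes "A \<in> K" shows "\<exists>\<sigma>\<in>facets K. A \<subseteq> \<sigma>"
proof -
  let ?P = "\<lambda>B. B \<in> K \<and> A \<subseteq> B"
  have "\<exists>B. ?P B \<and> (\<forall>C. ?P C \<longrightarrow> card C \<le> card B)"
    by (rule ex_has_greatest_nat[where k = A and b = "Suc (card (UNIV :: 'v set))"])
      (use assms in \<open>auto simp: less_Suc_eq_le card_mono\<close>)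
  then obtain B where B: "B \<in> K" "A \<subseteq> B" "\<And>C. C \<in> K \<Longrightarrow> A \<subseteq> C \<Longrightarrow> card C \<le> card B" by blast
  have "C = B" if "C \<in> K" "B \<subseteq> C" for C
    using card_seteq[of C B] B(2) B(3)[OF that(1)] that by auto
  then have "B \<in> facets K" using B by (auto simp: facets_def)
  then show ?thesis using B by blast
qed

lemma facets_nonempty: "facets K \<noteq> {}"
  using ex_facet_containing[OF empty_in_K] by blast

lemma card_facet: "\<sigma> \<in> facets K \<Longrightarrow> card \<sigma> = 3" and facet_in_K: "\<sigma> \<in> facets K \<Longrightarrow> \<sigma> \<in> K"
  using pure by (auto simp: pure3_def facets_def)

lemma facet_iff: "\<sigma> \<in> facets K \<longleftrightarrow> \<sigma> \<in> K \<and> card \<sigma> = 3"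
proof
  assume \<sigma>: "\<sigma> \<in> K \<and> card \<sigma> = 3"
  then obtain \<sigma>' where "\<sigma>' \<in> facets K" "\<sigma> \<subseteq> \<sigma>'" using ex_facet_containing by blast
  then show "\<sigma> \<in> facets K" using \<sigma> card_facet card_seteq[of \<sigma>' \<sigma>] by auto
qed (auto simp: card_facet facet_in_K)

lemma facet_third_vertex:
  assumes "\<sigma> \<in> facets K" "v \<in> \<sigma>" "w \<in> \<sigma>" "v \<noteq> w"
  obtains x where "\<sigma> = {v,w,x}" "distinct [v,w,x]"
proof -
  have "card (\<sigma> - {v,w}) = 1" using card_facet[OF assms(1)] assms by (simp add: card_Diff_subset)
  then obtain x where "\<sigma> - {v,w} = {x}" by (auto simp: card_1_singleton_iff)
  then have "\<sigma> = {v,w,x}" "distinct [v,w,x]" using assms by auto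
  then show ?thesis by (rule that)
qed

lemma facet_at_vertex:
  assumes "\<sigma> \<in> facets K" "v \<in> \<sigma>"
  obtains w x where "\<sigma> = {v,w,x}" "distinct [v,w,x]"
proof -
  have "\<sigma> \<noteq> {v}" using card_facet[OF assms(1)] by auto
  then obtain w where "w \<in> \<sigma>" "v \<noteq> w" using assms(2) by blast
  then show ?thesis using facet_third_vertex[OF assms] that by metis
qed

lemma facet_Int_eq:
  assumes "a \<in> facets K" "b \<in> facets K" "a \<noteq> b" "\<tau> \<subseteq> a \<inter> b" "card \<tau> = 2"
  shows "a \<inter> b = \<tau>"
proof -
  have "a \<inter> b \<noteq> a" using assms(1-3) card_facet card_seteq[of b a] by auto
  then have "card (a \<inter> b) < 3" using card_facet[OF assms(1)] psubset_card_mono[of a "a \<inter> b"] by auto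
  then show ?thesis using card_seteq[of "a \<inter> b" \<tau>] assms(4,5) by auto
qed

lemma ex_dual_vector:
  assumes "A \<in> K" "v \<in> A"
  shows "\<exists>n. n \<bullet> u v \<noteq> 0 \<and> (\<forall>w\<in>A. w \<noteq> v \<longrightarrow> n \<bullet> u w = 0)"
proof (intro exI conjI ballI impI)
  let ?n = "\<chi> i. coord A v (axis i 1)"
  have coord_eq: "coord A v x = ?n \<bullet> x" for x by (rule linear_functional_eq_inner[OF linear_coord[OF assms(1)]])
  show "?n \<bullet> u v \<noteq> 0" using coord_ray[OF assms, of v] coord_eq[of "ray v"] by (auto simp: ray_def)
  show "?n \<bullet> u w = 0" if "w \<in> A" "w \<noteq> v" for w
    using coord_ray[OF assms(1) that(1), of v] coord_eq[of "ray w"] that ray_nonzero[of w] by (simp add: ray_def)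
qed

lemma edge_cross_nonzero:
  assumes "{v,w} \<in> K" "v \<noteq> w" shows "cross3 (u v) (u w) \<noteq> 0"
proof
  assume zero: "cross3 (u v) (u w) = 0"
  obtain n where n: "n \<bullet> u v \<noteq> 0" "n \<bullet> u w = 0" using ex_dual_vector[OF assms(1), of v] assms(2) by auto
  show False using Lagrange[of n "u v" "u w"] zero n ray_nonzero[of w] by simp
qed

definition det3 :: "'v \<Rightarrow> 'v \<Rightarrow> 'v \<Rightarrow> real" where "det3 v w x = u v \<bullet> cross3 (u w) (u x)"

lemma det3_nonzero:
  assumes "{v,w,x} \<in> K" "distinct [v,w,x]"
  shows "det3 v w x \<noteq> 0"
proof
  assume zero: "det3 v w x = 0"
  obtain n where n: "n \<bullet> u v \<noteq> 0" "n \<bullet> u w = 0" "n \<bullet> u x = 0"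
    using ex_dual_vector[OF assms(1), of v] assms(2) by auto
  have "cross3 (u w) (u x) = 0" using triple_product_scaleR[of "u v" "u w" "u x" n] zero n by (simp add: det3_def)
  moreover have "{w,x} \<in> K" by (rule subface_in_K[OF assms(1)]) auto
  ultimately show False using edge_cross_nonzero assms(2) by auto
qed

lemma det3_swap: "det3 v x w = - det3 v w x" "det3 w v x = - det3 v w x"
  unfolding det3_def by (rule triple_product_swap)+

lemma pos_hull_triple:
  assumes "distinct [v,w,x]" "a \<ge> 0" "b \<ge> 0" "c \<ge> 0"
  shows "a *\<^sub>R u v + b *\<^sub>R u w + c *\<^sub>R u x \<in> pos_hull u {v,w,x}"
  unfolding pos_hull_def mem_Collect_eq
  by (intro exI[of _ "\<lambda>z. if z = v then a else if z = w then b else c"]) (use assms in auto)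

lemma pos_hulls_overlap:
  assumes distinct: "distinct [v,w,x]" "distinct [v,w,y]"
    and ux: "u x = a *\<^sub>R u v + b *\<^sub>R u w + c *\<^sub>R u y" and "c > 0"
  shows "\<exists>\<epsilon>>0. u v + u w + \<epsilon> *\<^sub>R u x \<in> pos_hull u {v,w,x} \<inter> pos_hull u {v,w,y}"
proof (intro exI[of _ "1 / (1 + \<bar>a\<bar> + \<bar>b\<bar>)"] conjI IntI)
  let ?\<epsilon> = "1 / (1 + \<bar>a\<bar> + \<bar>b\<bar>)"
  show \<epsilon>: "?\<epsilon> > 0" by auto
  have "\<bar>?\<epsilon> * r\<bar> \<le> 1" if "\<bar>r\<bar> \<le> 1 + \<bar>a\<bar> + \<bar>b\<bar>" for r
    using that by (auto simp: divide_simps abs_mult)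
  from this[of a] this[of b] have coeffs: "1 + ?\<epsilon> * a \<ge> 0" "1 + ?\<epsilon> * b \<ge> 0" by linarith+
  show "u v + u w + ?\<epsilon> *\<^sub>R u x \<in> pos_hull u {v,w,x}"
    using pos_hull_triple[OF distinct(1), of 1 1 ?\<epsilon>] \<epsilon> by simp
  have "u v + u w + ?\<epsilon> *\<^sub>R u x = (1 + ?\<epsilon> * a) *\<^sub>R u v + (1 + ?\<epsilon> * b) *\<^sub>R u w + (?\<epsilon> * c) *\<^sub>R u y"
    unfolding ux by (simp only: scaleR_add_left scaleR_add_right scaleR_scaleR scaleR_one) (simp add: algebra_simps)
  then show "u v + u w + ?\<epsilon> *\<^sub>R u x \<in> pos_hull u {v,w,y}"
    using pos_hull_triple[OF distinct(2) coeffs, of "?\<epsilon> * c"] \<epsilon> \<open>c > 0\<close>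
    by (simp only: mult_nonneg_nonneg less_imp_le)
qed

lemma facets_on_opposite_sides:
  assumes K: "{v,w,x} \<in> K" "{v,w,y} \<in> K" and distinct: "distinct [v,w,x,y]"
  shows "det3 v w x * det3 v w y < 0"
proof (rule ccontr)
  assume same_side: "\<not> det3 v w x * det3 v w y < 0"
  let ?D = "det3 v w y"
  have nonzero: "det3 v w x \<noteq> 0" "?D \<noteq> 0" using det3_nonzero K distinct by auto
  then have "det3 v w x * ?D > 0" using same_side by (metis mult_eq_0_iff not_less_iff_gr_or_eq)
  then have pos: "det3 v w x / ?D > 0" using nonzero by (simp add: zero_less_divide_iff zero_less_mult_iff)
  have "(1 / ?D) *\<^sub>R (?D *\<^sub>R u x)
    = (det3 x w y / ?D) *\<^sub>R u v + (det3 v x y / ?D) *\<^sub>R u w + (det3 v w x / ?D) *\<^sub>R u y"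
    using triple_product_cramer[of "u v" "u w" "u y" "u x"] by (simp add: det3_def scaleR_add_right)
  then have "u x = (det3 x w y / ?D) *\<^sub>R u v + (det3 v x y / ?D) *\<^sub>R u w + (det3 v w x / ?D) *\<^sub>R u y"
    using nonzero by simp
  from pos_hulls_overlap[OF _ _ this pos] distinct
  obtain \<epsilon> where \<epsilon>: "\<epsilon> > 0" and "u v + u w + \<epsilon> *\<^sub>R u x \<in> pos_hull u {v,w,x} \<inter> pos_hull u {v,w,y}" by auto
  moreover have "{v,w,x} \<inter> {v,w,y} = {v,w}" using distinct by auto
  ultimately have "u v + u w + \<epsilon> *\<^sub>R u x \<in> pos_hull u {v,w}" using pos_hull_Int[OF K] by simp
  then obtain l where l: "u v + u w + \<epsilon> *\<^sub>R u x = (\<Sum>z\<in>{v,w}. l z *\<^sub>R u z)" unfolding pos_hull_def by blast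
  obtain n where n: "n \<bullet> u x \<noteq> 0" "n \<bullet> u v = 0" "n \<bullet> u w = 0" using ex_dual_vector[OF K(1), of x] distinct by auto
  have "\<epsilon> * (n \<bullet> u x) = n \<bullet> (u v + u w + \<epsilon> *\<^sub>R u x)" using n by (simp add: inner_add_right)
  also have "\<dots> = 0" unfolding l using n distinct by (simp add: inner_add_right)
  finally show False using n(1) \<epsilon> by simp
qed

definition star :: "'v set \<Rightarrow> 'v set set" where "star \<tau> = {\<sigma>\<in>facets K. \<tau> \<subseteq> \<sigma>}"

lemma bdry_2faces_iff: "\<tau> \<in> bdry_2faces K \<longleftrightarrow> \<tau> \<in> K \<and> card \<tau> = 2 \<and> card (star \<tau>) = 1"
  by (simp add: bdry_2faces_def star_def)

lemma interior2_iff: "\<tau> \<in> interior2 K \<longleftrightarrow> \<tau> \<in> K \<and> card \<tau> = 2 \<and> card (star \<tau>) \<noteq> 1"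
proof -
  have "\<tau> \<in> bdry K \<longleftrightarrow> \<tau> \<in> bdry_2faces K" if "\<tau> \<in> K" "card \<tau> = 2"
    using that unfolding bdry_def bdry_2faces_def by (auto dest: card_seteq[rotated])
  then show ?thesis unfolding interior2_def using bdry_2faces_iff by blast
qed

text \<open>\<open>side \<sigma> v w\<close> is the side of the oriented plane through \<open>v\<close>, \<open>w\<close> on which the facet lies.\<close>
definition side :: "'v set \<Rightarrow> 'v \<Rightarrow> 'v \<Rightarrow> real" where
  "side \<sigma> v w = sgn (det3 v w (THE x. \<sigma> = {v,w,x} \<and> x \<noteq> v \<and> x \<noteq> w))"

lemma side_eq:
  assumes "distinct [v,w,x]" shows "side {v,w,x} v w = sgn (det3 v w x)"
proof -
  have "(THE y. {v,w,x} = {v,w,y} \<and> y \<noteq> v \<and> y \<noteq> w) = x" using assms by (intro the_equality) auto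
  then show ?thesis by (simp add: side_def)
qed

lemma side_values:
  assumes "\<sigma> \<in> facets K" "v \<in> \<sigma>" "w \<in> \<sigma>" "v \<noteq> w"
  shows "side \<sigma> v w \<in> {1, -1}"
proof -
  obtain x where x: "\<sigma> = {v,w,x}" "distinct [v,w,x]" using facet_third_vertex[OF assms] .
  have "det3 v w x \<noteq> 0" using det3_nonzero facet_in_K[OF assms(1)] x by blast
  then show ?thesis using side_eq[OF x(2)] x(1) by (auto simp: sgn_real_def)
qed

lemma side_swap:
  assumes "\<sigma> \<in> facets K" "v \<in> \<sigma>" "w \<in> \<sigma>" "v \<noteq> w"
  shows "side \<sigma> w v = - side \<sigma> v w"
proof -
  obtain x where x: "\<sigma> = {v,w,x}" "distinct [v,w,x]" using facet_third_vertex[OF assms] .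
  have "\<sigma> = {w,v,x}" "distinct [w,v,x]" using x by auto
  then show ?thesis using side_eq[OF x(2)] side_eq[of w v x] x(1) det3_swap(2)[of w v x] by (simp add: sgn_minus)
qed

lemma side_third_vertex:
  assumes "distinct [v,w,x]"
  shows "side {v,w,x} v x = - side {v,w,x} v w"
proof -
  have "{v,w,x} = {v,x,w}" by auto
  then have "side {v,w,x} v x = sgn (det3 v x w)" using side_eq[of v x w] assms by auto
  then show ?thesis using side_eq[OF assms] det3_swap(1)[of v x w] by (simp add: sgn_minus)
qed

lemma side_opposite:
  assumes \<sigma>: "\<sigma> \<in> facets K" "\<sigma>' \<in> facets K" "\<sigma> \<noteq> \<sigma>'" and vw: "{v,w} \<subseteq> \<sigma>" "{v,w} \<subseteq> \<sigma>'" "v \<noteq> w"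
  shows "side \<sigma>' v w = - side \<sigma> v w"
proof -
  obtain x where x: "\<sigma> = {v,w,x}" "distinct [v,w,x]" using facet_third_vertex[OF \<sigma>(1)] vw by auto
  obtain y where y: "\<sigma>' = {v,w,y}" "distinct [v,w,y]" using facet_third_vertex[OF \<sigma>(2)] vw by auto
  have "det3 v w x * det3 v w y < 0"
    by (rule facets_on_opposite_sides) (use x y \<sigma> facet_in_K in auto)
  then have "sgn (det3 v w y) = - sgn (det3 v w x)" by (auto simp: mult_less_0_iff sgn_real_def)
  then show ?thesis using side_eq x y by simp
qed

lemma card_star_le_2:
  assumes "card \<tau> = 2" shows "card (star \<tau>) \<le> 2"
proof (rule ccontr)
  assume "\<not> card (star \<tau>) \<le> 2"
  then obtain Q where "Q \<subseteq> star \<tau>" "card Q = 3" using obtain_subset_with_card_n[of 3 "star \<tau>"] by auto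
  then obtain a b c where abc: "a \<in> star \<tau>" "b \<in> star \<tau>" "c \<in> star \<tau>" "a \<noteq> b" "b \<noteq> c" "a \<noteq> c"
    by (auto simp: card_3_iff)
  obtain v w where vw: "\<tau> = {v,w}" "v \<noteq> w" using assms by (auto simp: card_2_iff)
  have "side b v w = - side a v w" "side c v w = - side a v w" "side c v w = - side b v w"
    using abc vw by (auto intro!: side_opposite simp: star_def)
  moreover have "side a v w \<noteq> 0" using side_values[of a v w] abc vw by (auto simp: star_def)
  ultimately show False by simp
qed

lemma star_interior2:
  assumes "\<tau> \<in> interior2 K"
  obtains a b where "star \<tau> = {a,b}" "a \<in> facets K" "b \<in> facets K" "a \<noteq> b" "a \<inter> b = \<tau>"
proof -
  have \<tau>: "\<tau> \<in> K" "card \<tau> = 2" "card (star \<tau>) \<noteq> 1" using assms by (auto simp: interior2_iff)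
  moreover have "star \<tau> \<noteq> {}" using ex_facet_containing[OF \<tau>(1)] by (auto simp: star_def)
  ultimately have "card (star \<tau>) = 2"
    using card_star_le_2[OF \<tau>(2)] card_gt_0_iff[of "star \<tau>"] by simp
  then obtain a b where ab: "star \<tau> = {a,b}" "a \<noteq> b" by (auto simp: card_2_iff)
  then have "a \<in> facets K" "b \<in> facets K" "\<tau> \<subseteq> a \<inter> b" by (auto simp: star_def)
  then show ?thesis using that[of a b] ab facet_Int_eq[of a b \<tau>] \<tau>(2) by simp
qed

lemma adjacent_facets:
  assumes "a \<in> facets K" "b \<in> facets K" "card (a \<inter> b) = 2"
  shows "a \<inter> b \<in> interior2 K" "star (a \<inter> b) = {a,b}" "a \<noteq> b"
proof -
  show ab: "a \<noteq> b" using assms card_facet by auto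
  have "{a,b} \<subseteq> star (a \<inter> b)" using assms by (auto simp: star_def)
  then show star: "star (a \<inter> b) = {a,b}"
    using card_star_le_2[OF assms(3)] ab card_seteq[of "star (a \<inter> b)" "{a,b}"] by simp
  have "a \<inter> b \<in> K" using subface_in_K[OF facet_in_K[OF assms(1)]] by auto
  then show "a \<inter> b \<in> interior2 K" using star ab assms(3) by (simp add: interior2_iff)
qed

definition orient :: "'v set \<Rightarrow> 'v \<times> 'v" where
  "orient \<tau> = (SOME p. \<tau> = {fst p, snd p} \<and> fst p \<noteq> snd p)"

lemma orient:
  assumes "card \<tau> = 2" shows "\<tau> = {fst (orient \<tau>), snd (orient \<tau>)}" "fst (orient \<tau>) \<noteq> snd (orient \<tau>)"
proof -
  obtain v w where "\<tau> = {v,w}" "v \<noteq> w" using assms by (auto simp: card_2_iff)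
  then have "\<exists>p. \<tau> = {fst p, snd p} \<and> fst p \<noteq> snd p" by (intro exI[of _ "(v,w)"]) auto
  from someI_ex[OF this] show "\<tau> = {fst (orient \<tau>), snd (orient \<tau>)}" "fst (orient \<tau>) \<noteq> snd (orient \<tau>)"
    unfolding orient_def by auto
qed

definition incidence :: "'v \<Rightarrow> 'v set \<Rightarrow> real" where
  "incidence v \<tau> = (if v = fst (orient \<tau>) then 1 else if v = snd (orient \<tau>) then -1 else 0)"

definition oriented_side :: "'v set \<Rightarrow> 'v set \<Rightarrow> real" where
  "oriented_side \<sigma> \<tau> = side \<sigma> (fst (orient \<tau>)) (snd (orient \<tau>))"

definition jump :: "('v set \<Rightarrow> real) \<Rightarrow> 'v set \<Rightarrow> real" where
  "jump F \<tau> = (\<Sum>\<sigma>\<in>star \<tau>. oriented_side \<sigma> \<tau> * F \<sigma>)"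

lemma incidence_values: "card \<tau> = 2 \<Longrightarrow> v \<in> \<tau> \<Longrightarrow> incidence v \<tau> \<in> {1, -1}"
  using orient[of \<tau>] by (auto simp: incidence_def)

lemma incidence_zero: "card \<tau> = 2 \<Longrightarrow> v \<notin> \<tau> \<Longrightarrow> incidence v \<tau> = 0"
  using orient[of \<tau>] by (auto simp: incidence_def)

lemma incidence_opposite: "card {v,w} = 2 \<Longrightarrow> incidence w {v,w} = - incidence v {v,w}"
  using orient[of "{v,w}"] by (auto simp: incidence_def doubleton_eq_iff)

lemma sum_incidence: "card \<tau> = 2 \<Longrightarrow> (\<Sum>v\<in>UNIV. incidence v \<tau>) = 0"
proof -
  assume "card \<tau> = 2"
  then have "(\<Sum>v\<in>{fst (orient \<tau>), snd (orient \<tau>)}. incidence v \<tau>) = 0"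
    using orient(2)[of \<tau>] by (simp add: incidence_def)
  moreover have "(\<Sum>v\<in>UNIV. incidence v \<tau>) = (\<Sum>v\<in>{fst (orient \<tau>), snd (orient \<tau>)}. incidence v \<tau>)"
    by (rule sum.mono_neutral_right) (auto simp: incidence_def)
  ultimately show ?thesis by simp
qed

lemma incidence_times_oriented_side:
  assumes "\<sigma> \<in> facets K" "{v,w} \<subseteq> \<sigma>" "v \<noteq> w"
  shows "incidence v {v,w} * oriented_side \<sigma> {v,w} = side \<sigma> v w"
proof -
  have "card {v,w} = 2" using assms by simp
  note oriented = orient[OF this]
  then consider "orient {v,w} = (v,w)" | "orient {v,w} = (w,v)" by (metis doubleton_eq_iff prod.collapse)
  then show ?thesis
  proof cases
    case 1 then show ?thesis by (simp add: incidence_def oriented_side_def)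
  next
    case 2 then show ?thesis using assms side_swap[of \<sigma> v w] by (simp add: incidence_def oriented_side_def)
  qed
qed

lemma oriented_side_values:
  assumes "\<sigma> \<in> facets K" "\<tau> \<subseteq> \<sigma>" "card \<tau> = 2"
  shows "oriented_side \<sigma> \<tau> \<in> {1, -1}"
  unfolding oriented_side_def using orient[OF assms(3)] assms(2) by (intro side_values[OF assms(1)]) auto

lemma jump_adjacent:
  assumes "a \<in> facets K" "b \<in> facets K" "card (a \<inter> b) = 2"
  shows "jump F (a \<inter> b) = oriented_side a (a \<inter> b) * (F a - F b)"
proof -
  note adjacent = adjacent_facets[OF assms]
  have "oriented_side b (a \<inter> b) = - oriented_side a (a \<inter> b)" unfolding oriented_side_def
    using orient[OF assms(3)] by (intro side_opposite assms(1,2) adjacent(3)) auto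
  then show ?thesis using adjacent(2,3) by (simp add: jump_def algebra_simps)
qed

lemma equal_if_jump_zero:
  assumes "a \<in> facets K" "b \<in> facets K" "card (a \<inter> b) = 2" "jump F (a \<inter> b) = 0"
  shows "F a = F b"
  using jump_adjacent[OF assms(1-3), of F] oriented_side_values[OF assms(1) Int_lower1 assms(3)] assms(4) by auto

lemma jump_const:
  assumes "\<tau> \<in> interior2 K" shows "jump (\<lambda>\<sigma>. k) \<tau> = 0"
proof -
  obtain a b where "a \<in> facets K" "b \<in> facets K" "a \<inter> b = \<tau>" using star_interior2[OF assms] by metis
  then show ?thesis using jump_adjacent[of a b "\<lambda>\<sigma>. k"] assms by (simp add: interior2_iff)
qed

lemma jump_add: "jump (\<lambda>\<sigma>. F \<sigma> + G \<sigma>) \<tau> = jump F \<tau> + jump G \<tau>"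
  and jump_diff: "jump (\<lambda>\<sigma>. F \<sigma> - G \<sigma>) \<tau> = jump F \<tau> - jump G \<tau>"
  and jump_scale: "jump (\<lambda>\<sigma>. c * F \<sigma>) \<tau> = c * jump F \<tau>"
  by (simp_all add: jump_def algebra_simps sum.distrib sum_subtractf sum_distrib_left)

lemma jump_cong: "(\<And>\<sigma>. \<sigma> \<in> facets K \<Longrightarrow> \<tau> \<subseteq> \<sigma> \<Longrightarrow> F \<sigma> = G \<sigma>) \<Longrightarrow> jump F \<tau> = jump G \<tau>"
  by (simp add: jump_def star_def)

lemma star_induct:
  assumes "\<psi> \<in> K" "a \<in> star \<psi>" "b \<in> star \<psi>" and base: "P a"
    and step: "\<And>x y. x \<in> facets K \<Longrightarrow> y \<in> facets K \<Longrightarrow> card (x \<inter> y) = 2 \<Longrightarrow> \<psi> \<subseteq> x \<inter> y \<Longrightarrow> P x \<Longrightarrow> P y"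
  shows "P b"
proof -
  have "(facet_adj K \<psi>)\<^sup>*\<^sup>* a b" using hereditary assms(1-3) unfolding hereditary_def star_def by blast
  then show ?thesis
    by (induction rule: rtranclp_induct) (auto simp: facet_adj_def intro: base step)
qed

lemma facet_induct:
  assumes "a \<in> facets K" "b \<in> facets K" "P a"
    and "\<And>x y. x \<in> facets K \<Longrightarrow> y \<in> facets K \<Longrightarrow> card (x \<inter> y) = 2 \<Longrightarrow> P x \<Longrightarrow> P y"
  shows "P b"
  by (rule star_induct[OF empty_in_K, of a b P]) (use assms in \<open>auto simp: star_def\<close>)

lemma constant_on_star_if_jumps_zero:
  assumes "\<psi> \<in> K" and jumps: "\<And>\<tau>. \<tau> \<in> interior2 K \<Longrightarrow> \<psi> \<subseteq> \<tau> \<Longrightarrow> jump F \<tau> = 0"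
    and ab: "a \<in> star \<psi>" "b \<in> star \<psi>"
  shows "F a = F b"
proof (rule star_induct[OF assms(1) ab, where P = "\<lambda>\<sigma>. F a = F \<sigma>"])
  fix x y assume xy: "x \<in> facets K" "y \<in> facets K" "card (x \<inter> y) = 2" and "\<psi> \<subseteq> x \<inter> y" "F a = F x"
  then have "jump F (x \<inter> y) = 0" using jumps adjacent_facets(1) by blast
  then show "F a = F y" using equal_if_jump_zero[OF xy] \<open>F a = F x\<close> by simp
qed simp

definition interior_vertices :: "'v set" where "interior_vertices = {v. {v} \<notin> bdry K}"

definition interior_edges :: "'v \<Rightarrow> 'v set set" where "interior_edges v = {\<tau>\<in>interior2 K. v \<in> \<tau>}"

definition edges_at :: "'v \<Rightarrow> 'v set set" where "edges_at v = {\<tau>\<in>K. card \<tau> = 2 \<and> v \<in> \<tau>}"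

lemma interior_vertex_iff: "v \<in> interior_vertices \<longleftrightarrow> (\<forall>\<tau>\<in>bdry_2faces K. v \<notin> \<tau>)"
  using vertex_in_K by (auto simp: interior_vertices_def bdry_def)

lemma interior_edges_eq_edges_at:
  assumes "v \<in> interior_vertices" shows "interior_edges v = edges_at v"
proof -
  have "\<tau> \<in> interior2 K \<longleftrightarrow> \<tau> \<in> K \<and> card \<tau> = 2" if "v \<in> \<tau>" for \<tau>
    using assms that interior_vertex_iff bdry_2faces_iff interior2_iff by blast
  then show ?thesis by (auto simp: interior_edges_def edges_at_def)
qed

lemma boundary_edge_vertices:
  assumes "{v,w} \<in> K" "v \<noteq> w" "{v,w} \<notin> interior2 K"
  shows "v \<notin> interior_vertices" "w \<notin> interior_vertices"
proof -
  have "{v,w} \<notin> interior_edges x" for x using assms(3) by (simp add: interior_edges_def)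
  moreover have "{v,w} \<in> edges_at v" "{v,w} \<in> edges_at w" using assms(1,2) by (simp_all add: edges_at_def)
  ultimately show "v \<notin> interior_vertices" "w \<notin> interior_vertices" using interior_edges_eq_edges_at by metis+
qed

lemma edges_at_in_facet:
  assumes \<sigma>: "{v,w,x} \<in> facets K" "distinct [v,w,x]"
  shows "{\<tau>\<in>edges_at v. \<tau> \<subseteq> {v,w,x}} = {{v,w},{v,x}}"
proof
  show "{\<tau>\<in>edges_at v. \<tau> \<subseteq> {v,w,x}} \<subseteq> {{v,w},{v,x}}"
  proof
    fix \<tau> assume \<tau>: "\<tau> \<in> {\<tau>\<in>edges_at v. \<tau> \<subseteq> {v,w,x}}"
    then obtain y where "\<tau> = {v,y}" "y \<noteq> v" by (auto simp: edges_at_def card_2_iff)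
    then show "\<tau> \<in> {{v,w},{v,x}}" using \<tau> \<sigma> by auto
  qed
  have "{v,w} \<in> K" "{v,x} \<in> K" using subface_in_K[OF facet_in_K[OF \<sigma>(1)]] by auto
  then show "{{v,w},{v,x}} \<subseteq> {\<tau>\<in>edges_at v. \<tau> \<subseteq> {v,w,x}}" using \<sigma>(2) by (auto simp: edges_at_def)
qed

lemma sum_edges_at_star:
  "(\<Sum>\<tau>\<in>edges_at v. \<Sum>\<sigma>\<in>star \<tau>. f \<tau> \<sigma>) = (\<Sum>\<sigma>\<in>star {v}. \<Sum>\<tau>\<in>{\<tau>\<in>edges_at v. \<tau> \<subseteq> \<sigma>}. f \<tau> \<sigma>)"
  for f :: "'v set \<Rightarrow> 'v set \<Rightarrow> 'a::comm_monoid_add"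
proof -
  have "(\<Sum>\<tau>\<in>edges_at v. \<Sum>\<sigma>\<in>star \<tau>. f \<tau> \<sigma>) = (\<Sum>\<sigma>\<in>facets K. \<Sum>\<tau>\<in>{\<tau>\<in>edges_at v. \<tau> \<subseteq> \<sigma>}. f \<tau> \<sigma>)"
    unfolding star_def by (rule sum.swap_restrict) simp_all
  also have "\<dots> = (\<Sum>\<sigma>\<in>star {v}. \<Sum>\<tau>\<in>{\<tau>\<in>edges_at v. \<tau> \<subseteq> \<sigma>}. f \<tau> \<sigma>)"
  proof (rule sum.mono_neutral_right)
    have "{\<tau>\<in>edges_at v. \<tau> \<subseteq> \<sigma>} = {}" if "v \<notin> \<sigma>" for \<sigma> using that by (auto simp: edges_at_def)
    then show "\<forall>\<sigma>\<in>facets K - star {v}. (\<Sum>\<tau>\<in>{\<tau>\<in>edges_at v. \<tau> \<subseteq> \<sigma>}. f \<tau> \<sigma>) = 0"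
      by (auto simp: star_def simp del: Collect_empty_eq)
  qed (auto simp: star_def)
  finally show ?thesis .
qed

definition boundary :: "('v set \<Rightarrow> real) \<Rightarrow> 'v \<Rightarrow> real" where
  "boundary g v = (\<Sum>\<tau>\<in>interior2 K. incidence v \<tau> * g \<tau>)"

lemma boundary_add: "boundary (\<lambda>\<tau>. f \<tau> + g \<tau>) v = boundary f v + boundary g v"
  and boundary_scale: "boundary (\<lambda>\<tau>. c * f \<tau>) v = c * boundary f v"
  by (simp_all add: boundary_def distrib_left sum.distrib sum_distrib_left mult_ac)

lemma boundary_eq_sum_interior_edges: "boundary g v = (\<Sum>\<tau>\<in>interior_edges v. incidence v \<tau> * g \<tau>)"
  unfolding boundary_def
proof (rule sum.mono_neutral_right)
  show "\<forall>\<tau>\<in>interior2 K - interior_edges v. incidence v \<tau> * g \<tau> = 0"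
    using incidence_zero interior2_iff by (auto simp: interior_edges_def)
qed (auto simp: interior_edges_def)

lemma boundary_jump:
  assumes v: "v \<in> interior_vertices"
  shows "boundary (jump F) v = 0"
proof -
  have "boundary (jump F) v = (\<Sum>\<tau>\<in>edges_at v. \<Sum>\<sigma>\<in>star \<tau>. incidence v \<tau> * oriented_side \<sigma> \<tau> * F \<sigma>)"
    by (simp add: boundary_eq_sum_interior_edges interior_edges_eq_edges_at[OF v]
        jump_def sum_distrib_left mult.assoc)
  also have "\<dots> = (\<Sum>\<sigma>\<in>star {v}. \<Sum>\<tau>\<in>{\<tau>\<in>edges_at v. \<tau> \<subseteq> \<sigma>}. incidence v \<tau> * oriented_side \<sigma> \<tau> * F \<sigma>)"
    by (rule sum_edges_at_star)
  also have "\<dots> = 0"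
  proof (rule sum.neutral, rule ballI)
    fix \<sigma> assume "\<sigma> \<in> star {v}"
    then have \<sigma>: "\<sigma> \<in> facets K" "v \<in> \<sigma>" by (auto simp: star_def)
    then obtain w x where wx: "\<sigma> = {v,w,x}" "distinct [v,w,x]" using facet_at_vertex by blast
    have "{v,w} \<noteq> {v,x}" using wx(2) by (auto simp: doubleton_eq_iff)
    then have "(\<Sum>\<tau>\<in>{\<tau>\<in>edges_at v. \<tau> \<subseteq> \<sigma>}. incidence v \<tau> * oriented_side \<sigma> \<tau> * F \<sigma>) =
      incidence v {v,w} * oriented_side \<sigma> {v,w} * F \<sigma> + incidence v {v,x} * oriented_side \<sigma> {v,x} * F \<sigma>"
      using edges_at_in_facet[of v w x] \<sigma>(1) wx by simp
    also have "\<dots> = side \<sigma> v w * F \<sigma> + side \<sigma> v x * F \<sigma>"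
      using incidence_times_oriented_side[OF \<sigma>(1)] wx by simp
    also have "\<dots> = 0" using side_third_vertex[OF wx(2)] wx(1) by simp
    finally show "(\<Sum>\<tau>\<in>{\<tau>\<in>edges_at v. \<tau> \<subseteq> \<sigma>}. incidence v \<tau> * oriented_side \<sigma> \<tau> * F \<sigma>) = 0" .
  qed
  finally show ?thesis .
qed

lemma double_count_at_vertex:
  "2 * card (star {v}) = 2 * card (interior_edges v) + card {\<tau>\<in>bdry_2faces K. v \<in> \<tau>}"
proof -
  let ?B = "{\<tau>\<in>bdry_2faces K. v \<in> \<tau>}"
  have "card {\<tau>\<in>edges_at v. \<tau> \<subseteq> \<sigma>} = 2" if \<sigma>: "\<sigma> \<in> star {v}" for \<sigma>
  proof -
    obtain w x where wx: "\<sigma> = {v,w,x}" "distinct [v,w,x]" using \<sigma> facet_at_vertex[of \<sigma> v] by (auto simp: star_def)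
    moreover have "{v,w} \<noteq> {v,x}" using wx(2) by (auto simp: doubleton_eq_iff)
    ultimately show ?thesis using edges_at_in_facet[of v w x] \<sigma> by (simp add: star_def)
  qed
  then have "2 * card (star {v}) = (\<Sum>\<sigma>\<in>star {v}. \<Sum>\<tau>\<in>{\<tau>\<in>edges_at v. \<tau> \<subseteq> \<sigma>}. 1)"
    by (simp add: mult.commute)
  also have "\<dots> = (\<Sum>\<tau>\<in>edges_at v. card (star \<tau>))" unfolding sum_edges_at_star[symmetric] by simp
  also have "edges_at v = interior_edges v \<union> ?B"
    by (auto simp: edges_at_def interior_edges_def interior2_iff bdry_2faces_iff)
  also have "(\<Sum>\<tau>\<in>interior_edges v \<union> ?B. card (star \<tau>))
    = (\<Sum>\<tau>\<in>interior_edges v. card (star \<tau>)) + (\<Sum>\<tau>\<in>?B. card (star \<tau>))"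
    by (rule sum.union_disjoint) (auto simp: interior_edges_def interior2_iff bdry_2faces_iff)
  also have "(\<Sum>\<tau>\<in>interior_edges v. card (star \<tau>)) = 2 * card (interior_edges v)"
  proof -
    have "card (star \<tau>) = 2" if "\<tau> \<in> interior_edges v" for \<tau>
    proof -
      have "\<tau> \<in> interior2 K" using that by (simp add: interior_edges_def)
      then obtain a b where "star \<tau> = {a,b}" "a \<noteq> b" using star_interior2 by metis
      then show ?thesis by simp
    qed
    then show ?thesis by simp
  qed
  also have "(\<Sum>\<tau>\<in>?B. card (star \<tau>)) = card ?B" by (simp add: bdry_2faces_iff)
  finally show ?thesis .
qed

definition local_jump :: "'v \<Rightarrow> ('v set \<Rightarrow> real) \<Rightarrow> 'v set \<Rightarrow> real" where
  "local_jump v p \<tau> = (if \<tau> \<in> interior_edges v then jump p \<tau> else 0)"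

lemma linear_local_jump: "Vector_Spaces.linear (\<lambda>c f x. c * f x) (\<lambda>c f x. c * f x) (local_jump v)"
  by unfold_locales
    (simp_all add: fun_eq_iff plus_fun_def local_jump_def jump_add jump_scale distrib_left distrib_right mult.assoc)

lemma local_jump_kernel_constant:
  assumes "local_jump v p = 0" "a \<in> star {v}" "b \<in> star {v}"
  shows "p a = p b"
proof (rule constant_on_star_if_jumps_zero[OF vertex_in_K _ assms(2,3)])
  show "jump p \<tau> = 0" if "\<tau> \<in> interior2 K" "{v} \<subseteq> \<tau>" for \<tau>
    using fun_cong[OF assms(1), of \<tau>] that by (simp add: local_jump_def interior_edges_def)
qed

lemma dim_local_jump_kernel: "fs.dim {p\<in>supported (star {v}). local_jump v p = 0} = 1"
proof -
  let ?N = "{p\<in>supported (star {v}). local_jump v p = 0}" and ?one = "\<lambda>\<sigma>. if \<sigma> \<in> star {v} then 1 else (0::real)"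
  obtain \<sigma> where \<sigma>: "\<sigma> \<in> star {v}" using ex_facet_containing[OF vertex_in_K[of v]] by (auto simp: star_def)
  have subspace: "fs.subspace ?N"
    using fs.subspace_inter[OF supported_subspace ff.linear_subspace_kernel[OF linear_local_jump]]
    by (simp add: Int_def)
  have "jump ?one \<tau> = 0" if "\<tau> \<in> interior_edges v" for \<tau>
  proof -
    have "jump ?one \<tau> = jump (\<lambda>\<sigma>. 1) \<tau>" using that by (intro jump_cong) (auto simp: star_def interior_edges_def)
    then show ?thesis using jump_const[of \<tau> 1] that by (simp add: interior_edges_def)
  qed
  then have "?one \<in> ?N" by (auto simp: supported_def local_jump_def fun_eq_iff)
  then have "fs.dim ?N = fs.dim {p\<in>?N. p \<sigma> = 0} + 1"
    using \<sigma> fs.finite_dim_subset[OF supported_finite_dim[of "star {v}"]]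
    by (intro fs.dim_functional_kernel[OF linear_evaluation subspace, of ?one]) auto
  moreover have "{p\<in>?N. p \<sigma> = 0} = {0}"
  proof -
    have "p = 0" if p: "p \<in> ?N" "p \<sigma> = 0" for p
    proof
      fix \<sigma>' show "p \<sigma>' = 0 \<sigma>'"
        using local_jump_kernel_constant[of v p \<sigma> \<sigma>'] p \<sigma> by (cases "\<sigma>' \<in> star {v}") (auto simp: supported_def)
    qed
    then show ?thesis using fs.subspace_0[OF subspace] by auto
  qed
  ultimately show ?thesis using fs.dim_zero by simp
qed

lemma dim_local_jump_image: "card (star {v}) = 1 + fs.dim (local_jump v ` supported (star {v}))"
  using ff.dim_kernel_image[OF linear_local_jump supported_subspace supported_finite_dim, of "star {v}" v]
    dim_local_jump_kernel[of v] supported_dim[of "star {v}"] by simp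

lemma local_jump_image_subspace: "fs.subspace (local_jump v ` supported (star {v}))"
  by (rule ff.linear_subspace_image[OF linear_local_jump supported_subspace])

lemma local_jump_image_subset: "local_jump v ` X \<subseteq> supported (interior_edges v)"
  by (auto simp: supported_def local_jump_def)

lemma linear_boundary: "Vector_Spaces.linear (\<lambda>c f x. c * f x) (*) (\<lambda>g. boundary g v)"
  by unfold_locales
    (simp_all add: fun_eq_iff plus_fun_def boundary_scale boundary_add distrib_left distrib_right mult.assoc)

lemma dim_local_cycles:
  assumes "interior_edges v \<noteq> {}"
  shows "card (interior_edges v) = fs.dim {g\<in>supported (interior_edges v). boundary g v = 0} + 1"
proof -
  obtain \<tau> where \<tau>: "\<tau> \<in> interior_edges v" using assms by blast
  let ?\<delta> = "\<lambda>\<tau>'. if \<tau>' = \<tau> then 1 else (0::real)"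
  have "boundary ?\<delta> v = incidence v \<tau>"
    using \<tau> by (simp add: boundary_def interior_edges_def if_distrib cong: if_cong)
  then have "boundary ?\<delta> v \<noteq> 0" using incidence_values[of \<tau> v] \<tau> by (auto simp: interior_edges_def interior2_iff)
  moreover have "?\<delta> \<in> supported (interior_edges v)" using \<tau> by (auto simp: supported_def)
  ultimately show ?thesis
    using fs.dim_functional_kernel[OF linear_boundary supported_subspace supported_finite_dim,
      of "interior_edges v" ?\<delta> v]
      supported_dim[of "interior_edges v"] by simp
qed

lemma boundary_cong: "(\<And>\<tau>. \<tau> \<in> interior_edges v \<Longrightarrow> f \<tau> = g \<tau>) \<Longrightarrow> boundary f v = boundary g v"
  by (simp add: boundary_eq_sum_interior_edges)

lemma local_jump_image_interior:
  assumes v: "v \<in> interior_vertices"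
  shows "local_jump v ` supported (star {v}) = {g\<in>supported (interior_edges v). boundary g v = 0}"
proof (rule fs.subspace_eq_of_dim_le[OF local_jump_image_subspace])
  have "{\<tau>\<in>bdry_2faces K. v \<in> \<tau>} = {}" using v by (auto simp: interior_vertex_iff)
  then have card_eq: "card (interior_edges v) = card (star {v})"
    using double_count_at_vertex[of v] by (simp only: card.empty)
  moreover have "card (star {v}) \<noteq> 0" using dim_local_jump_image[of v] by simp
  ultimately have "interior_edges v \<noteq> {}" by (metis card.empty)
  then show "fs.dim {g\<in>supported (interior_edges v). boundary g v = 0}
      \<le> fs.dim (local_jump v ` supported (star {v}))"
    using dim_local_cycles dim_local_jump_image[of v] card_eq by simp
  show "fs.finite_dim {g\<in>supported (interior_edges v). boundary g v = 0}"
    by (rule fs.finite_dim_subset[OF supported_finite_dim]) auto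
  have "boundary (local_jump v p) v = 0" for p
    using boundary_cong[of v "local_jump v p" "jump p"] boundary_jump[OF v] by (simp add: local_jump_def)
  then show "local_jump v ` supported (star {v}) \<subseteq> {g\<in>supported (interior_edges v). boundary g v = 0}"
    using local_jump_image_subset by blast
qed

lemma local_jump_image_boundary:
  assumes "v \<notin> interior_vertices"
  shows "local_jump v ` supported (star {v}) = supported (interior_edges v)"
proof (rule fs.subspace_eq_of_dim_le[OF local_jump_image_subspace local_jump_image_subset supported_finite_dim])
  have "{\<tau>\<in>bdry_2faces K. v \<in> \<tau>} \<noteq> {}" using assms by (auto simp: interior_vertex_iff)
  then have "card {\<tau>\<in>bdry_2faces K. v \<in> \<tau>} > 0" by (simp add: card_gt_0_iff)
  then have "card (interior_edges v) < card (star {v})" using double_count_at_vertex[of v] by linarith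
  then show "fs.dim (supported (interior_edges v)) \<le> fs.dim (local_jump v ` supported (star {v}))"
    using dim_local_jump_image[of v] supported_dim[of "interior_edges v"] by simp
qed simp

lemma local_potential:
  assumes "v \<in> interior_vertices \<Longrightarrow> boundary g v = 0"
  shows "\<exists>p. \<forall>\<tau>\<in>interior_edges v. jump p \<tau> = g \<tau>"
proof -
  let ?g = "\<lambda>\<tau>. if \<tau> \<in> interior_edges v then g \<tau> else 0"
  have "?g \<in> supported (interior_edges v)" by (auto simp: supported_def)
  moreover have "boundary ?g v = boundary g v" by (rule boundary_cong) simp
  ultimately have "?g \<in> local_jump v ` supported (star {v})"
    using local_jump_image_interior[of v] local_jump_image_boundary[of v] assms
    by (cases "v \<in> interior_vertices") simp_all
  then obtain p where "?g = local_jump v p" by blast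
  then have "jump p \<tau> = g \<tau>" if "\<tau> \<in> interior_edges v" for \<tau>
    using that fun_cong[of ?g "local_jump v p" \<tau>] by (simp add: local_jump_def)
  then show ?thesis by blast
qed

lemma local_potentials_differ_by_constants:
  assumes p: "\<And>v \<tau>. \<tau> \<in> interior2 K \<Longrightarrow> v \<in> \<tau> \<Longrightarrow> jump (p v) \<tau> = g \<tau>"
    and \<sigma>: "\<sigma> \<in> star {v,w}" "\<sigma>' \<in> star {v,w}"
  shows "p v \<sigma> - p w \<sigma> = p v \<sigma>' - p w \<sigma>'"
proof (rule constant_on_star_if_jumps_zero[where F = "\<lambda>\<sigma>. p v \<sigma> - p w \<sigma>", OF _ _ \<sigma>])
  show "{v,w} \<in> K" using \<sigma>(1) by (intro subface_in_K[OF facet_in_K[of \<sigma>]]) (simp_all add: star_def)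
  show "jump (\<lambda>\<sigma>. p v \<sigma> - p w \<sigma>) \<tau> = 0" if "\<tau> \<in> interior2 K" "{v,w} \<subseteq> \<tau>" for \<tau>
    using p[OF that(1)] that(2) by (simp add: jump_diff)
qed

lemma glue_up_to_constants:
  fixes p :: "'v \<Rightarrow> 'v set \<Rightarrow> real"
  assumes simply_connected: "simply_connected (lk_space K u)"
    and differ: "\<And>v w \<sigma> \<sigma>'. \<sigma> \<in> star {v,w} \<Longrightarrow> \<sigma>' \<in> star {v,w} \<Longrightarrow> p v \<sigma> - p w \<sigma> = p v \<sigma>' - p w \<sigma>'"
  shows "\<exists>q b. \<forall>\<sigma>\<in>facets K. \<forall>v\<in>\<sigma>. q \<sigma> = p v \<sigma> + b v"
proof -
  define c where "c v w = (let \<sigma> = SOME \<sigma>. \<sigma> \<in> star {v,w} in p v \<sigma> - p w \<sigma>)" for v w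
  have c_eq: "c v w = p v \<sigma> - p w \<sigma>" if \<sigma>: "\<sigma> \<in> star {v,w}" for v w \<sigma>
    unfolding c_def Let_def by (rule differ[OF someI[of "\<lambda>\<sigma>. \<sigma> \<in> star {v,w}", OF \<sigma>] \<sigma>])
  have "cocycle c" unfolding cocycle_def
  proof (intro ballI)
    fix A v w x assume A: "A \<in> K" "v \<in> A" "w \<in> A" "x \<in> A"
    obtain \<sigma> where "\<sigma> \<in> facets K" "A \<subseteq> \<sigma>" using ex_facet_containing[OF A(1)] by blast
    then have "\<sigma> \<in> star {v,w}" "\<sigma> \<in> star {w,x}" "\<sigma> \<in> star {v,x}" using A by (auto simp: star_def)
    then show "c v w + c w x = c v x" by (simp add: c_eq)
  qed
  then have "\<exists>b. \<forall>A\<in>K. \<forall>v\<in>A. \<forall>w\<in>A. c v w = b w - b v"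
    using cocycle_is_coboundary[OF simply_connected] by (simp only: coboundary_def)
  then obtain b where b: "\<And>A v w. A \<in> K \<Longrightarrow> v \<in> A \<Longrightarrow> w \<in> A \<Longrightarrow> c v w = b w - b v" by blast
  define q where "q \<sigma> = (let v = SOME v. v \<in> \<sigma> in p v \<sigma> + b v)" for \<sigma>
  have "q \<sigma> = p v \<sigma> + b v" if \<sigma>: "\<sigma> \<in> facets K" "v \<in> \<sigma>" for \<sigma> v
  proof -
    let ?w = "SOME v. v \<in> \<sigma>"
    have w: "?w \<in> \<sigma>" using \<sigma>(2) by (rule someI)
    then have "\<sigma> \<in> star {v,?w}" using \<sigma> by (simp add: star_def)
    then show ?thesis using c_eq b[OF facet_in_K[OF \<sigma>(1)] \<sigma>(2) w] by (simp add: q_def Let_def)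
  qed
  then show ?thesis by blast
qed

theorem global_potential:
  assumes simply_connected: "simply_connected (lk_space K u)"
    and cycle: "\<And>v. v \<in> interior_vertices \<Longrightarrow> boundary g v = 0"
  shows "\<exists>p. \<forall>\<tau>\<in>interior2 K. jump p \<tau> = g \<tau>"
proof -
  have "\<forall>v. \<exists>p. \<forall>\<tau>\<in>interior_edges v. jump p \<tau> = g \<tau>" using local_potential cycle by blast
  then obtain p where "\<forall>v. \<forall>\<tau>\<in>interior_edges v. jump (p v) \<tau> = g \<tau>" unfolding choice_iff by (rule exE)
  then have p: "jump (p v) \<tau> = g \<tau>" if "\<tau> \<in> interior2 K" "v \<in> \<tau>" for v \<tau>
    using that by (simp add: interior_edges_def)
  have "\<exists>q b. \<forall>\<sigma>\<in>facets K. \<forall>v\<in>\<sigma>. q \<sigma> = p v \<sigma> + b v"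
    by (rule glue_up_to_constants[OF simply_connected]) (rule local_potentials_differ_by_constants[of p g, OF p])
  then obtain q b where q: "\<And>\<sigma> v. \<sigma> \<in> facets K \<Longrightarrow> v \<in> \<sigma> \<Longrightarrow> q \<sigma> = p v \<sigma> + b v" by blast
  have "jump q \<tau> = g \<tau>" if \<tau>: "\<tau> \<in> interior2 K" for \<tau>
  proof -
    obtain v where v: "v \<in> \<tau>" using \<tau> by (auto simp: interior2_iff card_2_iff)
    have "jump q \<tau> = jump (\<lambda>\<sigma>. p v \<sigma> + b v) \<tau>" by (rule jump_cong) (use q v in blast)
    also have "\<dots> = g \<tau>" unfolding jump_add using jump_const[OF \<tau>] p[OF \<tau> v] by simp
    finally show ?thesis .
  qed
  then show ?thesis by blast
qed

end

section \<open>Counting splines\<close>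

context pure_fan
begin

definition jump_map :: "('v set \<Rightarrow> real^3 \<Rightarrow> real) \<Rightarrow> 'v set \<Rightarrow> real^3 \<Rightarrow> real" where
  "jump_map F \<tau> p = (if \<tau> \<in> interior2 K then jump (\<lambda>\<sigma>. F \<sigma> p) \<tau> else 0)"

definition boundary_map :: "('v set \<Rightarrow> real^3 \<Rightarrow> real) \<Rightarrow> 'v \<Rightarrow> real^3 \<Rightarrow> real" where
  "boundary_map g v p = (if v \<in> interior_vertices then boundary (\<lambda>\<tau>. g \<tau> p) v else 0)"

definition splines :: "(real^3 \<Rightarrow> real) set \<Rightarrow> ('v set \<Rightarrow> (real^3 \<Rightarrow> real) set) \<Rightarrow> ('v set \<Rightarrow> real^3 \<Rightarrow> real) set" where
  "splines X J = {F \<in> direct_sum (facets K) (\<lambda>_. X). jump_map F \<in> direct_sum (interior2 K) J}"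

lemma linear_jump_map: "Vector_Spaces.linear (\<lambda>c F i x. c * F i x) (\<lambda>c F i x. c * F i x) jump_map"
  by unfold_locales
    (simp_all add: fun_eq_iff plus_fun_def jump_map_def jump_add jump_scale distrib_left distrib_right mult.assoc)

lemma linear_boundary_map: "Vector_Spaces.linear (\<lambda>c F i x. c * F i x) (\<lambda>c F i x. c * F i x) boundary_map"
  by unfold_locales
    (simp_all add: fun_eq_iff plus_fun_def boundary_map_def boundary_add boundary_scale
      distrib_left distrib_right mult.assoc)

lemma splines_subspace:
  assumes "fs.subspace X" "\<And>\<tau>. \<tau> \<in> interior2 K \<Longrightarrow> fs.subspace (J \<tau>)"
  shows "ts.subspace (splines X J)"
proof -
  have "splines X J = direct_sum (facets K) (\<lambda>_. X) \<inter> jump_map -` direct_sum (interior2 K) J"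
    by (auto simp: splines_def)
  then show ?thesis
    using ts.subspace_inter[OF direct_sum_subspace
        tt.linear_subspace_vimage[OF linear_jump_map direct_sum_subspace]] assms
    by simp
qed

lemma jump_map_in:
  assumes X: "fs.subspace X" and F: "F \<in> direct_sum (facets K) (\<lambda>_. X)"
  shows "jump_map F \<in> direct_sum (interior2 K) (\<lambda>_. X)"
proof -
  have "(\<lambda>p. jump (\<lambda>\<sigma>. F \<sigma> p) \<tau>) \<in> X" for \<tau>
    unfolding jump_def
    by (intro fs_subspace_pointwise(5)[OF X] fs.subspace_scale[OF X])
      (use F in \<open>auto simp: direct_sum_def star_def\<close>)
  then show ?thesis by (simp add: direct_sum_def jump_map_def[abs_def])
qed

lemma splines_without_conditions: "fs.subspace X \<Longrightarrow> splines X (\<lambda>_. X) = direct_sum (facets K) (\<lambda>_. X)"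
  using jump_map_in by (auto simp: splines_def)

definition constant_spline :: "(real^3 \<Rightarrow> real) \<Rightarrow> 'v set \<Rightarrow> real^3 \<Rightarrow> real" where
  "constant_spline h \<sigma> = (if \<sigma> \<in> facets K then h else (\<lambda>p. 0))"

lemma jump_map_kernel:
  assumes J: "\<And>\<tau>. \<tau> \<in> interior2 K \<Longrightarrow> fs.subspace (J \<tau>)"
  shows "{F\<in>splines X J. jump_map F = 0} = constant_spline ` X"
proof
  obtain \<sigma> where \<sigma>: "\<sigma> \<in> facets K" using facets_nonempty by blast
  show "{F\<in>splines X J. jump_map F = 0} \<subseteq> constant_spline ` X"
  proof
    fix F assume F: "F \<in> {F\<in>splines X J. jump_map F = 0}"
    then have zero: "jump_map F = 0" by simp
    have "jump (\<lambda>\<sigma>. F \<sigma> p) \<tau> = 0" if "\<tau> \<in> interior2 K" for \<tau> p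
      using fun_cong[OF fun_cong[OF zero], of \<tau> p] that by (simp add: jump_map_def)
    then have "F \<sigma>' p = F \<sigma> p" if "\<sigma>' \<in> facets K" for \<sigma>' p
      using constant_on_star_if_jumps_zero[OF empty_in_K, of "\<lambda>\<sigma>. F \<sigma> p" \<sigma>' \<sigma>] that \<sigma> by (simp add: star_def)
    then have "F = constant_spline (F \<sigma>)"
      using F by (auto simp: splines_def direct_sum_def constant_spline_def fun_eq_iff)
    moreover have "F \<sigma> \<in> X" using F \<sigma> by (auto simp: splines_def direct_sum_def)
    ultimately show "F \<in> constant_spline ` X" by blast
  qed
  show "constant_spline ` X \<subseteq> {F\<in>splines X J. jump_map F = 0}"
  proof (rule image_subsetI)
    fix h assume h: "h \<in> X"
    have "jump (\<lambda>\<sigma>. constant_spline h \<sigma> p) \<tau> = jump (\<lambda>\<sigma>. h p) \<tau>" for \<tau> p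
      by (rule jump_cong) (simp add: constant_spline_def)
    then have "jump_map (constant_spline h) = 0" by (simp add: jump_map_def fun_eq_iff jump_const)
    moreover have "constant_spline h \<in> direct_sum (facets K) (\<lambda>_. X)"
      using h by (simp add: direct_sum_def constant_spline_def)
    ultimately show "constant_spline h \<in> {F\<in>splines X J. jump_map F = 0}"
      using ts.subspace_0[OF direct_sum_subspace[OF J]] by (simp add: splines_def)
  qed
qed

lemma dim_constant_splines:
  assumes "fs.subspace X" "fs.finite_dim X"
  shows "ts.dim (constant_spline ` X) = fs.dim X"
proof -
  have lin: "Vector_Spaces.linear (\<lambda>c f x. c * f x) (\<lambda>c F i x. c * F i x) constant_spline"
    by unfold_locales (auto simp: constant_spline_def fun_eq_iff distrib_left distrib_right)
  obtain \<sigma> where "\<sigma> \<in> facets K" using facets_nonempty by blast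
  then have "h = 0" if "constant_spline h = 0" for h
    using fun_cong[OF that, of \<sigma>] by (simp add: constant_spline_def)
  then have "{h\<in>X. constant_spline h = 0} = {0}"
    using fs.subspace_0[OF assms(1)] ft.linear_0[OF lin] by blast
  then show ?thesis using ft.dim_kernel_image[OF lin assms] fs.dim_zero by simp
qed

lemma in_subspace_if_jumps_in_subspace:
  assumes X: "fs.subspace X" and ab: "a \<in> facets K" "b \<in> facets K" and "F a \<in> X"
    and jumps: "\<And>\<tau>. \<tau> \<in> interior2 K \<Longrightarrow> (\<lambda>p. jump (\<lambda>\<sigma>. F \<sigma> p) \<tau>) \<in> X"
  shows "F b \<in> X"
  using ab \<open>F a \<in> X\<close>
proof (rule facet_induct)
  fix x y assume xy: "x \<in> facets K" "y \<in> facets K" "card (x \<inter> y) = 2" and "F x \<in> X"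
  have "oriented_side x (x \<inter> y) * jump (\<lambda>\<sigma>. F \<sigma> p) (x \<inter> y) = F x p - F y p" for p
    unfolding jump_adjacent[OF xy] using oriented_side_values[OF xy(1) Int_lower1 xy(3)] by auto
  then have "F y = (\<lambda>p. F x p - oriented_side x (x \<inter> y) * jump (\<lambda>\<sigma>. F \<sigma> p) (x \<inter> y))" by (simp add: fun_eq_iff)
  also have "\<dots> \<in> X"
    by (intro fs_subspace_pointwise(4)[OF X] fs.subspace_scale[OF X] jumps adjacent_facets(1) \<open>F x \<in> X\<close> xy)
  finally show "F y \<in> X" .
qed

lemma jump_map_onto_cycles:
  assumes simply_connected: "simply_connected (lk_space K u)" and X: "fs.subspace X"
    and g: "g \<in> direct_sum (interior2 K) (\<lambda>_. X)" and cycle: "boundary_map g = 0"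
  shows "\<exists>F\<in>direct_sum (facets K) (\<lambda>_. X). jump_map F = g"
proof -
  have "boundary (\<lambda>\<tau>. g \<tau> p) v = 0" if "v \<in> interior_vertices" for v p
    using fun_cong[OF fun_cong[OF cycle], of v p] that by (simp add: boundary_map_def)
  then have "\<forall>p. \<exists>P. \<forall>\<tau>\<in>interior2 K. jump P \<tau> = g \<tau> p" using global_potential[OF simply_connected] by simp
  then obtain P where "\<forall>p. \<forall>\<tau>\<in>interior2 K. jump (P p) \<tau> = g \<tau> p" unfolding choice_iff by (rule exE)
  then have P: "jump (P p) \<tau> = g \<tau> p" if "\<tau> \<in> interior2 K" for \<tau> p using that by simp
  obtain \<sigma> where \<sigma>: "\<sigma> \<in> facets K" using facets_nonempty by blast
  define F where "F \<sigma>' p = (if \<sigma>' \<in> facets K then P p \<sigma>' - P p \<sigma> else 0)" for \<sigma>' p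
  have jump_F: "jump (\<lambda>\<sigma>'. F \<sigma>' p) \<tau> = g \<tau> p" if \<tau>: "\<tau> \<in> interior2 K" for \<tau> p
  proof -
    have "jump (\<lambda>\<sigma>'. F \<sigma>' p) \<tau> = jump (\<lambda>\<sigma>'. P p \<sigma>' - P p \<sigma>) \<tau>" by (rule jump_cong) (simp add: F_def)
    then show ?thesis using P[OF \<tau>] jump_const[OF \<tau>] by (simp add: jump_diff)
  qed
  have "F \<sigma> = (\<lambda>p. 0)" by (simp add: F_def fun_eq_iff)
  then have "F \<sigma>' \<in> X" if "\<sigma>' \<in> facets K" for \<sigma>'
    by (intro in_subspace_if_jumps_in_subspace[OF X \<sigma> that, of F])
      (use g in \<open>auto simp: jump_F direct_sum_def fs_subspace_pointwise(1)[OF X]\<close>)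
  then have "F \<in> direct_sum (facets K) (\<lambda>_. X)" by (auto simp: direct_sum_def F_def)
  moreover have "jump_map F \<tau> p = g \<tau> p" for \<tau> p using jump_F[of \<tau> p] g by (auto simp: jump_map_def direct_sum_def)
  ultimately show ?thesis by (auto simp: fun_eq_iff)
qed

lemma boundary_map_jump_map: "boundary_map (jump_map F) = 0"
proof (intro ext)
  fix v p
  have "boundary (\<lambda>\<tau>. jump_map F \<tau> p) v = boundary (jump (\<lambda>\<sigma>. F \<sigma> p)) v"
    by (rule boundary_cong) (simp add: jump_map_def interior_edges_def)
  then show "boundary_map (jump_map F) v p = 0 v p" by (simp add: boundary_map_def boundary_jump)
qed

lemma jump_map_image:
  assumes simply_connected: "simply_connected (lk_space K u)" and X: "fs.subspace X"
    and J: "\<And>\<tau>. \<tau> \<in> interior2 K \<Longrightarrow> J \<tau> \<subseteq> X"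
  shows "jump_map ` splines X J = {g\<in>direct_sum (interior2 K) J. boundary_map g = 0}"
proof
  show "jump_map ` splines X J \<subseteq> {g\<in>direct_sum (interior2 K) J. boundary_map g = 0}"
    using boundary_map_jump_map by (auto simp: splines_def)
  show "{g\<in>direct_sum (interior2 K) J. boundary_map g = 0} \<subseteq> jump_map ` splines X J"
  proof
    fix g assume g: "g \<in> {g\<in>direct_sum (interior2 K) J. boundary_map g = 0}"
    then have "g \<in> direct_sum (interior2 K) (\<lambda>_. X)" using J by (auto simp: direct_sum_def)
    then obtain F where "F \<in> direct_sum (facets K) (\<lambda>_. X)" "jump_map F = g"
      using jump_map_onto_cycles[OF simply_connected X] g by blast
    then show "g \<in> jump_map ` splines X J" using g by (auto simp: splines_def)
  qed
qed

proposition spline_count: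
  assumes simply_connected: "simply_connected (lk_space K u)" and X: "fs.subspace X" "fs.finite_dim X"
    and J: "\<And>\<tau>. \<tau> \<in> interior2 K \<Longrightarrow> fs.subspace (J \<tau>)" "\<And>\<tau>. \<tau> \<in> interior2 K \<Longrightarrow> J \<tau> \<subseteq> X"
  shows "ts.dim (splines X J) + ts.dim (boundary_map ` direct_sum (interior2 K) J)
    = fs.dim X + (\<Sum>\<tau>\<in>interior2 K. fs.dim (J \<tau>))"
proof -
  let ?cycles = "{g\<in>direct_sum (interior2 K) J. boundary_map g = 0}"
  have finite_dim: "fs.finite_dim (J \<tau>)" if "\<tau> \<in> interior2 K" for \<tau>
    using fs.finite_dim_subset[OF X(2) J(2)[OF that]] .
  have "ts.finite_dim (splines X J)"
    by (rule ts.finite_dim_subset[OF direct_sum_finite_dim[of "facets K" "\<lambda>_. X"]]) (auto simp: splines_def X(2))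
  then have "ts.dim (splines X J) = fs.dim X + ts.dim ?cycles"
    using tt.dim_kernel_image[OF linear_jump_map splines_subspace[OF X(1) J(1)]]
    by (simp add: jump_map_kernel X J jump_map_image[OF simply_connected] dim_constant_splines)
  moreover have "ts.dim (direct_sum (interior2 K) J)
    = ts.dim ?cycles + ts.dim (boundary_map ` direct_sum (interior2 K) J)"
    by (intro tt.dim_kernel_image[OF linear_boundary_map] direct_sum_subspace direct_sum_finite_dim J finite_dim)
      simp_all
  moreover have "ts.dim (direct_sum (interior2 K) J) = (\<Sum>\<tau>\<in>interior2 K. fs.dim (J \<tau>))"
    by (rule direct_sum_dim) (simp_all add: J finite_dim)
  ultimately show ?thesis by simp
qed

lemma interior_vertices_closed: "bdry_2faces K = {} \<Longrightarrow> interior_vertices = UNIV"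
  by (auto simp: interior_vertex_iff)

lemma ex_boundary_vertex:
  assumes "bdry_2faces K \<noteq> {}" obtains v where "v \<notin> interior_vertices"
proof -
  obtain \<tau> where \<tau>: "\<tau> \<in> bdry_2faces K" using assms by blast
  then obtain v where "v \<in> \<tau>" by (auto simp: bdry_2faces_def card_2_iff)
  then show ?thesis using \<tau> that interior_vertex_iff by blast
qed

lemma vertices_connected:
  assumes edge: "\<And>v w. {v,w} \<in> K \<Longrightarrow> v \<noteq> w \<Longrightarrow> R v w" and refl: "\<And>v. R v v"
    and trans: "\<And>v w x. R v w \<Longrightarrow> R w x \<Longrightarrow> R v x"
  shows "R v w"
proof -
  have same_facet: "R x y" if "\<sigma> \<in> facets K" "x \<in> \<sigma>" "y \<in> \<sigma>" for \<sigma> x y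
    using edge[of x y] refl subface_in_K[OF facet_in_K[OF that(1)], of "{x,y}"] that by (cases "x = y") auto
  obtain a where a: "a \<in> facets K" "v \<in> a" using ex_facet_containing[OF vertex_in_K[of v]] by auto
  obtain b where b: "b \<in> facets K" "w \<in> b" using ex_facet_containing[OF vertex_in_K[of w]] by auto
  have "\<forall>x\<in>b. R v x"
  proof (rule facet_induct[OF a(1) b(1)])
    show "\<forall>x\<in>a. R v x" using same_facet a by blast
    fix x y assume xy: "x \<in> facets K" "y \<in> facets K" "card (x \<inter> y) = 2" and x: "\<forall>z\<in>x. R v z"
    obtain z where "z \<in> x" "z \<in> y" using xy(3) by (metis Int_iff card.empty ex_in_conv zero_neq_numeral)
    then show "\<forall>z\<in>y. R v z" using x same_facet[OF xy(2)] trans by blast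
  qed
  then show ?thesis using b by blast
qed

lemma sum_boundary_map_zero:
  assumes "bdry_2faces K = {}" shows "(\<Sum>v\<in>UNIV. boundary_map g v) = 0"
proof
  fix p
  have "(\<Sum>v\<in>UNIV. boundary_map g v) p = (\<Sum>v\<in>UNIV. \<Sum>\<tau>\<in>interior2 K. incidence v \<tau> * g \<tau> p)"
    by (simp add: sum_fun_apply boundary_map_def boundary_def interior_vertices_closed[OF assms])
  also have "\<dots> = (\<Sum>\<tau>\<in>interior2 K. (\<Sum>v\<in>UNIV. incidence v \<tau>) * g \<tau> p)"
    by (subst sum.swap) (simp add: sum_distrib_right)
  also have "\<dots> = 0" by (rule sum.neutral) (simp add: interior2_iff sum_incidence)
  finally show "(\<Sum>v\<in>UNIV. boundary_map g v) p = 0 p" by simp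
qed

definition interior_single :: "'v \<Rightarrow> (real^3 \<Rightarrow> real) \<Rightarrow> 'v \<Rightarrow> real^3 \<Rightarrow> real" where
  "interior_single v h = (if v \<in> interior_vertices then single v h else 0)"

lemma boundary_map_single:
  assumes edge: "{v,w} \<in> interior2 K" "v \<noteq> w"
  shows "boundary_map (single {v,w} (\<lambda>p. incidence v {v,w} * h p)) = interior_single v h - interior_single w h"
proof (intro ext)
  fix x p
  let ?\<tau> = "{v,w}"
  have card2: "card ?\<tau> = 2" using edge by simp
  have "boundary (\<lambda>\<tau>. single ?\<tau> (\<lambda>p. incidence v ?\<tau> * h p) \<tau> p) x
      = (\<Sum>\<tau>\<in>interior2 K. if \<tau> = ?\<tau> then incidence x ?\<tau> * (incidence v ?\<tau> * h p) else 0)"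
    unfolding boundary_def by (rule sum.cong) (auto simp: single_def)
  also have "\<dots> = incidence x ?\<tau> * incidence v ?\<tau> * h p" using edge by simp
  finally have "boundary_map (single ?\<tau> (\<lambda>p. incidence v ?\<tau> * h p)) x p =
      (if x \<in> interior_vertices then incidence x ?\<tau> * incidence v ?\<tau> * h p else 0)" by (simp add: boundary_map_def)
  moreover have "incidence v ?\<tau> * incidence v ?\<tau> = 1" using incidence_values[OF card2, of v] by auto
  moreover have "incidence w ?\<tau> = - incidence v ?\<tau>" using incidence_opposite[OF card2] .
  moreover have "incidence x ?\<tau> = 0" if "x \<noteq> v" "x \<noteq> w" using incidence_zero[OF card2] that by simp
  ultimately show "boundary_map (single ?\<tau> (\<lambda>p. incidence v ?\<tau> * h p)) x p
    = (interior_single v h - interior_single w h) x p"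
    using edge(2) by (auto simp: interior_single_def single_def)
qed

lemma boundary_map_image_subspace:
  "fs.subspace X \<Longrightarrow> ts.subspace (boundary_map ` direct_sum (interior2 K) (\<lambda>_. X))"
  by (intro tt.linear_subspace_image[OF linear_boundary_map] direct_sum_subspace)

lemma interior_single_diff_in_image:
  assumes X: "fs.subspace X" and h: "h \<in> X"
  shows "interior_single v h - interior_single w h \<in> boundary_map ` direct_sum (interior2 K) (\<lambda>_. X)" (is "_ \<in> ?I")
proof (rule vertices_connected[where R = "\<lambda>v w. interior_single v h - interior_single w h \<in> ?I"])
  note subspace = boundary_map_image_subspace[OF X]
  show "interior_single v h - interior_single v h \<in> ?I" for v using ts.subspace_0[OF subspace] by simp
  show "interior_single v h - interior_single x h \<in> ?I"
    if "interior_single v h - interior_single w h \<in> ?I" "interior_single w h - interior_single x h \<in> ?I" for v w x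
    using ts.subspace_add[OF subspace that] by simp
  fix v w assume vw: "{v,w} \<in> K" "v \<noteq> w"
  show "interior_single v h - interior_single w h \<in> ?I"
  proof (cases "{v,w} \<in> interior2 K")
    case True
    then show ?thesis unfolding boundary_map_single[OF True vw(2), symmetric]
      by (intro imageI single_in_direct_sum fs.subspace_scale[OF X h] X)
  next
    case False
    then show ?thesis
      using boundary_edge_vertices[OF vw] ts.subspace_0[OF subspace] by (simp add: interior_single_def)
  qed
qed

lemma boundary_map_in_direct_sum:
  assumes X: "fs.subspace X" and g: "g \<in> direct_sum (interior2 K) (\<lambda>_. X)"
  shows "boundary_map g \<in> direct_sum interior_vertices (\<lambda>_. X)"
proof -
  have "(\<lambda>p. boundary (\<lambda>\<tau>. g \<tau> p) v) \<in> X" for v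
    unfolding boundary_def
    by (intro fs_subspace_pointwise(5)[OF X] fs.subspace_scale[OF X]) (use g in \<open>auto simp: direct_sum_def\<close>)
  then show ?thesis by (simp add: direct_sum_def boundary_map_def[abs_def])
qed

lemma interior_single_decomposition:
  assumes "f \<in> direct_sum interior_vertices W"
  shows "f = (\<Sum>v\<in>interior_vertices. interior_single v (f v))"
  using direct_sum_decomposition[OF _ assms] by (simp add: interior_single_def)

lemma boundary_map_image_open:
  assumes X: "fs.subspace X" and "bdry_2faces K \<noteq> {}"
  shows "boundary_map ` direct_sum (interior2 K) (\<lambda>_. X) = direct_sum interior_vertices (\<lambda>_. X)"
proof
  show "boundary_map ` direct_sum (interior2 K) (\<lambda>_. X) \<subseteq> direct_sum interior_vertices (\<lambda>_. X)"
    using boundary_map_in_direct_sum[OF X] by blast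
  show "direct_sum interior_vertices (\<lambda>_. X) \<subseteq> boundary_map ` direct_sum (interior2 K) (\<lambda>_. X)"
  proof
    fix f assume f: "f \<in> direct_sum interior_vertices (\<lambda>_. X)"
    obtain b where "b \<notin> interior_vertices" using ex_boundary_vertex assms(2) by blast
    then have "interior_single v (f v) \<in> boundary_map ` direct_sum (interior2 K) (\<lambda>_. X)"
      if "v \<in> interior_vertices" for v
      using interior_single_diff_in_image[OF X, of "f v" v b] f that
      by (simp add: interior_single_def direct_sum_def)
    then show "f \<in> boundary_map ` direct_sum (interior2 K) (\<lambda>_. X)"
      by (subst interior_single_decomposition[OF f]) (rule ts.subspace_sum[OF boundary_map_image_subspace[OF X]])
  qed
qed

lemma boundary_map_image_closed:
  assumes X: "fs.subspace X" and closed: "bdry_2faces K = {}"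
  shows "boundary_map ` direct_sum (interior2 K) (\<lambda>_. X) = {f\<in>direct_sum UNIV (\<lambda>_. X). (\<Sum>v\<in>UNIV. f v) = 0}"
proof
  note interior = interior_vertices_closed[OF closed]
  show "boundary_map ` direct_sum (interior2 K) (\<lambda>_. X) \<subseteq> {f\<in>direct_sum UNIV (\<lambda>_. X). (\<Sum>v\<in>UNIV. f v) = 0}"
    using boundary_map_in_direct_sum[OF X] sum_boundary_map_zero[OF closed] by (auto simp: interior)
  show "{f\<in>direct_sum UNIV (\<lambda>_. X). (\<Sum>v\<in>UNIV. f v) = 0} \<subseteq> boundary_map ` direct_sum (interior2 K) (\<lambda>_. X)"
  proof
    fix f assume "f \<in> {f\<in>direct_sum (UNIV :: 'v set) (\<lambda>_. X). (\<Sum>v\<in>UNIV. f v) = 0}"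
    then have f: "f \<in> direct_sum interior_vertices (\<lambda>_. X)" "(\<Sum>v\<in>UNIV. f v) = 0" by (auto simp: interior)
    fix b :: 'v
    have "(\<Sum>v\<in>UNIV. interior_single v (f v) - interior_single b (f v))
      \<in> boundary_map ` direct_sum (interior2 K) (\<lambda>_. X)"
      using f(1)
      by (intro ts.subspace_sum[OF boundary_map_image_subspace[OF X]] interior_single_diff_in_image[OF X])
        (simp add: direct_sum_def interior)
    moreover have "(\<Sum>v\<in>UNIV. interior_single b (f v)) = single b (\<Sum>v\<in>UNIV. f v)"
      by (simp add: interior_single_def interior ft.linear_sum[OF linear_single])
    then have "(\<Sum>v\<in>UNIV. interior_single b (f v)) = 0" by (simp add: f(2) single_def fun_eq_iff)
    then have "(\<Sum>v\<in>UNIV. interior_single v (f v) - interior_single b (f v)) = f"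
      using interior_single_decomposition[OF f(1)] by (simp add: interior sum_subtractf)
    ultimately show "f \<in> boundary_map ` direct_sum (interior2 K) (\<lambda>_. X)" by simp
  qed
qed

end

section \<open>Exactness at the vertices\<close>

lemma in_span_if_annihilated:
  fixes S :: "'a::euclidean_space set"
  assumes "\<And>a. (\<And>s. s \<in> S \<Longrightarrow> a \<bullet> s = 0) \<Longrightarrow> a \<bullet> y = 0"
  shows "y \<in> span S"
proof -
  obtain x z where xz: "x \<in> span S" "\<And>w. w \<in> span S \<Longrightarrow> orthogonal z w" "y = x + z"
    using orthogonal_subspace_decomp_exists[of S y] by metis
  have "z \<bullet> y = 0" by (rule assms) (use xz(2) span_base in \<open>auto simp: orthogonal_def\<close>)
  moreover have "z \<bullet> x = 0" using xz(1,2) by (simp add: orthogonal_def)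
  ultimately have "z \<bullet> z = 0" using xz(3) by (simp add: inner_add_right)
  then show ?thesis using xz by simp
qed

context pure_fan
begin

definition edges :: "'v set set" where "edges = {e\<in>K. card e = 2}"

lemma Union_edges: "\<Union>edges = UNIV"
proof -
  have "v \<in> \<Union>edges" for v
  proof -
    obtain \<sigma> where \<sigma>: "\<sigma> \<in> facets K" "v \<in> \<sigma>" using ex_facet_containing[OF vertex_in_K[of v]] by auto
    then obtain w x where "\<sigma> = {v,w,x}" "distinct [v,w,x]" using facet_at_vertex by blast
    then have "{v,w} \<in> edges" using subface_in_K[OF facet_in_K[OF \<sigma>(1)]] by (auto simp: edges_def)
    then show ?thesis by blast
  qed
  then show ?thesis by blast
qed

lemma normal_edge:
  assumes "{v,w} \<in> K" "v \<noteq> w"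
  obtains k where "k \<noteq> 0" "normal u {v,w} = k *\<^sub>R cross3 (u v) (u w)"
proof -
  let ?c = "cross3 (u v) (u w)" and ?n = "normal u {v,w}"
  have cross_nonzero: "?c \<noteq> 0" by (rule edge_cross_nonzero[OF assms])
  then have "\<exists>n. n \<noteq> 0 \<and> (\<forall>x\<in>{v,w}. n \<bullet> u x = 0)"
    by (intro exI[of _ ?c]) (auto simp: dot_cross_self inner_commute)
  from someI_ex[OF this] have n: "?n \<noteq> 0" "?n \<bullet> u v = 0" "?n \<bullet> u w = 0" unfolding normal_def by auto
  have "?c \<bullet> ?c \<noteq> 0" using cross_nonzero by simp
  from dual_basis_expansion[OF this, of ?n] have normal_eq: "?n = (?n \<bullet> ?c / (?c \<bullet> ?c)) *\<^sub>R ?c" using n by simp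
  then have "?n \<bullet> ?c / (?c \<bullet> ?c) \<noteq> 0" using n(1) by (metis scaleR_zero_left)
  then show ?thesis using that normal_eq by blast
qed

lemma qf_normal_eq_iff:
  assumes "{v,w} \<in> K" "v \<noteq> w"
  shows "qf A (normal u {v,w}) = qf B (normal u {v,w}) \<longleftrightarrow> qf A (cross3 (u v) (u w)) = qf B (cross3 (u v) (u w))"
  by (rule normal_edge[OF assms]) (simp add: qf_scale)

lemma normal_perp:
  assumes "\<tau> \<in> interior_edges v" shows "normal u \<tau> \<bullet> u v = 0"
proof -
  have "v \<in> \<tau>" "card \<tau> = 2" "\<tau> \<in> K" using assms by (auto simp: interior_edges_def interior2_iff)
  then obtain w where "\<tau> = {v,w}" "v \<noteq> w" "\<tau> \<in> K" by (metis card_2_iff insertE insert_commute singletonD)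
  then obtain k where "normal u \<tau> = k *\<^sub>R cross3 (u v) (u w)" using normal_edge[of v w] by blast
  then show ?thesis by (simp add: dot_cross_self inner_commute)
qed

abbreviation edge_ideal :: "nat \<Rightarrow> 'v set \<Rightarrow> (real^3 \<Rightarrow> real) set" where
  "edge_ideal d \<tau> \<equiv> sq_ideal u {\<tau>} \<inter> forms d"

abbreviation vertex_ideal :: "nat \<Rightarrow> 'v \<Rightarrow> (real^3 \<Rightarrow> real) set" where
  "vertex_ideal d v \<equiv> sq_ideal u (interior_edges v) \<inter> forms d"

definition boundary_image :: "nat \<Rightarrow> ('v \<Rightarrow> real^3 \<Rightarrow> real) set" where
  "boundary_image d = boundary_map ` direct_sum (interior2 K) (edge_ideal d)"

lemma boundary_image_subspace: "ts.subspace (boundary_image d)"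
  unfolding boundary_image_def
  by (intro tt.linear_subspace_image[OF linear_boundary_map] direct_sum_subspace sq_ideal_forms_subspace) simp

lemmas boundary_image_diff = ts_subspace_pointwise(1)[OF boundary_image_subspace]
  and boundary_image_sum = ts_subspace_pointwise(2)[OF boundary_image_subspace]

lemma boundary_image_mult:
  assumes "y \<in> boundary_image d" and q: "q \<in> forms k"
  shows "(\<lambda>v p. q p * y v p) \<in> boundary_image (d + k)"
proof -
  obtain g where g: "g \<in> direct_sum (interior2 K) (edge_ideal d)" "y = boundary_map g"
    using assms(1) unfolding boundary_image_def by blast
  have "(\<lambda>p. q p * g \<tau> p) \<in> edge_ideal (d + k) \<tau>" if "\<tau> \<in> interior2 K" for \<tau>
    by (rule sq_ideal_forms_mult[OF _ _ q]) (use g(1) that in \<open>auto simp: direct_sum_def\<close>)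
  then have "(\<lambda>\<tau> p. q p * g \<tau> p) \<in> direct_sum (interior2 K) (edge_ideal (d + k))"
    using g(1) by (simp add: direct_sum_def)
  moreover have "(\<lambda>v p. q p * y v p) = boundary_map (\<lambda>\<tau> p. q p * g \<tau> p)"
    by (simp add: fun_eq_iff g(2) boundary_map_def boundary_scale)
  ultimately show ?thesis unfolding boundary_image_def by blast
qed

lemma boundary_image_subset: "boundary_image d \<subseteq> direct_sum interior_vertices (vertex_ideal d)"
proof
  fix y assume "y \<in> boundary_image d"
  then obtain g where g: "g \<in> direct_sum (interior2 K) (edge_ideal d)" "y = boundary_map g"
    unfolding boundary_image_def by blast
  have "y v \<in> vertex_ideal d v" if "v \<in> interior_vertices" for v
  proof -
    have subspace: "fs.subspace (vertex_ideal d v)" by (rule sq_ideal_forms_subspace) simp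
    have "g \<tau> \<in> vertex_ideal d v" if "\<tau> \<in> interior_edges v" for \<tau>
      using g(1) that sq_ideal_mono[of "interior_edges v" "{\<tau>}" u] by (auto simp: direct_sum_def interior_edges_def)
    then have "(\<lambda>p. \<Sum>\<tau>\<in>interior_edges v. incidence v \<tau> * g \<tau> p) \<in> vertex_ideal d v"
      by (intro fs_subspace_pointwise(5)[OF subspace] fs.subspace_scale[OF subspace])
    also have "(\<lambda>p. \<Sum>\<tau>\<in>interior_edges v. incidence v \<tau> * g \<tau> p) = y v"
      using that by (simp add: fun_eq_iff g(2) boundary_map_def boundary_eq_sum_interior_edges)
    finally show ?thesis .
  qed
  then show "y \<in> direct_sum interior_vertices (vertex_ideal d)"
    by (simp add: direct_sum_def g(2) boundary_map_def[abs_def])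
qed

definition quadratic_family :: "real^3^3^'v \<Rightarrow> 'v \<Rightarrow> real^3 \<Rightarrow> real" where
  "quadratic_family Y v p = qf (Y $ v) p"

lemma quadratic_family_add: "quadratic_family (Y + Z) = quadratic_family Y + quadratic_family Z"
  and quadratic_family_diff: "quadratic_family (Y - Z) = quadratic_family Y - quadratic_family Z"
  and quadratic_family_scale: "quadratic_family (c *\<^sub>R Y) = (\<lambda>v p. c * quadratic_family Y v p)"
  by (simp_all add: fun_eq_iff quadratic_family_def qf_add_matrix qf_diff_matrix qf_scale_matrix)

definition edge_matrix :: "'v set \<Rightarrow> real^3^3^'v" where
  "edge_matrix \<tau> = (\<chi> v. if v \<in> interior_vertices then incidence v \<tau> *\<^sub>R outer (normal u \<tau>) (normal u \<tau>) else 0)"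

lemma quadratic_edge_matrix:
  assumes "\<tau> \<in> interior2 K"
  shows "quadratic_family (edge_matrix \<tau>) = boundary_map (single \<tau> (\<lambda>p. (normal u \<tau> \<bullet> p)\<^sup>2))"
proof (intro ext)
  fix v p
  have "boundary (\<lambda>\<tau>'. single \<tau> (\<lambda>p. (normal u \<tau> \<bullet> p)\<^sup>2) \<tau>' p) v
      = (\<Sum>\<tau>'\<in>interior2 K. if \<tau>' = \<tau> then incidence v \<tau> * (normal u \<tau> \<bullet> p)\<^sup>2 else 0)"
    unfolding boundary_def by (rule sum.cong) (auto simp: single_def)
  also have "\<dots> = incidence v \<tau> * (normal u \<tau> \<bullet> p)\<^sup>2" using assms by simp
  finally show "quadratic_family (edge_matrix \<tau>) v p = boundary_map (single \<tau> (\<lambda>p. (normal u \<tau> \<bullet> p)\<^sup>2)) v p"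
    by (simp add: quadratic_family_def edge_matrix_def boundary_map_def qf_scale_matrix qf_outer power2_eq_square)
qed

lemma quadratic_family_in_boundary_image:
  assumes "Y \<in> span (edge_matrix ` interior2 K)"
  shows "quadratic_family Y \<in> boundary_image 2"
  using assms
proof (induction rule: span_induct)
  case base
  have "quadratic_family 0 = 0" by (simp add: fun_eq_iff quadratic_family_def)
  then show ?case
    using ts.subspace_0[OF boundary_image_subspace] ts.subspace_add[OF boundary_image_subspace]
      ts.subspace_scale[OF boundary_image_subspace]
    by (intro subspaceI) (simp_all add: quadratic_family_add quadratic_family_scale)
next
  case (step Y)
  then obtain \<tau> where \<tau>: "\<tau> \<in> interior2 K" "Y = edge_matrix \<tau>" by blast
  have "single \<tau> (\<lambda>p. (normal u \<tau> \<bullet> p)\<^sup>2) \<in> direct_sum (interior2 K) (edge_ideal 2)"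
    by (intro single_in_direct_sum \<tau>(1) normal_square_in_ideal sq_ideal_forms_subspace) simp_all
  then show ?case unfolding \<tau>(2) quadratic_edge_matrix[OF \<tau>(1)] boundary_image_def by blast
qed

definition on_interior :: "real^3^3^'v \<Rightarrow> 'v \<Rightarrow> real^3^3" where
  "on_interior A v = (if v \<in> interior_vertices then A $ v else 0)"

lemma inner_edge_matrix:
  assumes "{x,y} \<in> K" "x \<noteq> y"
  shows "A \<bullet> edge_matrix {x,y} =
    incidence x {x,y} * (qf (on_interior A x) (normal u {x,y}) - qf (on_interior A y) (normal u {x,y}))"
proof -
  let ?n = "normal u {x,y}"
  have card2: "card {x,y} = 2" using assms(2) by simp
  have "A \<bullet> edge_matrix {x,y} = (\<Sum>w\<in>UNIV. incidence w {x,y} * qf (on_interior A w) ?n)"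
    unfolding inner_vec_def[of A] by (intro sum.cong) (auto simp: edge_matrix_def on_interior_def inner_outer_self)
  also have "\<dots> = (\<Sum>w\<in>{x,y}. incidence w {x,y} * qf (on_interior A w) ?n)"
    by (rule sum.mono_neutral_right) (auto simp: incidence_zero[OF card2])
  also have "\<dots> = incidence x {x,y} * (qf (on_interior A x) ?n - qf (on_interior A y) ?n)"
    using assms(2) incidence_opposite[OF card2] by (simp add: algebra_simps)
  finally show ?thesis .
qed

lemma annihilator_compatible:
  assumes annihilates: "\<And>\<tau>. \<tau> \<in> interior2 K \<Longrightarrow> A \<bullet> edge_matrix \<tau> = 0"
  shows "compatible u edges (on_interior A)"
  unfolding compatible_def
proof (intro allI impI)
  fix x y assume "{x,y} \<in> edges"
  then have xy: "{x,y} \<in> K" "x \<noteq> y" "card {x,y} = 2" by (auto simp: edges_def)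
  show "qf (on_interior A x) (cross3 (u x) (u y)) = qf (on_interior A y) (cross3 (u x) (u y))"
  proof (cases "{x,y} \<in> interior2 K")
    case True
    have "incidence x {x,y} \<noteq> 0" using incidence_values[OF xy(3), of x] by auto
    then show ?thesis
      using annihilates[OF True] inner_edge_matrix[OF xy(1,2), of A] qf_normal_eq_iff[OF xy(1,2)] by simp
  next
    case False
    then show ?thesis using boundary_edge_vertices[OF xy(1,2)] by (simp add: on_interior_def)
  qed
qed

definition interior_rigid :: bool where
  "interior_rigid \<longleftrightarrow> (\<forall>A x. compatible u edges A \<longrightarrow> (\<forall>y. y \<notin> interior_vertices \<longrightarrow> A y = 0)
     \<longrightarrow> agree_on_perp (u x) (A x) 0)"

lemma square_at_vertex_in_boundary_image:
  assumes rigid: "interior_rigid" and v: "v \<in> interior_vertices" and \<tau>: "\<tau> \<in> interior_edges v"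
  shows "single v (\<lambda>p. (normal u \<tau> \<bullet> p)\<^sup>2) \<in> boundary_image 2"
proof -
  let ?n = "normal u \<tau>"
  have "axis v (outer ?n ?n) \<in> span (edge_matrix ` interior2 K)"
  proof (rule in_span_if_annihilated)
    fix A :: "real^3^3^'v" assume "\<And>s. s \<in> edge_matrix ` interior2 K \<Longrightarrow> A \<bullet> s = 0"
    then have "compatible u edges (on_interior A)" by (intro annihilator_compatible) auto
    moreover have "\<forall>y. y \<notin> interior_vertices \<longrightarrow> on_interior A y = 0" by (simp add: on_interior_def)
    ultimately have "agree_on_perp (u v) (on_interior A v) 0"
      using rigid unfolding interior_rigid_def by blast
    then have "qf (A $ v) ?n = 0" using agree_on_perpD normal_perp[OF \<tau>] v by (fastforce simp: on_interior_def)
    then show "A \<bullet> axis v (outer ?n ?n) = 0" by (simp add: inner_axis inner_outer_self)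
  qed
  then have "quadratic_family (axis v (outer ?n ?n)) \<in> boundary_image 2"
    by (rule quadratic_family_in_boundary_image)
  also have "quadratic_family (axis v (outer ?n ?n)) = single v (\<lambda>p. (?n \<bullet> p)\<^sup>2)"
    by (auto simp: fun_eq_iff quadratic_family_def axis_def single_def qf_outer power2_eq_square)
  finally show ?thesis .
qed

lemma vertex_ideal_in_boundary_image:
  assumes rigid: "interior_rigid" and v: "v \<in> interior_vertices" and f: "f \<in> vertex_ideal d v"
  shows "single v f \<in> boundary_image d"
  using finite f
proof (cases rule: sq_ideal_forms_cases)
  case zero
  then have "single v f = 0" by (auto simp: single_def fun_eq_iff)
  then show ?thesis using ts.subspace_0[OF boundary_image_subspace] by simp
next
  case (comb e H)
  have "(\<lambda>w p. \<Sum>\<tau>\<in>interior_edges v. H \<tau> p * single v (\<lambda>p. (normal u \<tau> \<bullet> p)\<^sup>2) w p) \<in> boundary_image (2 + e)"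
    by (intro boundary_image_sum boundary_image_mult square_at_vertex_in_boundary_image[OF rigid v] comb(2))
  then show ?thesis by (simp add: comb(1,3) single_sq_comb[abs_def] add.commute)
qed

proposition boundary_image_if_interior_rigid:
  assumes "interior_rigid"
  shows "boundary_image d = direct_sum interior_vertices (vertex_ideal d)"
proof
  show "direct_sum interior_vertices (vertex_ideal d) \<subseteq> boundary_image d"
  proof
    fix f assume f: "f \<in> direct_sum interior_vertices (vertex_ideal d)"
    then have "single v (f v) \<in> boundary_image d" if "v \<in> interior_vertices" for v
      using vertex_ideal_in_boundary_image[OF assms that] that by (auto simp: direct_sum_def)
    then show "f \<in> boundary_image d"
      using direct_sum_decomposition[OF _ f] ts.subspace_sum[OF boundary_image_subspace,
        of interior_vertices "\<lambda>v. single v (f v)" d]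
      by simp
  qed
qed (rule boundary_image_subset)

end

section \<open>Syzygies of squares and complete fans\<close>

lemma trilinear_zero_if_zero_on_spanning:
  fixes t :: "'a::real_vector \<Rightarrow> 'a \<Rightarrow> 'a \<Rightarrow> real"
  assumes linear: "\<And>x y. linear (\<lambda>z. t z x y)" "\<And>x y. linear (\<lambda>z. t x z y)" "\<And>x y. linear (\<lambda>z. t x y z)"
    and span: "span N = UNIV" and zero: "\<And>x y z. x \<in> N \<Longrightarrow> y \<in> N \<Longrightarrow> z \<in> N \<Longrightarrow> t x y z = 0"
  shows "t x y z = 0"
proof -
  have third: "t x y z = 0" if "x \<in> N" "y \<in> N" for x y z
    by (rule linear_eq_0_on_span[OF linear(3), of N]) (simp_all add: zero that span)
  have second: "t x y z = 0" if "x \<in> N" for x y z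
    by (rule linear_eq_0_on_span[OF linear(2), of N]) (simp_all add: third that span)
  show ?thesis
    by (rule linear_eq_0_on_span[OF linear(1), of N]) (simp_all add: second span)
qed

lemma trilinear_zero_on_frame:
  fixes t :: "'a::real_vector \<Rightarrow> 'a \<Rightarrow> 'a \<Rightarrow> real"
  assumes linear: "\<And>x y. linear (\<lambda>z. t z x y)" "\<And>x y. linear (\<lambda>z. t x z y)" "\<And>x y. linear (\<lambda>z. t x y z)"
    and anti: "\<And>x y z. t x y z = - t y x z" and cyclic: "\<And>x y z. t x y z + t y z x + t z x y = 0"
    and pairs: "\<And>x y. x \<in> {m1,m2,m3} \<Longrightarrow> y \<in> {m1,m2,m3} \<Longrightarrow> t x y x = 0"
    and differences: "t (m1 - m2) (m2 - m3) (m1 - m2) = 0" "t (m1 - m2) (m2 - m3) (m2 - m3) = 0"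
    and frame: "x \<in> {m1,m2,m3}" "y \<in> {m1,m2,m3}" "z \<in> {m1,m2,m3}"
  shows "t x y z = 0"
proof -
  let ?s = "t (m1 - m2) (m2 - m3)"
  have diagonal: "t x x z = 0" for x z using anti[of x x z] by simp
  have pairs': "t x y y = 0" if "x \<in> {m1,m2,m3}" "y \<in> {m1,m2,m3}" for x y
    using anti[of x y y] pairs[of y x] that by simp
  have "?s z = t m1 m2 z + t m2 m3 z + t m3 m1 z" for z
    using anti[of m1 m3 z] by (simp add: linear_diff[OF linear(1)] linear_diff[OF linear(2)] diagonal)
  then have "?s m1 = t m2 m3 m1" "?s m2 = t m3 m1 m2" "?s m3 = t m1 m2 m3" using pairs pairs' by simp_all
  moreover have "?s m1 = ?s m2" "?s m2 = ?s m3" using differences by (simp_all add: linear_diff[OF linear(3)])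
  ultimately have "t m1 m2 m3 = 0" "t m2 m3 m1 = 0" "t m3 m1 m2 = 0" using cyclic[of m1 m2 m3] by simp_all
  then show ?thesis
    using frame diagonal pairs pairs' anti[of m2 m1 m3] anti[of m3 m2 m1] anti[of m1 m3 m2] by auto
qed

text \<open>The linear syzygies of the ideal of the squares of all linear forms are spanned by those
  involving only forms that vanish at one of four points in general position.\<close>
lemma trilinear_zero_if_zero_at_four_points:
  fixes t :: "real^3 \<Rightarrow> real^3 \<Rightarrow> real^3 \<Rightarrow> real"
  assumes linear: "\<And>x y. linear (\<lambda>z. t z x y)" "\<And>x y. linear (\<lambda>z. t x z y)" "\<And>x y. linear (\<lambda>z. t x y z)"
    and anti: "\<And>x y z. t x y z = - t y x z" and cyclic: "\<And>x y z. t x y z + t y z x + t z x y = 0"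
    and local: "\<And>w x y z. w \<in> {a,b,c,e} \<Longrightarrow> x \<bullet> w = 0 \<Longrightarrow> y \<bullet> w = 0 \<Longrightarrow> z \<bullet> w = 0 \<Longrightarrow> t x y z = 0"
    and indep: "a \<bullet> cross3 b c \<noteq> 0" "e \<bullet> cross3 b c \<noteq> 0" "e \<bullet> cross3 c a \<noteq> 0" "e \<bullet> cross3 a b \<noteq> 0"
  shows "t x y z = 0"
proof -
  define m where "m n = (1 / (e \<bullet> n)) *\<^sub>R n" for n
  let ?m1 = "m (cross3 b c)" and ?m2 = "m (cross3 c a)" and ?m3 = "m (cross3 a b)"
  have perp: "?m1 \<bullet> b = 0" "?m1 \<bullet> c = 0" "?m2 \<bullet> c = 0" "?m2 \<bullet> a = 0" "?m3 \<bullet> a = 0" "?m3 \<bullet> b = 0"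
    by (simp_all add: m_def dot_cross_self inner_commute)
  have perp_e: "(?m1 - ?m2) \<bullet> e = 0" "(?m2 - ?m3) \<bullet> e = 0"
    using indep by (simp_all only: inner_commute[of _ e] inner_diff_right) (simp_all add: m_def)
  have "span {?m1,?m2,?m3} = UNIV"
  proof -
    have "n = (e \<bullet> n) *\<^sub>R m n" if "e \<bullet> n \<noteq> 0" for n using that by (simp add: m_def)
    then have "{cross3 b c, cross3 c a, cross3 a b} \<subseteq> span {?m1,?m2,?m3}"
      using indep by (metis (no_types, lifting) empty_subsetI insert_iff insert_subset span_base span_scale)
    then have "r *\<^sub>R cross3 b c + s *\<^sub>R cross3 c a + q *\<^sub>R cross3 a b \<in> span {?m1,?m2,?m3}" for r s q
      by (intro span_add span_scale) auto
    then show ?thesis using dual_basis_expansion[OF indep(1)] by (metis UNIV_eq_I)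
  qed
  moreover have "t x y z = 0" if "x \<in> {?m1,?m2,?m3}" "y \<in> {?m1,?m2,?m3}" "z \<in> {?m1,?m2,?m3}" for x y z
  proof (rule trilinear_zero_on_frame[OF linear anti cyclic _ _ _ that])
    show "t x y x = 0" if "x \<in> {?m1,?m2,?m3}" "y \<in> {?m1,?m2,?m3}" for x y
    proof -
      have "\<exists>w\<in>{a,b,c}. x \<bullet> w = 0 \<and> y \<bullet> w = 0" using that perp by auto
      then show ?thesis using local by blast
    qed
  qed (use perp_e local[of e] in auto)
  ultimately show ?thesis by (rule trilinear_zero_if_zero_on_spanning[OF linear])
qed

lemma bilinear_eq_sum_axis:
  fixes f :: "real^'n \<Rightarrow> real^'m \<Rightarrow> real"
  assumes linear: "\<And>y. linear (\<lambda>x. f x y)" "\<And>x. linear (f x)"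
  shows "f x y = (\<Sum>i\<in>UNIV. \<Sum>j\<in>UNIV. x $ i * y $ j * f (axis i 1) (axis j 1))"
proof -
  have "f x y = f (\<Sum>i\<in>UNIV. x $ i *\<^sub>R axis i 1) (\<Sum>j\<in>UNIV. y $ j *\<^sub>R axis j 1)"
    by (simp only: basis_expansion scalar_mult_eq_scaleR[symmetric])
  also have "\<dots> = (\<Sum>i\<in>UNIV. x $ i * f (axis i 1) (\<Sum>j\<in>UNIV. y $ j *\<^sub>R axis j 1))"
    by (simp add: linear_sum[OF linear(1)] linear_cmul[OF linear(1)])
  also have "\<dots> = (\<Sum>i\<in>UNIV. \<Sum>j\<in>UNIV. x $ i * y $ j * f (axis i 1) (axis j 1))"
    by (simp add: linear_sum[OF linear(2)] linear_cmul[OF linear(2)] sum_distrib_left mult.assoc)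
  finally show ?thesis .
qed

lemma sum_antisymmetric:
  fixes a f :: "'i \<Rightarrow> 'i \<Rightarrow> real"
  assumes "\<And>i k. a i k = - a k i"
  shows "(\<Sum>i\<in>I. \<Sum>k\<in>I. a i k * f i k) = 1/2 * (\<Sum>i\<in>I. \<Sum>k\<in>I. a i k * (f i k - f k i))"
proof -
  have "(\<Sum>i\<in>I. \<Sum>k\<in>I. a i k * f k i) = (\<Sum>i\<in>I. \<Sum>k\<in>I. a k i * f i k)" by (rule sum.swap)
  also have "\<dots> = - (\<Sum>i\<in>I. \<Sum>k\<in>I. a i k * f i k)"
    unfolding sum_negf[symmetric] by (intro sum.cong refl) (metis assms minus_mult_left)
  finally show ?thesis by (simp add: right_diff_distrib sum_subtractf)
qed

lemma quadratic_relation_iterated_koszul: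
  fixes h :: "3 \<Rightarrow> 3 \<Rightarrow> real^3 \<Rightarrow> real"
  assumes h: "\<And>i j. h i j \<in> forms e" and relation: "\<And>p. (\<Sum>i\<in>UNIV. \<Sum>j\<in>UNIV. h i j p * (p $ i * p $ j)) = 0"
  obtains a b where "\<And>i j p. a i j p = - a j i p" "\<And>j i k. b j i k \<in> forms_pred e"
    "\<And>j i k p. b j i k p = - b j k i p" "\<And>i j p. h i j p = a j i p + (\<Sum>k\<in>UNIV. b j i k p * p $ k)"
proof -
  define g where "g j p = (\<Sum>i\<in>UNIV. h i j p * p $ i)" for j p
  have "g j \<in> forms (e + 1)" for j unfolding g_def[abs_def] by (intro forms_sum forms_mult h coord_in_forms)
  moreover have "(\<Sum>j\<in>UNIV. g j p * p $ j) = 0" for p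
    using relation[of p] by (subst (asm) sum.swap) (simp add: g_def sum_distrib_right sum_distrib_left mult_ac)
  ultimately obtain a where a: "\<And>j k. a j k \<in> forms_pred (e + 1)" "\<And>j k p. a j k p = - a k j p"
    "\<And>j p. g j p = (\<Sum>k\<in>UNIV. a j k p * p $ k)" by (rule koszul_exact) blast
  let ?koszul = "\<lambda>j b. (\<forall>i k. b i k \<in> forms_pred e) \<and> (\<forall>i k p. b i k p = - b k i p) \<and>
      (\<forall>i p. h i j p - a j i p = (\<Sum>k\<in>UNIV. b i k p * p $ k))"
  have "\<exists>b. ?koszul j b" for j
  proof -
    have "(\<lambda>p. h i j p - a j i p) \<in> forms e" for i
      using a(1)[of j i] by (intro forms_diff h) (simp add: forms_pred_def)
    moreover have "(\<Sum>i\<in>UNIV. (h i j p - a j i p) * p $ i) = 0" for p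
      using a(3)[of j p] by (simp add: g_def left_diff_distrib sum_subtractf)
    ultimately show ?thesis by (rule koszul_exact) blast
  qed
  then have "\<exists>b. \<forall>j. ?koszul j (b j)" by (intro choice allI)
  then obtain b where koszul: "\<forall>j. ?koszul j (b j)" by (rule exE)
  have b: "b j i k \<in> forms_pred e" "b j i k p = - b j k i p" "h i j p - a j i p = (\<Sum>k\<in>UNIV. b j i k p * p $ k)"
    for i j k p using spec[OF koszul, of j] by blast+
  have "h i j p = a j i p + (\<Sum>k\<in>UNIV. b j i k p * p $ k)" for i j p using b(3)[of i j p] by simp
  then show ?thesis by (rule that[of a b, OF a(2) b(1,2)])
qed

lemma quadratic_relation_syzygies:
  fixes h :: "3 \<Rightarrow> 3 \<Rightarrow> real^3 \<Rightarrow> real"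
  assumes h: "\<And>i j. h i j \<in> forms e" and relation: "\<And>p. (\<Sum>i\<in>UNIV. \<Sum>j\<in>UNIV. h i j p * (p $ i * p $ j)) = 0"
  obtains b where "\<And>i j k. b i j k \<in> forms_pred e"
    "\<And>\<theta> p. (\<And>i j. \<theta> i j = \<theta> j i) \<Longrightarrow> (\<Sum>i\<in>UNIV. \<Sum>j\<in>UNIV. h i j p * \<theta> i j) =
      1/2 * (\<Sum>j\<in>UNIV. \<Sum>i\<in>UNIV. \<Sum>k\<in>UNIV. b j i k p * (p $ k * \<theta> i j - p $ i * \<theta> k j))"
proof -
  obtain a b where a: "\<And>i j p. a i j p = - a j i p" and b: "\<And>j i k. b j i k \<in> forms_pred e"
    "\<And>j i k p. b j i k p = - b j k i p" "\<And>i j p. h i j p = a j i p + (\<Sum>k\<in>UNIV. b j i k p * p $ k)"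
    by (rule quadratic_relation_iterated_koszul[OF h relation]) blast
  have expand: "(\<Sum>i\<in>UNIV. \<Sum>j\<in>UNIV. h i j p * \<theta> i j) =
      1/2 * (\<Sum>j\<in>UNIV. \<Sum>i\<in>UNIV. \<Sum>k\<in>UNIV. b j i k p * (p $ k * \<theta> i j - p $ i * \<theta> k j))"
    if symmetric: "\<And>i j. \<theta> i j = \<theta> j i" for \<theta> p
  proof -
    have "(\<Sum>j\<in>UNIV. \<Sum>i\<in>UNIV. a j i p * \<theta> i j) = 1/2 * (\<Sum>j\<in>UNIV. \<Sum>i\<in>UNIV. a j i p * (\<theta> i j - \<theta> j i))"
      by (rule sum_antisymmetric) (rule a)
    also have "\<dots> = 0"
    proof -
      have "\<theta> i j - \<theta> j i = 0" for i j using symmetric[of i j] by simp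
      then show ?thesis by (simp only: mult_zero_right sum.neutral_const)
    qed
    finally have "(\<Sum>i\<in>UNIV. \<Sum>j\<in>UNIV. h i j p * \<theta> i j) = (\<Sum>j\<in>UNIV. \<Sum>i\<in>UNIV. \<Sum>k\<in>UNIV. b j i k p * (p $ k * \<theta> i j))"
      by (subst sum.swap) (simp add: b(3) distrib_right sum.distrib sum_distrib_right mult.assoc)
    also have "\<dots> = (\<Sum>j\<in>UNIV. 1/2 * (\<Sum>i\<in>UNIV. \<Sum>k\<in>UNIV. b j i k p * (p $ k * \<theta> i j - p $ i * \<theta> k j)))"
      by (intro sum.cong refl sum_antisymmetric b(2))
    finally show ?thesis by (simp add: sum_distrib_left)
  qed
  show ?thesis by (rule that[of b, OF b(1) expand])
qed

definition symm :: "real^'n \<Rightarrow> real^'n \<Rightarrow> real^'n^'n" where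
  "symm l m = outer l m + outer m l"

lemma symm_commute: "symm l m = symm m l"
  by (simp add: symm_def add.commute)

lemma linear_symm: "linear (symm l)"
  by (rule linearI) (simp_all add: symm_def outer_def vec_eq_iff distrib_left distrib_right mult.left_commute)

lemma qf_symm: "qf (symm l m) p = 2 * (l \<bullet> p) * (m \<bullet> p)"
  by (simp add: symm_def qf_add_matrix qf_outer)

lemma inner_symm: "A \<bullet> symm l m = qf A (l + m) - qf A l - qf A m"
  by (simp add: symm_def inner_add_right inner_outer qf_add)

locale closed_rigid_fan = pure_fan K u for K :: "('v::finite) set set" and u +
  assumes closed: "bdry_2faces K = {}" and independent: "triples_independent u" and rigid: "rigid u edges"
begin

lemma interior_vertices_eq: "interior_vertices = UNIV"
  by (rule interior_vertices_closed[OF closed])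

lemma edges_eq: "edges = interior2 K"
  using closed bdry_2faces_iff interior2_iff by (auto simp: edges_def)

lemma four_vertices: "CARD('v) \<ge> 4"
proof -
  obtain a where a: "a \<in> facets K" using facets_nonempty by blast
  obtain v w x where vwx: "a = {v,w,x}" "distinct [v,w,x]" using card_facet[OF a] by (auto simp: card_3_iff)
  then have "{v,w} \<in> interior2 K"
    using subface_in_K[OF facet_in_K[OF a], of "{v,w}"] by (auto simp: edges_eq[symmetric] edges_def)
  then obtain \<sigma> \<sigma>' where "\<sigma> \<in> facets K" "\<sigma>' \<in> facets K" "\<sigma> \<inter> \<sigma>' = {v,w}" using star_interior2 by metis
  then have "card (\<sigma> \<union> \<sigma>') = 4" using card_Un_Int[of \<sigma> \<sigma>'] card_facet vwx(2) by simp
  then show ?thesis by (metis card_mono finite subset_UNIV)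
qed

lemma three_other_vertices: obtains a b c :: 'v where "distinct [v,a,b,c]"
proof -
  have "card (UNIV - {v}) \<ge> 3" using four_vertices by (simp add: card_Diff_subset)
  then obtain Q where "Q \<subseteq> UNIV - {v}" "card Q = 3" using obtain_subset_with_card_n by metis
  then obtain a b c where "Q = {a,b,c}" "distinct [a,b,c]" by (auto simp: card_3_iff)
  then have "distinct [v,a,b,c]" using \<open>Q \<subseteq> UNIV - {v}\<close> by auto
  then show ?thesis by (rule that)
qed

lemma vanishes_at_vertex:
  assumes zero: "\<And>\<tau>. \<tau> \<in> interior_edges v \<Longrightarrow> qf A (normal u \<tau>) = 0"
  shows "agree_on_perp (u v) A 0"
proof -
  let ?A = "\<lambda>x. if x = v then A else 0"
  obtain a b c where abc: "distinct [v,a,b,c]" by (rule three_other_vertices)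
  have "compatible u edges ?A" unfolding compatible_def
  proof (intro allI impI)
    fix x y assume "{x,y} \<in> edges"
    then have xy: "{x,y} \<in> interior2 K" "{x,y} \<in> K" "x \<noteq> y" by (auto simp: edges_eq[symmetric] edges_def)
    have "qf A (cross3 (u x) (u y)) = 0" if "v \<in> {x,y}"
      using zero[of "{x,y}"] that xy(1) qf_normal_eq_iff[OF xy(2,3), of A 0] by (simp add: interior_edges_def)
    then show "qf (?A x) (cross3 (u x) (u y)) = qf (?A y) (cross3 (u x) (u y))" by auto
  qed
  moreover have "u a \<bullet> cross3 (u b) (u c) \<noteq> 0" using triples_independentD[OF independent, of a b c] abc by simp
  ultimately have "agree_on_perp (u v) (?A v) 0"
    by (intro rigid_pinned_zero[OF rigid, of ?A a b c v]) (use abc in \<open>auto simp: Union_edges\<close>)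
  then show ?thesis by simp
qed

definition star_span :: "'v \<Rightarrow> (real^3^3) set" where
  "star_span v = span ((\<lambda>\<tau>. outer (normal u \<tau>) (normal u \<tau>)) ` interior_edges v)"

lemma symm_in_star_span:
  assumes "l \<bullet> u v = 0" "m \<bullet> u v = 0" shows "symm l m \<in> star_span v"
  unfolding star_span_def
proof (rule in_span_if_annihilated)
  fix A assume "\<And>s. s \<in> (\<lambda>\<tau>. outer (normal u \<tau>) (normal u \<tau>)) ` interior_edges v \<Longrightarrow> A \<bullet> s = 0"
  then have "qf A (normal u \<tau>) = 0" if "\<tau> \<in> interior_edges v" for \<tau>
    using that by (auto simp: inner_outer_self[symmetric])
  then have "qf A n = 0" if "n \<bullet> u v = 0" for n using agree_on_perpD[OF vanishes_at_vertex that] by simp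
  then show "A \<bullet> symm l m = 0" using assms by (simp add: inner_symm inner_add_left)
qed

definition local_families :: "(real^3^3^'v) set" where
  "local_families = {Y. \<forall>v. Y $ v \<in> star_span v}"

lemma local_families_subspace: "subspace local_families"
  by (rule subspaceI) (auto simp: local_families_def star_span_def span_zero span_add span_scale)

lemma axis_in_local_families: "M \<in> star_span v \<Longrightarrow> axis v M \<in> local_families"
  by (auto simp: local_families_def axis_def star_span_def span_zero)

lemma sum_axis: "(\<Sum>w\<in>UNIV. axis v M $ w) = M"
  by (simp add: axis_def)

lemma local_family_in_boundary_image:
  assumes Y: "Y \<in> local_families" "(\<Sum>v\<in>UNIV. Y $ v) = 0"
  shows "quadratic_family Y \<in> boundary_image 2"
proof (rule quadratic_family_in_boundary_image, rule in_span_if_annihilated)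
  fix A :: "real^3^3^'v" assume "\<And>s. s \<in> edge_matrix ` interior2 K \<Longrightarrow> A \<bullet> s = 0"
  then have "compatible u edges (on_interior A)" by (intro annihilator_compatible) auto
  from rigidE[OF rigid this] obtain B where B: "\<And>v. agree_on_perp (u v) (A $ v) B"
    by (auto simp: Union_edges on_interior_def interior_vertices_eq)
  have "(A $ v - B) \<bullet> M = 0" if "M \<in> star_span v" for v M
    using that unfolding star_span_def
  proof (induction rule: span_induct)
    case base
    show ?case by (auto intro!: subspaceI simp: inner_add_right)
  next
    case (step M)
    then obtain \<tau> where \<tau>: "\<tau> \<in> interior_edges v" "M = outer (normal u \<tau>) (normal u \<tau>)" by blast
    then show ?case using agree_on_perpD[OF B normal_perp[OF \<tau>(1)]] by (simp add: inner_outer_self qf_diff_matrix)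
  qed
  then have "A \<bullet> Y = (\<Sum>v\<in>UNIV. B \<bullet> Y $ v)"
    using Y(1) by (simp add: inner_vec_def[of A] local_families_def inner_diff_left)
  also have "\<dots> = 0" using Y(2) by (simp add: inner_sum_right[symmetric])
  finally show "A \<bullet> Y = 0" .
qed

lemma linear_sum_components: "linear (\<lambda>Y::real^3^3^'v. \<Sum>v\<in>UNIV. Y $ v)"
  by (rule linearI) (simp_all add: sum.distrib scaleR_sum_right)

lemma symm_in_sum_of_local_families: "symm l m \<in> (\<lambda>Y. \<Sum>v\<in>UNIV. Y $ v) ` local_families"
proof -
  let ?S = "(\<lambda>Y. \<Sum>v\<in>UNIV. Y $ v) ` local_families"
  have "symm l m \<in> span ?S"
  proof (rule in_span_if_annihilated)
    fix A assume A: "\<And>s. s \<in> ?S \<Longrightarrow> A \<bullet> s = 0"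
    have agree: "agree_on_perp (u v) A 0" for v
    proof (rule vanishes_at_vertex)
      fix \<tau> assume "\<tau> \<in> interior_edges v"
      then have "outer (normal u \<tau>) (normal u \<tau>) \<in> star_span v" unfolding star_span_def by (intro span_base imageI)
      then have "(\<Sum>w\<in>UNIV. axis v (outer (normal u \<tau>) (normal u \<tau>)) $ w) \<in> ?S"
        by (intro imageI axis_in_local_families)
      then have "outer (normal u \<tau>) (normal u \<tau>) \<in> ?S" by (simp only: sum_axis)
      then show "qf A (normal u \<tau>) = 0" using A by (simp add: inner_outer_self[symmetric])
    qed
    obtain a b c :: 'v where "distinct [undefined,a,b,c]" by (rule three_other_vertices)
    then have "u a \<bullet> cross3 (u b) (u c) \<noteq> 0" by (intro triples_independentD[OF independent]) simp
    then have "qf A n = 0" for n using qf_eq_if_agree_on_three_planes[OF _ agree agree agree, of a b c n] by simp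
    then show "A \<bullet> symm l m = 0" by (simp add: inner_symm)
  qed
  also have "span ?S = ?S"
    using linear_subspace_image[OF linear_sum_components local_families_subspace] by (simp add: span_eq_iff)
  finally show ?thesis .
qed

lemma ex_linear_local_lift:
  obtains \<Theta> where "linear \<Theta>" "\<And>M. \<Theta> M \<in> local_families" "\<And>l m. (\<Sum>v\<in>UNIV. \<Theta> (symm l m) $ v) = symm l m"
proof -
  let ?sum = "\<lambda>Y::real^3^3^'v. \<Sum>v\<in>UNIV. Y $ v"
  obtain \<Theta> where \<Theta>: "range \<Theta> \<subseteq> local_families" "linear \<Theta>" "\<forall>M\<in>?sum ` local_families. ?sum (\<Theta> M) = M"
    using linear_exists_right_inverse_on[OF linear_sum_components local_families_subspace] by blast
  show ?thesis
  proof (rule that)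
    show "\<Theta> M \<in> local_families" for M using \<Theta>(1) by auto
    show "?sum (\<Theta> (symm l m)) = symm l m" for l m using bspec[OF \<Theta>(3) symm_in_sum_of_local_families] .
  qed (rule \<Theta>(2))
qed

end

locale local_lift = closed_rigid_fan K u for K :: "('v::finite) set set" and u +
  fixes \<Theta> :: "real^3^3 \<Rightarrow> real^3^3^'v"
  assumes linear_lift: "linear \<Theta>" and lift_local: "\<Theta> M \<in> local_families"
    and sum_lift: "(\<Sum>v\<in>UNIV. \<Theta> (symm l m) $ v) = symm l m"
begin

definition theta :: "real^3 \<Rightarrow> real^3 \<Rightarrow> 'v \<Rightarrow> real^3 \<Rightarrow> real" where
  "theta l m = quadratic_family (\<Theta> (symm l m))"

lemma theta_commute: "theta l m = theta m l"
  by (simp add: theta_def symm_commute)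

lemma linear_theta: "linear (\<lambda>m. theta l m v p)"
  by (intro linearI)
    (simp_all add: theta_def quadratic_family_def linear_add[OF linear_symm] linear_add[OF linear_lift]
      linear_cmul[OF linear_symm] linear_cmul[OF linear_lift] qf_add_matrix qf_scale_matrix)

lemma linear_theta_left: "linear (\<lambda>l. theta l m v p)"
  using linear_theta[of m v p] by (simp add: theta_commute[of m])

lemma theta_local:
  assumes "l \<bullet> u v = 0" "m \<bullet> u v = 0"
  shows "(\<lambda>w p. theta l m w p - single v (\<lambda>p. 2 * (l \<bullet> p) * (m \<bullet> p)) w p) \<in> boundary_image 2"
proof -
  let ?Y = "axis v (symm l m) :: real^3^3^'v"
  have "quadratic_family (\<Theta> (symm l m) - ?Y) \<in> boundary_image 2"
  proof (rule local_family_in_boundary_image)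
    show "\<Theta> (symm l m) - ?Y \<in> local_families"
      by (intro subspace_diff[OF local_families_subspace] lift_local axis_in_local_families symm_in_star_span assms)
    show "(\<Sum>w\<in>UNIV. (\<Theta> (symm l m) - ?Y) $ w) = 0" by (simp add: sum_subtractf sum_lift sum_axis)
  qed
  moreover have "quadratic_family ?Y = single v (\<lambda>p. 2 * (l \<bullet> p) * (m \<bullet> p))"
    by (auto simp: fun_eq_iff quadratic_family_def axis_def single_def qf_symm)
  ultimately show ?thesis by (simp add: quadratic_family_diff theta_def fun_diff_def)
qed

definition syzygy :: "real^3 \<Rightarrow> real^3 \<Rightarrow> real^3 \<Rightarrow> 'v \<Rightarrow> real^3 \<Rightarrow> real" where
  "syzygy l m k v p = (l \<bullet> p) * theta m k v p - (m \<bullet> p) * theta l k v p"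

lemma syzygy_local:
  assumes "l \<bullet> u v = 0" "m \<bullet> u v = 0" "k \<bullet> u v = 0"
  shows "syzygy l m k \<in> boundary_image 3"
proof -
  let ?\<theta> = "\<lambda>m k w p. theta m k w p - single v (\<lambda>p. 2 * (m \<bullet> p) * (k \<bullet> p)) w p"
  have product: "(\<lambda>w p. (l \<bullet> p) * ?\<theta> m k w p) \<in> boundary_image 3" if "m \<bullet> u v = 0" for l m
    using boundary_image_mult[OF theta_local[OF that assms(3)] inner_in_forms[of l]] by simp
  have "syzygy l m k = (\<lambda>w p. (l \<bullet> p) * ?\<theta> m k w p - (m \<bullet> p) * ?\<theta> l k w p)"
    by (auto simp: fun_eq_iff syzygy_def single_def algebra_simps)
  then show ?thesis using boundary_image_diff[OF product product] assms(1,2) by simp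
qed

lemma syzygy_cyclic: "syzygy l m k v p + syzygy m k l v p + syzygy k l m v p = 0"
  by (simp add: syzygy_def theta_commute[of k l] theta_commute[of m l] theta_commute[of k m])

lemma syzygy_add:
  "syzygy (l + l') m k = syzygy l m k + syzygy l' m k"
  "syzygy l (m + m') k = syzygy l m k + syzygy l m' k"
  "syzygy l m (k + k') = syzygy l m k + syzygy l m k'"
  by (simp_all add: fun_eq_iff syzygy_def linear_add[OF linear_theta] linear_add[OF linear_theta_left]
      inner_add_left algebra_simps)

lemma syzygy_scale:
  "syzygy (c *\<^sub>R l) m k = (\<lambda>v p. c * syzygy l m k v p)"
  "syzygy l (c *\<^sub>R m) k = (\<lambda>v p. c * syzygy l m k v p)"
  "syzygy l m (c *\<^sub>R k) = (\<lambda>v p. c * syzygy l m k v p)"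
  by (simp_all add: fun_eq_iff syzygy_def linear_cmul[OF linear_theta]
    linear_cmul[OF linear_theta_left] algebra_simps)

lemma syzygy_in_boundary_image: "syzygy l m k \<in> boundary_image 3"
proof (rule ccontr)
  assume "syzygy l m k \<notin> boundary_image 3"
  then obtain \<phi> where lin: "Vector_Spaces.linear (\<lambda>c F i x. c * F i x) (*) \<phi>"
    and zero: "\<And>y. y \<in> boundary_image 3 \<Longrightarrow> \<phi> y = (0::real)" and one: "\<phi> (syzygy l m k) = 1"
    using ts.separating_functional[OF boundary_image_subspace] by blast
  interpret \<phi>: Vector_Spaces.linear "\<lambda>c F i x. c * F i x" "(*)" \<phi> by (rule lin)
  obtain a :: 'v where True by blast
  obtain b c e where distinct: "distinct [a,b,c,e]" by (rule three_other_vertices)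
  note indep = triples_independentD[OF independent]
  have "\<phi> (syzygy l m k) = 0"
  proof (rule trilinear_zero_if_zero_at_four_points)
    show "linear (\<lambda>z. \<phi> (syzygy z x y))" "linear (\<lambda>z. \<phi> (syzygy x z y))" "linear (\<lambda>z. \<phi> (syzygy x y z))" for x y
      by (rule linearI; simp add: syzygy_add syzygy_scale \<phi>.add \<phi>.scale)+
    fix x y z
    have "syzygy x y z = - syzygy y x z" by (simp add: fun_eq_iff syzygy_def)
    then show "\<phi> (syzygy x y z) = - \<phi> (syzygy y x z)" by (simp add: \<phi>.neg)
    have "syzygy x y z + syzygy y z x + syzygy z x y = 0" by (simp add: fun_eq_iff syzygy_cyclic)
    then show "\<phi> (syzygy x y z) + \<phi> (syzygy y z x) + \<phi> (syzygy z x y) = 0" by (simp add: \<phi>.add[symmetric])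
    show "\<phi> (syzygy x y z) = 0" if "w \<in> {u a, u b, u c, u e}" "x \<bullet> w = 0" "y \<bullet> w = 0" "z \<bullet> w = 0" for w
      using zero[OF syzygy_local] that by blast
  qed (use distinct in \<open>auto intro!: indep\<close>)
  then show False using one by simp
qed

lemma quadratic_combination_in_boundary_image:
  fixes h :: "3 \<Rightarrow> 3 \<Rightarrow> real^3 \<Rightarrow> real"
  assumes h: "\<And>i j. h i j \<in> forms e" and relation: "\<And>p. (\<Sum>i\<in>UNIV. \<Sum>j\<in>UNIV. h i j p * (p $ i * p $ j)) = 0"
  shows "(\<lambda>v p. \<Sum>i\<in>UNIV. \<Sum>j\<in>UNIV. h i j p * theta (axis i 1) (axis j 1) v p) \<in> boundary_image (e + 2)"
proof -
  obtain b where b: "\<And>i j k. b i j k \<in> forms_pred e" and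
    expand: "\<And>\<theta> p. (\<And>i j. \<theta> i j = \<theta> j i) \<Longrightarrow> (\<Sum>i\<in>UNIV. \<Sum>j\<in>UNIV. h i j p * \<theta> i j) =
      1/2 * (\<Sum>j\<in>UNIV. \<Sum>i\<in>UNIV. \<Sum>k\<in>UNIV. b j i k p * (p $ k * \<theta> i j - p $ i * \<theta> k j))"
    by (rule quadratic_relation_syzygies[OF h relation]) blast
  have "(\<lambda>v p. b j i k p * syzygy (axis k 1) (axis i 1) (axis j 1) v p) \<in> boundary_image (e + 2)" for i j k
  proof (cases "e = 0")
    case True
    then show ?thesis using b[of j i k] ts.subspace_0[OF boundary_image_subspace]
      by (simp add: forms_pred_def zero_fun_def)
  next
    case False
    then have "b j i k \<in> forms (e - 1)" using b[of j i k] by (simp add: forms_pred_def)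
    from boundary_image_mult[OF syzygy_in_boundary_image this] show ?thesis using False by (simp add: add.commute)
  qed
  then have "(\<lambda>v p. 1/2 * (\<Sum>j\<in>UNIV. \<Sum>i\<in>UNIV. \<Sum>k\<in>UNIV. b j i k p * syzygy (axis k 1) (axis i 1) (axis j 1) v p))
      \<in> boundary_image (e + 2)"
    by (intro ts.subspace_scale[OF boundary_image_subspace] boundary_image_sum)
  also have "(\<lambda>v p. 1/2 * (\<Sum>j\<in>UNIV. \<Sum>i\<in>UNIV. \<Sum>k\<in>UNIV. b j i k p * syzygy (axis k 1) (axis i 1) (axis j 1) v p))
      = (\<lambda>v p. \<Sum>i\<in>UNIV. \<Sum>j\<in>UNIV. h i j p * theta (axis i 1) (axis j 1) v p)"
    by (intro ext, subst expand) (simp_all add: theta_commute syzygy_def inner_axis')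
  finally show ?thesis .
qed

definition square_coefficients :: "('v \<Rightarrow> 'v set \<Rightarrow> real^3 \<Rightarrow> real) \<Rightarrow> 3 \<Rightarrow> 3 \<Rightarrow> real^3 \<Rightarrow> real" where
  "square_coefficients H i j p =
    (\<Sum>v\<in>UNIV. \<Sum>\<tau>\<in>interior_edges v. 1/2 * (normal u \<tau> $ i * normal u \<tau> $ j) * H v \<tau> p)"

lemma square_coefficients_contract:
  "(\<Sum>i\<in>UNIV. \<Sum>j\<in>UNIV. square_coefficients H i j p * q i j) =
    (\<Sum>v\<in>UNIV. \<Sum>\<tau>\<in>interior_edges v. 1/2 * H v \<tau> p * (\<Sum>i\<in>UNIV. \<Sum>j\<in>UNIV. normal u \<tau> $ i * normal u \<tau> $ j * q i j))"
proof -
  let ?f = "\<lambda>i j v \<tau>. 1/2 * H v \<tau> p * (normal u \<tau> $ i * normal u \<tau> $ j * q i j)"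
  have "(\<Sum>i\<in>UNIV. \<Sum>j\<in>UNIV. \<Sum>v\<in>UNIV. \<Sum>\<tau>\<in>interior_edges v. ?f i j v \<tau>)
      = (\<Sum>v\<in>UNIV. \<Sum>i\<in>UNIV. \<Sum>j\<in>UNIV. \<Sum>\<tau>\<in>interior_edges v. ?f i j v \<tau>)"
    by (subst (2) sum.swap, subst sum.swap) (rule refl)
  also have "\<dots> = (\<Sum>v\<in>UNIV. \<Sum>\<tau>\<in>interior_edges v. \<Sum>i\<in>UNIV. \<Sum>j\<in>UNIV. ?f i j v \<tau>)"
    by (intro sum.cong refl, subst (2) sum.swap, subst sum.swap) (rule refl)
  finally show ?thesis by (simp add: square_coefficients_def sum_distrib_left sum_distrib_right mult_ac)
qed

lemma square_coefficients_relation: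
  assumes f: "\<And>v. f v = sq_comb u (interior_edges v) (H v)" and zero_sum: "(\<Sum>v\<in>UNIV. f v) = 0"
  shows "(\<Sum>i\<in>UNIV. \<Sum>j\<in>UNIV. square_coefficients H i j p * (p $ i * p $ j)) = 0"
proof -
  have "(\<Sum>i\<in>UNIV. \<Sum>j\<in>UNIV. normal u \<tau> $ i * normal u \<tau> $ j * (p $ i * p $ j)) = (normal u \<tau> \<bullet> p)\<^sup>2" for \<tau>
    by (simp add: inner_vec_def power2_eq_square sum_product mult_ac)
  then have "(\<Sum>i\<in>UNIV. \<Sum>j\<in>UNIV. square_coefficients H i j p * (p $ i * p $ j)) =
      (\<Sum>v\<in>UNIV. \<Sum>\<tau>\<in>interior_edges v. 1/2 * H v \<tau> p * (normal u \<tau> \<bullet> p)\<^sup>2)"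
    unfolding square_coefficients_contract by simp
  also have "\<dots> = 1/2 * (\<Sum>v\<in>UNIV. f v) p"
    by (simp add: sum_fun_apply f sq_comb_def sum_distrib_left mult_ac)
  finally show ?thesis by (simp add: zero_sum)
qed

lemma sum_of_single_squares:
  assumes f: "f \<in> direct_sum UNIV W" "\<And>v. f v = sq_comb u (interior_edges v) (H v)"
  shows "f w p = (\<Sum>v\<in>UNIV. \<Sum>\<tau>\<in>interior_edges v.
    1/2 * H v \<tau> p * single v (\<lambda>p. 2 * (normal u \<tau> \<bullet> p) * (normal u \<tau> \<bullet> p)) w p)"
proof -
  have summand: "single v (f v) w p = (\<Sum>\<tau>\<in>interior_edges v.
      1/2 * H v \<tau> p * single v (\<lambda>p. 2 * (normal u \<tau> \<bullet> p) * (normal u \<tau> \<bullet> p)) w p)" for v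
    unfolding f(2) single_sq_comb by (rule sum.cong) (simp_all add: single_def power2_eq_square)
  have "f w p = (\<Sum>v\<in>UNIV. single v (f v) w p)"
    using direct_sum_decomposition[OF finite f(1)] by (metis sum_fun_apply)
  then show ?thesis by (simp only: summand)
qed

lemma zero_sum_in_boundary_image:
  assumes f: "f \<in> direct_sum UNIV (vertex_ideal (e + 2))" and zero_sum: "(\<Sum>v\<in>UNIV. f v) = 0"
  shows "f \<in> boundary_image (e + 2)"
proof -
  have "\<forall>v. \<exists>h. (\<forall>\<tau>. h \<tau> \<in> forms e) \<and> f v = sq_comb u (interior_edges v) h"
    using f by (auto simp: direct_sum_def sq_ideal_forms simp del: add_2_eq_Suc')
  then obtain H where H: "\<And>v \<tau>. H v \<tau> \<in> forms e" "\<And>v. f v = sq_comb u (interior_edges v) (H v)" by metis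
  let ?\<theta> = "\<lambda>\<tau>. theta (normal u \<tau>) (normal u \<tau>)"
    and ?sq = "\<lambda>\<tau> v. single v (\<lambda>p. 2 * (normal u \<tau> \<bullet> p) * (normal u \<tau> \<bullet> p))"
  have "square_coefficients H i j \<in> forms e" for i j
    unfolding square_coefficients_def[abs_def] by (intro forms_sum forms_scale H(1))
  then have "(\<lambda>w p. \<Sum>i\<in>UNIV. \<Sum>j\<in>UNIV. square_coefficients H i j p * theta (axis i 1) (axis j 1) w p)
    \<in> boundary_image (e + 2)"
    using square_coefficients_relation[OF H(2) zero_sum] by (rule quadratic_combination_in_boundary_image)
  then have global: "(\<lambda>w p. \<Sum>v\<in>UNIV. \<Sum>\<tau>\<in>interior_edges v. 1/2 * H v \<tau> p * ?\<theta> \<tau> w p) \<in> boundary_image (e + 2)"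
    unfolding square_coefficients_contract bilinear_eq_sum_axis[OF linear_theta_left linear_theta, symmetric] .
  have "(\<lambda>w p. 1/2 * H v \<tau> p * (?\<theta> \<tau> w p - ?sq \<tau> v w p)) \<in> boundary_image (2 + e)" if "\<tau> \<in> interior_edges v" for v \<tau>
    by (intro boundary_image_mult theta_local normal_perp[OF that] forms_scale H(1))
  then have "(\<lambda>w p. \<Sum>v\<in>UNIV. \<Sum>\<tau>\<in>interior_edges v. 1/2 * H v \<tau> p * (?\<theta> \<tau> w p - ?sq \<tau> v w p))
    \<in> boundary_image (e + 2)"
    by (intro boundary_image_sum) (simp add: add.commute)
  from boundary_image_diff[OF global this]
  have "(\<lambda>w p. \<Sum>v\<in>UNIV. \<Sum>\<tau>\<in>interior_edges v. 1/2 * H v \<tau> p * ?sq \<tau> v w p) \<in> boundary_image (e + 2)"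
    by (simp add: right_diff_distrib sum_subtractf)
  also have "(\<lambda>w p. \<Sum>v\<in>UNIV. \<Sum>\<tau>\<in>interior_edges v. 1/2 * H v \<tau> p * ?sq \<tau> v w p) = f"
    by (intro ext) (rule sum_of_single_squares[OF f H(2), symmetric])
  finally show ?thesis .
qed

end

context closed_rigid_fan
begin

proposition boundary_image_closed:
  "boundary_image d = {f\<in>direct_sum UNIV (vertex_ideal d). (\<Sum>v\<in>UNIV. f v) = 0}"
proof
  show "boundary_image d \<subseteq> {f\<in>direct_sum UNIV (vertex_ideal d). (\<Sum>v\<in>UNIV. f v) = 0}"
    using boundary_image_subset[of d] sum_boundary_map_zero[OF closed]
    by (auto simp: interior_vertices_eq boundary_image_def)
  show "{f\<in>direct_sum UNIV (vertex_ideal d). (\<Sum>v\<in>UNIV. f v) = 0} \<subseteq> boundary_image d"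
  proof
    fix f assume f: "f \<in> {f\<in>direct_sum UNIV (vertex_ideal d). (\<Sum>v\<in>UNIV. f v) = 0}"
    obtain \<Theta> where "local_lift K u \<Theta>"
      using ex_linear_local_lift closed_rigid_fan_axioms by (metis local_lift_axioms_def local_lift_def)
    then interpret local_lift K u \<Theta> .
    show "f \<in> boundary_image d"
    proof (cases "d < 2")
      case True
      then have "f = 0" using f by (auto simp: direct_sum_def sq_ideal_low_degree fun_eq_iff)
      then show ?thesis using ts.subspace_0[OF boundary_image_subspace] by simp
    next
      case False
      then obtain e where "d = e + 2" by (metis le_add_diff_inverse2 not_less)
      then show ?thesis using zero_sum_in_boundary_image f by blast
    qed
  qed
qed

end

section \<open>The cone over the boundary\<close>

lemma coord_poly_case_option:
  assumes "coord_poly P" shows "coord_poly (\<lambda>u. P (case_option p u))"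
  using assms
proof induction
  case (cp_coord v i)
  show ?case by (cases v) (auto intro: coord_poly.intros)
qed (auto intro: coord_poly.intros)

lemma generically_case_option:
  assumes "generically \<phi>" shows "generically (\<lambda>u. \<exists>p. \<phi> (case_option p u))"
proof -
  obtain P w where P: "coord_poly P" "P w \<noteq> 0" "\<And>u. P u \<noteq> 0 \<Longrightarrow> \<phi> u"
    using assms by (auto simp: generically_def)
  let ?Q = "\<lambda>u. P (case_option (w None) u)"
  have "case_option (w None) (\<lambda>v. w (Some v)) = w" by (auto simp: fun_eq_iff split: option.split)
  then have "?Q (\<lambda>v. w (Some v)) \<noteq> 0" using P(2) by simp
  then show ?thesis unfolding generically_def
    using coord_poly_case_option[OF P(1), of "w None"] P(3) by (intro exI[of _ ?Q]) blast
qed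

lemma cycle2_contains_neighbour:
  assumes D: "cycle2 D" "D \<subseteq> S" and e: "card e = 2" "{T\<in>S. e \<subseteq> T} = {T,T'}" and "T \<in> D"
  shows "T' \<in> D"
proof (rule ccontr)
  assume "T' \<notin> D"
  then have "{T\<in>D. e \<subseteq> T} = {T}" using D e(2) \<open>T \<in> D\<close> by blast
  then have "degree2 D e = 1" by (simp add: degree2_def)
  then show False using D(1) e(1) unfolding cycle2_def by (metis odd_one)
qed

definition cone_face :: "'v set \<Rightarrow> 'v option set" where "cone_face \<tau> = insert None (Some ` \<tau>)"

definition cone_complex :: "'v set set \<Rightarrow> 'v option set set" where
  "cone_complex K = (`) Some ` facets K \<union> cone_face ` bdry_2faces K"

lemma Some_image_eq_iff: "Some ` A = Some ` B \<longleftrightarrow> A = B"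
  by (metis inj_Some inj_image_eq_iff)

lemma cone_face_eq_iff: "cone_face A = cone_face B \<longleftrightarrow> A = B"
  unfolding cone_face_def by (subst insert_ident) (auto simp: Some_image_eq_iff)

lemma cone_complex_cases:
  assumes "T \<in> cone_complex K"
  obtains (facet) \<sigma> where "\<sigma> \<in> facets K" "T = Some ` \<sigma>" | (cone) \<tau> where "\<tau> \<in> bdry_2faces K" "T = cone_face \<tau>"
  using assms unfolding cone_complex_def by blast

context pure_fan
begin

lemma cone_complex_card: "T \<in> cone_complex K \<Longrightarrow> card T = 3"
  by (elim cone_complex_cases)
    (auto simp: card_facet card_image cone_face_def bdry_2faces_def card_insert_if image_iff)

lemma cone_faces_over_edge:
  assumes "card \<tau> = 2"
  shows "{T\<in>cone_complex K. Some ` \<tau> \<subseteq> T} = (`) Some ` star \<tau> \<union> (if \<tau> \<in> bdry_2faces K then {cone_face \<tau>} else {})"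
proof -
  have "Some ` \<tau> \<subseteq> Some ` \<sigma> \<longleftrightarrow> \<tau> \<subseteq> \<sigma>" for \<sigma> by auto
  moreover have "Some ` \<tau> \<subseteq> cone_face \<tau>' \<longleftrightarrow> \<tau> = \<tau>'" if "\<tau>' \<in> bdry_2faces K" for \<tau>'
    using that assms card_seteq[of \<tau>' \<tau>] by (auto simp: bdry_2faces_def cone_face_def)
  moreover have "Some ` \<tau> \<subseteq> cone_face \<tau>" by (auto simp: cone_face_def)
  ultimately show ?thesis unfolding cone_complex_def star_def by auto
qed

lemma even_degree_over_edge:
  assumes "card \<tau> = 2" shows "even (degree2 (cone_complex K) (Some ` \<tau>))"
proof -
  have card_image: "card ((`) Some ` star \<tau>) = card (star \<tau>)"
    by (intro card_image inj_onI) (simp add: Some_image_eq_iff)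
  have "cone_face \<tau> \<notin> (`) Some ` star \<tau>" by (auto simp: cone_face_def)
  then have degree: "degree2 (cone_complex K) (Some ` \<tau>) = card (star \<tau>) + (if \<tau> \<in> bdry_2faces K then 1 else 0)"
    unfolding degree2_def cone_faces_over_edge[OF assms] using card_image by simp
  consider "\<tau> \<notin> K" | "\<tau> \<in> bdry_2faces K" | "\<tau> \<in> interior2 K"
    using assms bdry_2faces_iff interior2_iff by blast
  then show ?thesis
  proof cases
    case 1
    then have "star \<tau> = {}" using subface_in_K facet_in_K by (auto simp: star_def)
    then show ?thesis using 1 degree by (simp add: bdry_2faces_iff)
  next
    case 2
    then show ?thesis using degree by (simp add: bdry_2faces_iff)
  next
    case 3
    then obtain a b where "star \<tau> = {a,b}" "a \<noteq> b" using star_interior2 by metis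
    then show ?thesis using degree by (simp add: bdry_2faces_iff)
  qed
qed

lemma even_degree_over_apex_edge: "even (degree2 (cone_complex K) {None, Some v})"
proof -
  have "{T\<in>cone_complex K. {None, Some v} \<subseteq> T} = cone_face ` {\<tau>\<in>bdry_2faces K. v \<in> \<tau>}"
    unfolding cone_complex_def cone_face_def by auto
  moreover have "inj_on cone_face {\<tau>\<in>bdry_2faces K. v \<in> \<tau>}" by (rule inj_onI) (simp add: cone_face_eq_iff)
  ultimately have "degree2 (cone_complex K) {None, Some v} = card {\<tau>\<in>bdry_2faces K. v \<in> \<tau>}"
    by (simp add: degree2_def card_image)
  then show ?thesis using double_count_at_vertex[of v] by presburger
qed

lemma cone_cycle: "cycle2 (cone_complex K)"
  unfolding cycle2_def
proof (intro conjI ballI allI impI cone_complex_card)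
  fix e :: "'v option set" assume e: "card e = 2"
  show "even (degree2 (cone_complex K) e)"
  proof (cases "None \<in> e")
    case True
    then obtain x where x: "e = {None, x}" "x \<noteq> None"
      using e by (metis card_2_iff doubleton_eq_iff insertE singletonD)
    then show ?thesis using even_degree_over_apex_edge by auto
  next
    case False
    then have "e = Some ` (Some -` e)" by (auto simp: image_iff) (metis option.exhaust_sel)
    moreover from this have "card (Some -` e) = 2" using e by (metis card_image inj_Some)
    ultimately show ?thesis using even_degree_over_edge[of "Some -` e"] by metis
  qed
qed

lemma facet_under_cone_face:
  assumes "\<tau> \<in> bdry_2faces K"
  obtains \<sigma> where "\<sigma> \<in> facets K" "{T\<in>cone_complex K. Some ` \<tau> \<subseteq> T} = {Some ` \<sigma>, cone_face \<tau>}"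
proof -
  have \<tau>: "card \<tau> = 2" "card (star \<tau>) = 1" using assms by (auto simp: bdry_2faces_iff)
  then obtain \<sigma> where "star \<tau> = {\<sigma>}" by (auto simp: card_1_singleton_iff)
  moreover from this have "\<sigma> \<in> facets K" by (auto simp: star_def)
  ultimately show ?thesis using that[of \<sigma>] cone_faces_over_edge[OF \<tau>(1)] assms by (simp add: insert_commute)
qed

lemma adjacent_faces_of_cone:
  assumes "x \<in> facets K" "y \<in> facets K" "card (x \<inter> y) = 2"
  shows "{T\<in>cone_complex K. Some ` (x \<inter> y) \<subseteq> T} = {Some ` x, Some ` y}"
  using adjacent_facets[OF assms] cone_faces_over_edge[OF assms(3)] by (auto simp: interior2_iff bdry_2faces_iff)

lemma subcycle_contains_facets:
  assumes D: "cycle2 D" "D \<subseteq> cone_complex K" "D \<noteq> {}" and b: "b \<in> facets K"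
  shows "Some ` b \<in> D"
proof -
  obtain T where T: "T \<in> D" using D(3) by blast
  then have "T \<in> cone_complex K" using D(2) by blast
  then obtain a where a: "a \<in> facets K" "Some ` a \<in> D"
  proof (cases rule: cone_complex_cases)
    case (facet \<sigma>)
    then show ?thesis using that T by blast
  next
    case (cone \<tau>)
    obtain \<sigma> where \<sigma>: "\<sigma> \<in> facets K" "{T\<in>cone_complex K. Some ` \<tau> \<subseteq> T} = {Some ` \<sigma>, cone_face \<tau>}"
      using facet_under_cone_face[OF cone(1)] by blast
    have "card (Some ` \<tau>) = 2" using cone(1) by (simp add: card_image bdry_2faces_iff)
    then have "Some ` \<sigma> \<in> D"
      using cycle2_contains_neighbour[OF D(1,2), of "Some ` \<tau>" T "Some ` \<sigma>"] \<sigma>(2) cone(2) T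
      by (simp add: insert_commute)
    then show ?thesis using that \<sigma>(1) by blast
  qed
  from a(1) b a(2) show ?thesis
  proof (rule facet_induct)
    fix x y assume xy: "x \<in> facets K" "y \<in> facets K" "card (x \<inter> y) = 2" and "Some ` x \<in> D"
    then show "Some ` y \<in> D"
      by (intro cycle2_contains_neighbour[OF D(1,2) _ adjacent_faces_of_cone[OF xy]]) (simp_all add: card_image)
  qed
qed

lemma cone_min_cycle: "min_cycle (cone_complex K)"
  unfolding min_cycle_def
proof (intro conjI allI impI disjCI)
  show "cone_complex K \<noteq> {}" using facets_nonempty by (auto simp: cone_complex_def)
  fix D assume D: "D \<subseteq> cone_complex K" "cycle2 D" "D \<noteq> cone_complex K"
  show "D = {}"
  proof (rule ccontr)
    assume "D \<noteq> {}"
    note facets = subcycle_contains_facets[OF D(2,1) this]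
    have "T \<in> D" if "T \<in> cone_complex K" for T
      using that
    proof (cases rule: cone_complex_cases)
      case (facet \<sigma>)
      then show ?thesis using facets by blast
    next
      case (cone \<tau>)
      obtain \<sigma> where \<sigma>: "\<sigma> \<in> facets K" "{T\<in>cone_complex K. Some ` \<tau> \<subseteq> T} = {Some ` \<sigma>, cone_face \<tau>}"
        using facet_under_cone_face[OF cone(1)] by blast
      then show ?thesis using cone
        by (intro cycle2_contains_neighbour[OF D(2,1) _ _ facets[OF \<sigma>(1)], of "Some ` \<tau>"])
          (simp_all add: card_image bdry_2faces_iff)
    qed
    then show False using D(1,3) by blast
  qed
qed (rule cone_cycle)

lemma Some_edge_in_cone:
  assumes "{Some x, Some y} \<in> edges2 (cone_complex K)" shows "{x,y} \<in> edges"
proof -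
  have "x \<noteq> y" using assms by (auto simp: edges2_def)
  obtain T where T: "T \<in> cone_complex K" "{Some x, Some y} \<subseteq> T" using assms by (auto simp: edges2_def)
  from T(1) have "{x,y} \<in> K"
  proof (cases rule: cone_complex_cases)
    case (facet \<sigma>)
    then show ?thesis using T(2) subface_in_K[OF facet_in_K, of \<sigma> "{x,y}"] by auto
  next
    case (cone \<tau>)
    then show ?thesis using T(2) subface_in_K[of \<tau> "{x,y}"] by (auto simp: bdry_2faces_iff cone_face_def)
  qed
  then show ?thesis using \<open>x \<noteq> y\<close> by (simp add: edges_def)
qed

lemma apex_edge_in_cone: "{Some x, None} \<in> edges2 (cone_complex K) \<Longrightarrow> x \<notin> interior_vertices"
  using interior_vertex_iff by (auto simp: edges2_def cone_complex_def cone_face_def)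

lemma Some_in_cone: "Some x \<in> \<Union>(edges2 (cone_complex K))"
proof -
  obtain \<sigma> where "\<sigma> \<in> facets K" "x \<in> \<sigma>" using ex_facet_containing[OF vertex_in_K[of x]] by auto
  then have "Some x \<in> \<Union>(cone_complex K)" by (auto simp: cone_complex_def)
  then show ?thesis using Union_edges2[of "cone_complex K", OF cone_complex_card] by simp
qed

lemma cone_compatible:
  assumes A: "compatible u edges A" and zero: "\<And>x. x \<notin> interior_vertices \<Longrightarrow> A x = 0"
  shows "compatible (case_option p u) (edges2 (cone_complex K)) (case_option 0 A)"
  unfolding compatible_def
proof (intro allI impI)
  let ?A = "case_option 0 A" and ?u = "case_option p u"
  fix a b assume ab: "{a,b} \<in> edges2 (cone_complex K)"
  show "qf (?A a) (cross3 (?u a) (?u b)) = qf (?A b) (cross3 (?u a) (?u b))"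
  proof (cases a; cases b)
    fix x assume "a = Some x" "b = None"
    then show ?thesis using zero[OF apex_edge_in_cone, of x] ab by simp
  next
    fix x assume "a = None" "b = Some x"
    then show ?thesis using zero[OF apex_edge_in_cone, of x] ab by (simp add: insert_commute)
  next
    fix x y assume "a = Some x" "b = Some y"
    then show ?thesis using compatibleD[OF A Some_edge_in_cone, of x y] ab by simp
  qed simp
qed

lemma interior_rigid_if_cone_rigid:
  assumes rigid: "rigid (case_option p u) (edges2 (cone_complex K))"
    and independent: "triples_independent (case_option p u)" and "bdry_2faces K \<noteq> {}"
  shows "interior_rigid"
  unfolding interior_rigid_def
proof (intro allI impI)
  fix A x assume A: "compatible u edges A" "\<forall>y. y \<notin> interior_vertices \<longrightarrow> A y = 0"
  obtain \<tau> where \<tau>: "\<tau> \<in> bdry_2faces K" using assms(3) by blast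
  then obtain a b where ab: "\<tau> = {a,b}" "a \<noteq> b" by (auto simp: bdry_2faces_def card_2_iff)
  then have "a \<notin> interior_vertices" "b \<notin> interior_vertices" using \<tau> by (auto simp: interior_vertex_iff)
  then have zero: "A a = 0" "A b = 0" using A(2) by blast+
  have "None \<in> \<Union>(cone_complex K)" using \<tau> by (auto simp: cone_complex_def cone_face_def)
  then have apex: "None \<in> \<Union>(edges2 (cone_complex K))"
    using Union_edges2[of "cone_complex K", OF cone_complex_card] by simp
  have triple: "case_option p u None \<bullet> cross3 (case_option p u (Some a)) (case_option p u (Some b)) \<noteq> 0"
    using ab(2) by (intro triples_independentD[OF independent]) simp
  have "agree_on_perp (case_option p u (Some x)) (case_option 0 A (Some x)) 0"
  proof (rule rigid_pinned_zero[OF rigid cone_compatible[OF A(1)] _ triple _ _ _ Some_in_cone])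
    show "{None, Some a, Some b} \<subseteq> \<Union>(edges2 (cone_complex K))" using apex Some_in_cone by simp
  qed (use A(2) zero in simp_all)
  then show "agree_on_perp (u x) (A x) 0" by simp
qed

lemma rigid_if_cone_rigid:
  assumes rigid: "rigid (case_option p u) (edges2 (cone_complex K))" and "bdry_2faces K = {}"
  shows "rigid u edges"
  unfolding rigid_def
proof (intro allI impI)
  fix A assume A: "compatible u edges A"
  have "compatible (case_option p u) (edges2 (cone_complex K)) (case_option 0 A)"
    by (rule cone_compatible[OF A]) (simp add: interior_vertices_closed[OF assms(2)])
  from rigidE[OF rigid this] obtain B where
    "\<And>a. a \<in> \<Union>(edges2 (cone_complex K)) \<Longrightarrow> agree_on_perp (case_option p u a) (case_option 0 A a) B" by blast
  from this[OF Some_in_cone] show "\<exists>B. \<forall>x\<in>\<Union>edges. agree_on_perp (u x) (A x) B" by auto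
qed

end

section \<open>The generic dimension formula\<close>

definition cone_generic :: "'v set set \<Rightarrow> ('v \<Rightarrow> real^3) \<Rightarrow> bool" where
  "cone_generic K u \<longleftrightarrow>
    (\<exists>p. rigid (case_option p u) (edges2 (cone_complex K)) \<and> triples_independent (case_option p u))"

context pure_fan
begin

lemma generically_cone_generic: "generically (cone_generic K)"
  unfolding cone_generic_def[abs_def]
  by (intro generically_case_option generically_conj
    min_cycle_generically_rigid cone_min_cycle generically_triples_independent)

lemma jump_map_in_iff:
  assumes V: "fs.subspace V" and ab: "a \<in> facets K" "b \<in> facets K" "card (a \<inter> b) = 2"
  shows "jump_map F (a \<inter> b) \<in> V \<longleftrightarrow> (\<lambda>p. F a p - F b p) \<in> V"
proof -
  let ?s = "oriented_side a (a \<inter> b)"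
  have jump: "jump_map F (a \<inter> b) = (\<lambda>p. ?s * (F a p - F b p))"
    using adjacent_facets(1)[OF ab] by (simp add: fun_eq_iff jump_map_def jump_adjacent[OF ab])
  have "(\<lambda>p. F a p - F b p) = (\<lambda>p. ?s * jump_map F (a \<inter> b) p)"
    unfolding jump using oriented_side_values[OF ab(1) Int_lower1 ab(3)] by auto
  then show ?thesis using jump fs.subspace_scale[OF V] by metis
qed

lemma C1_eq_splines: "C1 K u d = splines (forms d) (edge_ideal d)"
proof (intro set_eqI iffI)
  have subspace: "fs.subspace (edge_ideal d \<tau>)" for \<tau> by (rule sq_ideal_forms_subspace) simp
  show "F \<in> splines (forms d) (edge_ideal d)" if F: "F \<in> C1 K u d" for F
  proof -
    have "jump_map F \<tau> \<in> edge_ideal d \<tau>" if \<tau>: "\<tau> \<in> interior2 K" for \<tau>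
    proof -
      obtain a b where ab: "a \<in> facets K" "b \<in> facets K" "a \<inter> b = \<tau>" using star_interior2[OF \<tau>] by metis
      then have card2: "card (a \<inter> b) = 2" using \<tau> by (simp add: interior2_iff)
      then have "(\<lambda>p. F a p - F b p) \<in> edge_ideal d \<tau>" using F ab by (auto simp: C1_def forms_diff)
      then show ?thesis using jump_map_in_iff[OF subspace ab(1,2) card2] ab(3) by simp
    qed
    then show ?thesis using F by (auto simp: splines_def direct_sum_def C1_def jump_map_def[abs_def])
  qed
  show "F \<in> C1 K u d" if F: "F \<in> splines (forms d) (edge_ideal d)" for F
  proof -
    have "(\<lambda>p. F a p - F b p) \<in> sq_ideal u {a \<inter> b}" if ab: "a \<in> facets K" "b \<in> facets K" "card (a \<inter> b) = 2" for a b
      using jump_map_in_iff[OF subspace ab, of F] F adjacent_facets(1)[OF ab]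
      by (auto simp: splines_def direct_sum_def)
    then show ?thesis using F by (auto simp: splines_def direct_sum_def C1_def)
  qed
qed

lemma spline_dimension:
  assumes simply_connected: "simply_connected (lk_space K u)"
  shows "int (tdim (C1 K u d)) = int (card (facets K)) * int (fs.dim (forms d))
    - (\<Sum>\<tau>\<in>interior2 K. int (fs.dim (forms d)) - int (fs.dim (edge_ideal d \<tau>)))
    + (int (ts.dim (boundary_map ` direct_sum (interior2 K) (\<lambda>_. forms d))) - int (ts.dim (boundary_image d)))"
proof -
  note count = spline_count[OF simply_connected forms_subspace forms_finite_dim]
  have "ts.dim (C1 K u d) + ts.dim (boundary_image d)
    = fs.dim (forms d) + (\<Sum>\<tau>\<in>interior2 K. fs.dim (edge_ideal d \<tau>))"
    unfolding C1_eq_splines boundary_image_def by (rule count) (simp_all add: sq_ideal_forms_subspace)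
  then have "int (tdim (C1 K u d)) + int (ts.dim (boundary_image d))
      = int (fs.dim (forms d)) + (\<Sum>\<tau>\<in>interior2 K. int (fs.dim (edge_ideal d \<tau>)))"
    unfolding tdim_eq by (simp flip: of_nat_add of_nat_sum)
  moreover have "ts.dim (direct_sum (facets K) (\<lambda>_. forms d)) = card (facets K) * fs.dim (forms d)"
    by (subst direct_sum_dim) (simp_all add: forms_subspace forms_finite_dim)
  then have "card (facets K) * fs.dim (forms d) + ts.dim (boundary_map ` direct_sum (interior2 K) (\<lambda>_. forms d))
      = fs.dim (forms d) + card (interior2 K) * fs.dim (forms d)"
    using count[of "\<lambda>_. forms d" d] by (simp add: splines_without_conditions forms_subspace)
  then have "int (card (facets K)) * int (fs.dim (forms d))
      + int (ts.dim (boundary_map ` direct_sum (interior2 K) (\<lambda>_. forms d)))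
      = int (fs.dim (forms d)) + int (card (interior2 K)) * int (fs.dim (forms d))"
    by (simp flip: of_nat_add of_nat_mult)
  ultimately show ?thesis by (simp add: sum_subtractf)
qed

lemma HF_quot_facet: "\<sigma> \<in> facets K \<Longrightarrow> HF_quot K u \<sigma> d = int (fs.dim (forms d))"
proof -
  have "{\<lambda>p. 0} \<inter> forms d = {0}" using forms_0 by (auto simp: zero_fun_def)
  then show "\<sigma> \<in> facets K \<Longrightarrow> HF_quot K u \<sigma> d = int (fs.dim (forms d))"
    using fs.dim_zero by (simp add: HF_quot_def Jid_def fdim_eq)
qed

lemma HF_quot_nonfacet:
  assumes "card \<gamma> \<noteq> 3"
  shows "HF_quot K u \<gamma> d = int (fs.dim (forms d)) - int (fs.dim (sq_ideal u {\<tau>\<in>interior2 K. \<gamma> \<subseteq> \<tau>} \<inter> forms d))"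
  using assms card_facet by (auto simp: HF_quot_def Jid_def fdim_eq)

lemma HF_quot_edge:
  assumes \<tau>: "\<tau> \<in> interior2 K"
  shows "HF_quot K u \<tau> d = int (fs.dim (forms d)) - int (fs.dim (edge_ideal d \<tau>))"
proof -
  have "\<tau>' = \<tau>" if "\<tau>' \<in> interior2 K" "\<tau> \<subseteq> \<tau>'" for \<tau>'
    using that \<tau> card_seteq[of \<tau>' \<tau>] by (simp add: interior2_iff)
  then have "{\<tau>'\<in>interior2 K. \<tau> \<subseteq> \<tau>'} = {\<tau>}" using \<tau> by blast
  then show ?thesis using HF_quot_nonfacet[of \<tau>] \<tau> by (simp add: interior2_iff)
qed

lemma nonboundary_faces:
  "{A\<in>K. card A = 3 \<and> A \<notin> bdry K} = facets K"
  "{A\<in>K. card A = 2 \<and> A \<notin> bdry K} = interior2 K"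
  "{A\<in>K. card A = 1 \<and> A \<notin> bdry K} = (\<lambda>v. {v}) ` interior_vertices"
  "{A\<in>K. card A = 0 \<and> A \<notin> bdry K} = (if bdry_2faces K = {} then {{}} else {})"
proof -
  have "card A \<le> 2" if "A \<in> bdry K" for A
    using that by (auto simp: bdry_def bdry_2faces_def intro: card_mono[THEN order_trans])
  then show "{A\<in>K. card A = 3 \<and> A \<notin> bdry K} = facets K" using facet_iff by fastforce
  show "{A\<in>K. card A = 1 \<and> A \<notin> bdry K} = (\<lambda>v. {v}) ` interior_vertices"
    using vertex_in_K by (auto simp: interior_vertices_def card_1_singleton_iff)
qed (use empty_in_K in \<open>auto simp: interior2_def bdry_def\<close>)

lemma chi_RJ_eq:
  "chi_RJ K u d = int (card (facets K)) * int (fs.dim (forms d))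
    - (\<Sum>\<tau>\<in>interior2 K. int (fs.dim (forms d)) - int (fs.dim (edge_ideal d \<tau>)))
    + (\<Sum>v\<in>interior_vertices. int (fs.dim (forms d)) - int (fs.dim (vertex_ideal d v)))
    - (if bdry_2faces K = {} then int (fs.dim (forms d)) - int (fs.dim (sq_ideal u (interior2 K) \<inter> forms d))
      else 0)"
proof -
  have "{0..3::nat} = {0,1,2,3}" by auto
  then have "chi_RJ K u d = (\<Sum>\<sigma>\<in>facets K. HF_quot K u \<sigma> d) - (\<Sum>\<tau>\<in>interior2 K. HF_quot K u \<tau> d)
      + (\<Sum>v\<in>interior_vertices. HF_quot K u {v} d) - (if bdry_2faces K = {} then HF_quot K u {} d else 0)"
    using nonboundary_faces by (simp add: chi_RJ_def sum.reindex)
  then show ?thesis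
    by (simp add: HF_quot_facet HF_quot_edge HF_quot_nonfacet interior_edges_def[symmetric])
qed

theorem open_dimension_formula:
  assumes simply_connected: "simply_connected (lk_space K u)" and "bdry_2faces K \<noteq> {}" and rigid: "interior_rigid"
  shows "int (tdim (C1 K u d)) = chi_RJ K u d"
proof -
  have "ts.dim (boundary_image d) = (\<Sum>v\<in>interior_vertices. fs.dim (vertex_ideal d v))"
    unfolding boundary_image_if_interior_rigid[OF rigid]
    by (rule direct_sum_dim) (simp_all add: sq_ideal_forms_subspace sq_ideal_forms_finite_dim)
  moreover have "ts.dim (boundary_map ` direct_sum (interior2 K) (\<lambda>_. forms d))
    = (\<Sum>v\<in>interior_vertices. fs.dim (forms d))"
    unfolding boundary_map_image_open[OF forms_subspace assms(2)]
    by (rule direct_sum_dim) (simp_all add: forms_subspace forms_finite_dim)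
  ultimately show ?thesis
    unfolding spline_dimension[OF simply_connected] chi_RJ_eq using assms(2) by (simp add: sum_subtractf)
qed

end

context closed_rigid_fan
begin

lemma sum_over_vertex_ideals:
  "(\<lambda>f. \<Sum>v\<in>UNIV. f v) ` direct_sum UNIV (vertex_ideal d) = sq_ideal u (interior2 K) \<inter> forms d" (is "?I = ?J")
proof
  have v_subspace: "fs.subspace (vertex_ideal d v)" for v by (rule sq_ideal_forms_subspace) simp
  have J_subspace: "fs.subspace ?J" by (rule sq_ideal_forms_subspace) simp
  have I_subspace: "fs.subspace ?I"
    by (rule tf.linear_subspace_image[OF linear_sum_over direct_sum_subspace]) (rule v_subspace)
  have "vertex_ideal d v \<subseteq> ?J" for v
    using sq_ideal_mono[of "interior2 K" "interior_edges v" u] by (auto simp: interior_edges_def)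
  then show "?I \<subseteq> ?J" by (intro image_subsetI fs.subspace_sum[OF J_subspace]) (auto simp: direct_sum_def)
  have vertex: "f \<in> ?I" if "f \<in> vertex_ideal d v" for f v
  proof (rule image_eqI)
    show "f = (\<Sum>w\<in>UNIV. single v f w)" by (simp add: sum_single)
    show "single v f \<in> direct_sum UNIV (vertex_ideal d)"
      using that by (intro single_in_direct_sum v_subspace) simp_all
  qed
  show "?J \<subseteq> ?I"
  proof
    fix g assume g: "g \<in> ?J"
    from finite g show "g \<in> ?I"
    proof (cases rule: sq_ideal_forms_cases)
      case zero
      then show ?thesis using fs_subspace_pointwise(1)[OF I_subspace] by simp
    next
      case (comb e H)
      have "(\<lambda>p. H \<tau> p * (normal u \<tau> \<bullet> p)\<^sup>2) \<in> ?I" if \<tau>: "\<tau> \<in> interior2 K" for \<tau>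
      proof -
        obtain v where "v \<in> \<tau>" using \<tau> by (auto simp: interior2_iff card_2_iff)
        then have "(\<lambda>p. (normal u \<tau> \<bullet> p)\<^sup>2) \<in> vertex_ideal 2 v"
          using \<tau> by (intro normal_square_in_ideal) (simp_all add: interior_edges_def)
        from sq_ideal_forms_mult[OF finite this comb(2)] show ?thesis
          by (intro vertex[of _ v]) (simp add: comb(1) add.commute)
      qed
      then have "(\<lambda>p. \<Sum>\<tau>\<in>interior2 K. H \<tau> p * (normal u \<tau> \<bullet> p)\<^sup>2) \<in> ?I"
        by (rule fs_subspace_pointwise(5)[OF I_subspace])
      then show ?thesis unfolding comb(3) sq_comb_def[abs_def] by (simp only: mult.commute)
    qed
  qed
qed

theorem closed_dimension_formula:
  assumes simply_connected: "simply_connected (lk_space K u)"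
  shows "int (tdim (C1 K u d)) = chi_RJ K u d"
proof -
  have "ts.dim (boundary_image d) + fs.dim (sq_ideal u (interior2 K) \<inter> forms d)
    = (\<Sum>v\<in>UNIV. fs.dim (vertex_ideal d v))"
    unfolding boundary_image_closed sum_over_vertex_ideals[symmetric]
    by (rule dim_zero_sum) (simp_all add: sq_ideal_forms_subspace sq_ideal_forms_finite_dim)
  then have "int (ts.dim (boundary_image d)) + int (fs.dim (sq_ideal u (interior2 K) \<inter> forms d))
      = (\<Sum>v\<in>UNIV. int (fs.dim (vertex_ideal d v)))"
    by (simp flip: of_nat_add of_nat_sum)
  moreover have "ts.dim (boundary_map ` direct_sum (interior2 K) (\<lambda>_. forms d)) + fs.dim (forms d)
      = (\<Sum>v\<in>(UNIV :: 'v set). fs.dim (forms d))"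
    unfolding boundary_map_image_closed[OF forms_subspace closed]
    using dim_zero_sum[of "UNIV :: 'v set" "\<lambda>_. forms d"]
    by (simp add: sum_over_constant forms_subspace forms_finite_dim)
  then have "int (ts.dim (boundary_map ` direct_sum (interior2 K) (\<lambda>_. forms d))) + int (fs.dim (forms d))
      = (\<Sum>v\<in>(UNIV :: 'v set). int (fs.dim (forms d)))"
    by (simp flip: of_nat_add of_nat_mult)
  ultimately show ?thesis
    unfolding spline_dimension[OF simply_connected] chi_RJ_eq interior_vertices_eq using closed
    by (simp add: sum_subtractf)
qed

end

theorem (in pure_fan) dimension_formula:
  assumes simply_connected: "simply_connected (lk_space K u)" and "cone_generic K u"
  shows "int (tdim (C1 K u d)) = chi_RJ K u d"
proof -
  obtain p where p: "rigid (case_option p u) (edges2 (cone_complex K))" "triples_independent (case_option p u)"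
    using assms(2) unfolding cone_generic_def by blast
  show ?thesis
  proof (cases "bdry_2faces K = {}")
    case True
    have "u x \<bullet> cross3 (u y) (u z) \<noteq> 0" if "distinct [x,y,z]" for x y z
      using triples_independentD[OF p(2), of "Some x" "Some y" "Some z"] that by simp
    then interpret closed_rigid_fan K u
      using rigid_if_cone_rigid[OF p(1) True] True by unfold_locales (simp_all add: triples_independent_def)
    show ?thesis by (rule closed_dimension_formula[OF simply_connected])
  next
    case False
    then show ?thesis by (intro open_dimension_formula[OF simply_connected] interior_rigid_if_cone_rigid[OF p])
  qed
qed

theorem theorem9p9:
  fixes K :: "('v::finite) set set"
  assumes "pure3 K" and "hereditary K"
  shows "\<exists>P. coord_poly P \<and> (\<exists>u. P u \<noteq> 0) \<and>
     (\<forall>u. P u \<noteq> 0 \<longrightarrow> simplicial_fan K u \<longrightarrow> simply_connected (lk_space K u) \<longrightarrow>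
        (\<forall>d. int (tdim (C1 K u d)) = chi_RJ K u d))"
proof (cases "\<exists>u. simplicial_fan K u")
  case False
  then show ?thesis using generically_True unfolding generically_def by blast
next
  case True
  have fan: "pure_fan K u" if "simplicial_fan K u" for u
    using assms that by unfold_locales
  then have "generically (cone_generic K)" using True pure_fan.generically_cone_generic by blast
  then show ?thesis unfolding generically_def using pure_fan.dimension_formula[OF fan] by meson
qed

end
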